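(* Let $\mathfrak{g}=\mathfrak{sl}(2,\mathbb{C})$, and let $\pi_{\Lambda_i}:W^N(\Lambda_i)\to W(\Lambda_i)$ ($i=0,1$) and $\pi_{\Lambda_1}':W^N(\Lambda_1)'\to W(\Lambda_1)$ be the restrictions of the natural surjections $\Pi_{\Lambda_i}:N(\Lambda_i)\to L(\Lambda_i)$ from generalized Verma modules to level $1$ standard $\widehat{\mathfrak{g}}$-modules; let $N^1(\Lambda_i)=\operatorname{Ker}\Pi_{\Lambda_i}$. Then $$\operatorname{Ker}\pi_{\Lambda_0}=I_{\Lambda_0}\cdot v_{\Lambda_0}^N\quad(\subset N^1(\Lambda_0)).$$ Moreover, $$\operatorname{Ker}\pi_{\Lambda_1}'=I_{\Lambda_1}'\cdot v_{\Lambda_1}^N\quad(\subset N^1(\Lambda_1)),$$ or equivalently, $$\operatorname{Ker}\pi_{\Lambda_1}=I_{\Lambda_1}\cdot v_{\Lambda_1}^N\quad(\subset N^1(\Lambda_1)).$$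
   Context: Let $\mathfrak{g}=\mathfrak{sl}(2,\mathbb{C})=\mathbb{C}x_{-\alpha}\oplus\mathbb{C}h\oplus\mathbb{C}x_\alpha$ with $[h,x_{\pm\alpha}]=\pm2x_{\pm\alpha}$, $[x_\alpha,x_{-\alpha}]=h$, and $\langle a,b\rangle=\operatorname{tr}(ab)$. The affine Lie algebra is $\widehat{\mathfrak{g}}=\mathfrak{g}\otimes\mathbb{C}[t,t^{-1}]\oplus\mathbb{C}\mathbf{k}$ with $\mathbf{k}$ central and $[a\otimes t^m,b\otimes t^n]=[a,b]\otimes t^{m+n}+m\langle a,b\rangle\delta_{m+n,0}\mathbf{k}$. Write $a(m)$ for $a\otimes t^m$. Put $\widehat{\mathfrak{g}}_{\ge0}=\mathfrak{g}\otimes\mathbb{C}[t]\oplus\mathbb{C}\mathbf{k}$. For $i=0,1$, $L(\Lambda_i)$ is the irreducible highest weight (standard) $\widehat{\mathfrak{g}}$-module of highest weight $\Lambda_i$, where $\Lambda_i(\mathbf{k})=1$, $\Lambda_i(h)=\delta_{i,1}$, with respect to the triangular decomposition whose positive part is $\mathbb{C}x_\alpha\oplus\mathfrak{g}\otimes t\mathbb{C}[t]$; $v_{\Lambda_i}$ is a highest weight vector. Generalized Verma modules: $N(\Lambda_0)=U(\widehat{\mathfrak{g}})\otimes_{U(\widehat{\mathfrak{g}}_{\ge0})}\mathbb{C}v_{\Lambda_0}^N$, where $\mathfrak{g}\otimes\mathbb{C}[t]$ acts by $0$ and $\mathbf{k}$ by $1$ on $\mathbb{C}v_{\Lambda_0}^N$;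 $N(\Lambda_1)=U(\widehat{\mathfrak{g}})\otimes_{U(\widehat{\mathfrak{g}}_{\ge0})}U$, where $U$ is the two-dimensional irreducible $\mathfrak{g}$-module with highest weight vector $v_{\Lambda_1}^N$, $\mathfrak{g}\otimes t\mathbb{C}[t]$ acts by $0$ and $\mathbf{k}$ by $1$. The natural surjective $\widehat{\mathfrak{g}}$-module map $\Pi_{\Lambda_i}:N(\Lambda_i)\to L(\Lambda_i)$ sends $a\cdot v_{\Lambda_i}^N$ to $a\cdot v_{\Lambda_i}$ for $a\in U(\widehat{\mathfrak{g}})$. Put $\mathfrak{n}=\mathbb{C}x_\alpha$, $\bar{\mathfrak{n}}=\mathfrak{n}\otimes\mathbb{C}[t,t^{-1}]$, $\bar{\mathfrak{n}}_-=\mathfrak{n}\otimes t^{-1}\mathbb{C}[t^{-1}]$, $\bar{\mathfrak{n}}_{\le-2}=\mathfrak{n}\otimes t^{-2}\mathbb{C}[t^{-1}]$; $U(\bar{\mathfrak{n}}_-)=\mathbb{C}[x_\alpha(-1),x_\alpha(-2),\dots]$ and $U(\bar{\mathfrak{n}}_{\le-2})=\mathbb{C}[x_\alpha(-2),x_\alpha(-3),\dots]$ are polynomial algebras. Principal subspaces: $W(\Lambda_i)=U(\bar{\mathfrak{n}})\cdot v_{\Lambda_i}\subset L(\Lambda_i)$ and $W^N(\Lambda_i)=U(\bar{\mathfrak{n}})\cdot v_{\Lambda_i}^N=U(\bar{\mathfrak{n}}_-)\cdot v_{\Lambda_i}^N\subset N(\Lambda_i)$; also $W^N(\Lambda_1)'=U(\bar{\mathfrak{n}}_{\le-2})\cdot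 v_{\Lambda_1}^N$. One has $W(\Lambda_1)=U(\bar{\mathfrak{n}}_{\le-2})\cdot v_{\Lambda_1}$. Define $$R_t^0=\sum_{m_1,m_2\le-1,\ m_1+m_2=-t}x_\alpha(m_1)x_\alpha(m_2)\ (t\ge2),\qquad R_t^1=\sum_{m_1,m_2\le-2,\ m_1+m_2=-t}x_\alpha(m_1)x_\alpha(m_2)\ (t\ge4),$$ (sums over ordered pairs of integers), and $$I_{\Lambda_0}=\sum_{t\ge2}U(\bar{\mathfrak{n}}_-)R_t^0,\qquad I_{\Lambda_1}=\sum_{t\ge2}U(\bar{\mathfrak{n}}_-)R_t^0+U(\bar{\mathfrak{n}}_-)x_\alpha(-1),\qquad I_{\Lambda_1}'=\sum_{t\ge4}U(\bar{\mathfrak{n}}_{\le-2})R_t^1.$$ *)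

theory Defs
  imports "HOL-Analysis.Analysis" "HOL-Library.Poly_Mapping"
begin

section \<open>Complex vector spaces and Lie algebras\<close>

class complex_vs = ab_group_add +
  fixes cscale :: "complex \<Rightarrow> 'a \<Rightarrow> 'a"  (infixr \<open>*\<^sub>C\<close> 75)
  assumes cscale_add_right: "c *\<^sub>C (x + y) = c *\<^sub>C x + c *\<^sub>C y"
    and cscale_add_left: "(c + d) *\<^sub>C x = c *\<^sub>C x + d *\<^sub>C x"
    and cscale_cscale: "c *\<^sub>C (d *\<^sub>C x) = (c * d) *\<^sub>C x"
    and cscale_one: "1 *\<^sub>C x = x"

class lie_algebra = complex_vs +
  fixes lie :: "'a \<Rightarrow> 'a \<Rightarrow> 'a"
  assumes lie_add_left: "lie (x + y) z = lie x z + lie y z"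
    and lie_add_right: "lie x (y + z) = lie x y + lie x z"
    and lie_cscale_left: "lie (c *\<^sub>C x) y = c *\<^sub>C lie x y"
    and lie_cscale_right: "lie x (c *\<^sub>C y) = c *\<^sub>C lie x y"
    and lie_self: "lie x x = 0"
    and lie_jacobi: "lie (lie x y) z + lie (lie y z) x + lie (lie z x) y = 0"

context complex_vs
begin

lemma cscale_zero_right [simp]: "c *\<^sub>C 0 = 0"
  using cscale_add_right[of c 0 0] by simp

lemma cscale_zero_left [simp]: "0 *\<^sub>C x = 0"
  using cscale_add_left[of 0 0 x] by simp

lemma cscale_minus_right: "c *\<^sub>C (- x) = - (c *\<^sub>C x)"
proof -
  have "c *\<^sub>C (- x) + c *\<^sub>C x = 0"
    by (simp flip: cscale_add_right)
  then show ?thesis by (simp add: eq_neg_iff_add_eq_0)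
qed

lemma cscale_minus_left: "(- c) *\<^sub>C x = - (c *\<^sub>C x)"
proof -
  have "(- c) *\<^sub>C x + c *\<^sub>C x = 0"
    by (simp flip: cscale_add_left)
  then show ?thesis by (simp add: eq_neg_iff_add_eq_0)
qed

lemma cscale_diff_right: "c *\<^sub>C (x - y) = c *\<^sub>C x - c *\<^sub>C y"
  using cscale_add_right[of c x "- y"] by (simp add: cscale_minus_right)

lemma cscale_sum_right: "c *\<^sub>C (\<Sum>i\<in>A. f i) = (\<Sum>i\<in>A. c *\<^sub>C f i)"
  by (induction A rule: infinite_finite_induct) (auto simp: cscale_add_right)

end

instantiation complex :: complex_vs
begin
definition cscale_complex :: "complex \<Rightarrow> complex \<Rightarrow> complex" where
  "cscale_complex c z = c * z"
instance by standard (simp_all add: cscale_complex_def algebra_simps)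
end

instantiation poly_mapping :: (type, complex_vs) complex_vs
begin
lift_definition cscale_poly_mapping :: "complex \<Rightarrow> ('a \<Rightarrow>\<^sub>0 'b) \<Rightarrow> ('a \<Rightarrow>\<^sub>0 'b)"
  is "\<lambda>c f k. c *\<^sub>C f k"
proof -
  fix c :: complex and f :: "'a \<Rightarrow> 'b"
  assume "finite {k. f k \<noteq> 0}"
  moreover have "{k. c *\<^sub>C f k \<noteq> 0} \<subseteq> {k. f k \<noteq> 0}" by auto
  ultimately show "finite {k. c *\<^sub>C f k \<noteq> 0}" by (rule rev_finite_subset)
qed
instance
  by standard (transfer, simp add: fun_eq_iff cscale_add_right cscale_add_left cscale_cscale cscale_one)+
end

lemma keys_sum_superset:
  assumes "finite A" "Poly_Mapping.keys p \<subseteq> A" "\<And>k. f k 0 = (0::'c::comm_monoid_add)"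
  shows "(\<Sum>k\<in>Poly_Mapping.keys p. f k (Poly_Mapping.lookup p k)) = (\<Sum>k\<in>A. f k (Poly_Mapping.lookup p k))"
  using assms by (intro sum.mono_neutral_left) (auto simp: in_keys_iff)

lemma keys_sum_add:
  fixes f :: "'k \<Rightarrow> 'b::ab_group_add \<Rightarrow> 'c::ab_group_add"
  assumes f: "\<And>k x y. f k (x + y) = f k x + f k y"
  shows "(\<Sum>k\<in>Poly_Mapping.keys (p + q). f k (Poly_Mapping.lookup (p + q) k)) =
    (\<Sum>k\<in>Poly_Mapping.keys p. f k (Poly_Mapping.lookup p k)) +
    (\<Sum>k\<in>Poly_Mapping.keys q. f k (Poly_Mapping.lookup q k))"
proof -
  let ?A = "Poly_Mapping.keys p \<union> Poly_Mapping.keys q"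
  have f0: "f k 0 = 0" for k using f[of k 0 0] by simp
  have sub: "Poly_Mapping.keys (p + q) \<subseteq> ?A" by (rule Poly_Mapping.keys_add)
  show ?thesis
    using keys_sum_superset[of ?A "p + q" f, OF _ sub f0]
      keys_sum_superset[of ?A p f, OF _ _ f0] keys_sum_superset[of ?A q f, OF _ _ f0]
    by (simp add: f lookup_add sum.distrib)
qed

lemma keys_sum_cscale:
  fixes f :: "'k \<Rightarrow> 'b::complex_vs \<Rightarrow> 'c::complex_vs"
  assumes f: "\<And>k x. f k (c *\<^sub>C x) = c *\<^sub>C f k x"
    and f0: "\<And>k. f k 0 = 0"
  shows "(\<Sum>k\<in>Poly_Mapping.keys (c *\<^sub>C p). f k (Poly_Mapping.lookup (c *\<^sub>C p) k)) =
    c *\<^sub>C (\<Sum>k\<in>Poly_Mapping.keys p. f k (Poly_Mapping.lookup p k))"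
proof -
  have sub: "Poly_Mapping.keys (c *\<^sub>C p) \<subseteq> Poly_Mapping.keys p"
    by (auto simp: in_keys_iff cscale_poly_mapping.rep_eq)
  show ?thesis
    using keys_sum_superset[of "Poly_Mapping.keys p" "c *\<^sub>C p" f, OF finite_keys sub f0]
    by (simp add: cscale_poly_mapping.rep_eq f cscale_sum_right)
qed

lemma poly_mapping_add_induct [case_names zero single add]:
  fixes p :: "'k \<Rightarrow>\<^sub>0 'b::ab_group_add"
  assumes "P 0" "\<And>k b. P (Poly_Mapping.single k b)" "\<And>p q. P p \<Longrightarrow> P q \<Longrightarrow> P (p + q)"
  shows "P p"
proof -
  have "p = (\<Sum>k\<in>Poly_Mapping.keys p. Poly_Mapping.single k (Poly_Mapping.lookup p k))"
    by (rule poly_mapping_eqI)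
      (simp add: lookup_sum lookup_single when_def in_keys_iff)
  moreover have "P (\<Sum>k\<in>A. Poly_Mapping.single k (Poly_Mapping.lookup p k))" if "finite A" for A
    using that by induction (auto intro: assms)
  ultimately show ?thesis by (metis finite_keys)
qed


section \<open>The Lie algebra \<open>sl(2, \<complex>)\<close>\<close>

lemma matrix_distribs:
  fixes A B C :: "complex^2^2"
  shows "(A + B) ** C = A ** C + B ** C" "C ** (A + B) = C ** A + C ** B"
    "(A - B) ** C = A ** C - B ** C" "C ** (A - B) = C ** A - C ** B"
    "(\<chi> i j. c * A $ i $ j) ** B = (\<chi> i j. c * (A ** B) $ i $ j)"
    "A ** (\<chi> i j. c * B $ i $ j) = (\<chi> i j. c * (A ** B) $ i $ j)"
  by (simp_all add: vec_eq_iff matrix_matrix_mult_def sum.distrib sum_subtractf distrib_left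
      distrib_right left_diff_distrib right_diff_distrib sum_distrib_left mult_ac)

lemma trace_scale: "trace (\<chi> i j. c * A $ i $ j) = c * trace (A :: complex^2^2)"
  by (simp add: trace_def sum_2 distrib_left)

typedef sl2 = "{A :: complex^2^2. trace A = 0}"
  morphisms mat_of_sl2 Abs_sl2
  by (rule exI[of _ 0]) (simp add: trace_def)

setup_lifting type_definition_sl2

instantiation sl2 :: lie_algebra
begin
lift_definition zero_sl2 :: sl2 is 0 by (simp add: trace_def)
lift_definition plus_sl2 :: "sl2 \<Rightarrow> sl2 \<Rightarrow> sl2" is "(+)" by (simp add: trace_add)
lift_definition uminus_sl2 :: "sl2 \<Rightarrow> sl2" is uminus by (simp add: trace_def sum_negf)
lift_definition minus_sl2 :: "sl2 \<Rightarrow> sl2 \<Rightarrow> sl2" is "(-)" by (simp add: trace_sub)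
lift_definition cscale_sl2 :: "complex \<Rightarrow> sl2 \<Rightarrow> sl2" is "\<lambda>c A. \<chi> i j. c * A $ i $ j"
  by (simp add: trace_scale)
lift_definition lie_sl2 :: "sl2 \<Rightarrow> sl2 \<Rightarrow> sl2" is "\<lambda>A B. A ** B - B ** A"
  by (metis trace_sub trace_mul_sym diff_self)
instance
proof
  fix X Y Z :: sl2 and c d :: complex
  note rep = mat_of_sl2_inject[symmetric] zero_sl2.rep_eq plus_sl2.rep_eq uminus_sl2.rep_eq
    minus_sl2.rep_eq cscale_sl2.rep_eq lie_sl2.rep_eq
  show "X + Y + Z = X + (Y + Z)" "X + Y = Y + X" "0 + X = X" "- X + X = 0" "X - Y = X + - Y"
    by (simp_all add: rep add_ac)
  show "c *\<^sub>C (X + Y) = c *\<^sub>C X + c *\<^sub>C Y" "(c + d) *\<^sub>C X = c *\<^sub>C X + d *\<^sub>C X"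
    "c *\<^sub>C d *\<^sub>C X = (c * d) *\<^sub>C X" "1 *\<^sub>C X = X"
    by (simp_all add: rep vec_eq_iff distrib_left distrib_right mult.assoc)
  show "lie (X + Y) Z = lie X Z + lie Y Z" "lie X (Y + Z) = lie X Y + lie X Z"
    by (simp_all add: rep matrix_distribs)
  show "lie (c *\<^sub>C X) Y = c *\<^sub>C lie X Y" "lie X (c *\<^sub>C Y) = c *\<^sub>C lie X Y"
    by (simp_all add: rep matrix_distribs) (simp_all add: vec_eq_iff right_diff_distrib)
  show "lie X X = 0" by (simp add: rep)
  show "lie (lie X Y) Z + lie (lie Y Z) X + lie (lie Z X) Y = 0"
    by (simp add: rep matrix_distribs matrix_mul_assoc)
qed
end

lift_definition sl2_h :: sl2 is
  "\<chi> i j. if i = j then (if i = 1 then 1 else - 1) else 0"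
  by (simp add: trace_def sum_2)
lift_definition sl2_xa :: sl2 is "\<chi> i j. if i = 1 \<and> j = 2 then 1 else 0"
  by (simp add: trace_def sum_2)

lift_definition sl2_form :: "sl2 \<Rightarrow> sl2 \<Rightarrow> complex" is "\<lambda>A B. trace (A ** B)" .

lemma sl2_form_add_left: "sl2_form (a + b) c = sl2_form a c + sl2_form b c"
  and sl2_form_add_right: "sl2_form a (b + c) = sl2_form a b + sl2_form a c"
  by (simp_all add: sl2_form.rep_eq plus_sl2.rep_eq matrix_distribs trace_add)

lemma sl2_form_cscale_left: "sl2_form (z *\<^sub>C a) b = z * sl2_form a b"
  and sl2_form_cscale_right: "sl2_form a (z *\<^sub>C b) = z * sl2_form a b"
  by (simp_all only: sl2_form.rep_eq cscale_sl2.rep_eq matrix_distribs trace_scale)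

lemma sl2_form_sym: "sl2_form a b = sl2_form b a"
  unfolding sl2_form.rep_eq by (rule trace_mul_sym)

lemma sl2_form_cyclic: "sl2_form (lie a b) c = sl2_form (lie b c) a"
proof -
  let ?A = "mat_of_sl2 a" and ?B = "mat_of_sl2 b" and ?C = "mat_of_sl2 c"
  have "trace (?A ** ?B ** ?C) = trace (?B ** ?C ** ?A)"
    using trace_mul_sym[of ?A "?B ** ?C"] by (simp add: matrix_mul_assoc)
  moreover have "trace (?B ** ?A ** ?C) = trace (?C ** ?B ** ?A)"
    using trace_mul_sym[of "?B ** ?A" ?C] by (simp add: matrix_mul_assoc)
  ultimately show ?thesis
    by (simp add: sl2_form.rep_eq lie_sl2.rep_eq matrix_distribs trace_sub)
qed


section \<open>The affine Lie algebra\<close>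

text \<open>
  An element of \<open>\<gg> \<otimes> \<complex>[t, t\<^sup>-\<^sup>1] \<oplus> \<complex>k\<close> is a finitely supported family of elements of \<open>sl2\<close>,
  indexed by the exponents of \<open>t\<close>, together with the coefficient of \<open>k\<close>.
\<close>

datatype ghat = Ghat (loop: "int \<Rightarrow>\<^sub>0 sl2") (cen: complex)

abbreviation coef :: "ghat \<Rightarrow> int \<Rightarrow> sl2" where
  "coef X m \<equiv> Poly_Mapping.lookup (loop X) m"

definition loop_bracket :: "(int \<Rightarrow>\<^sub>0 sl2) \<Rightarrow> (int \<Rightarrow>\<^sub>0 sl2) \<Rightarrow> (int \<Rightarrow>\<^sub>0 sl2)" where
  "loop_bracket X Y = (\<Sum>m\<in>Poly_Mapping.keys X. \<Sum>n\<in>Poly_Mapping.keys Y.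
     Poly_Mapping.single (m + n) (lie (Poly_Mapping.lookup X m) (Poly_Mapping.lookup Y n)))"

definition loop_cocycle :: "(int \<Rightarrow>\<^sub>0 sl2) \<Rightarrow> (int \<Rightarrow>\<^sub>0 sl2) \<Rightarrow> complex" where
  "loop_cocycle X Y = (\<Sum>m\<in>Poly_Mapping.keys X.
     of_int m * sl2_form (Poly_Mapping.lookup X m) (Poly_Mapping.lookup Y (- m)))"

lemma lie_zero [simp]: "lie 0 x = 0" "lie x 0 = (0 :: 'a::lie_algebra)"
  using lie_add_left[of 0 0 x] lie_add_right[of x 0 0] by simp_all

lemma sl2_form_zero [simp]: "sl2_form 0 x = 0" "sl2_form x 0 = 0"
  using sl2_form_add_left[of 0 0 x] sl2_form_add_right[of x 0 0] by simp_all

lemma cscale_single: "c *\<^sub>C Poly_Mapping.single k x = Poly_Mapping.single k (c *\<^sub>C x)"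
  by (rule poly_mapping_eqI) (simp add: cscale_poly_mapping.rep_eq lookup_single when_def)

lemma loop_bracket_single:
  "loop_bracket (Poly_Mapping.single m a) (Poly_Mapping.single n b) = Poly_Mapping.single (m + n) (lie a b)"
  by (simp add: loop_bracket_def)

lemma loop_cocycle_single:
  "loop_cocycle (Poly_Mapping.single m a) (Poly_Mapping.single n b) =
    (if m + n = 0 then of_int m * sl2_form a b else 0)"
  by (auto simp: loop_cocycle_def lookup_single when_def)

lemma loop_bracket_add_left: "loop_bracket (X + X') Y = loop_bracket X Y + loop_bracket X' Y"
  unfolding loop_bracket_def
  by (rule keys_sum_add) (simp add: lie_add_left single_add sum.distrib)

lemma loop_bracket_add_right: "loop_bracket X (Y + Y') = loop_bracket X Y + loop_bracket X Y'"
  unfolding loop_bracket_def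
  by (subst keys_sum_add) (simp_all add: lie_add_right single_add sum.distrib)

lemma loop_bracket_cscale_left: "loop_bracket (c *\<^sub>C X) Y = c *\<^sub>C loop_bracket X Y"
  unfolding loop_bracket_def
  by (rule keys_sum_cscale) (simp_all add: lie_cscale_left cscale_sum_right cscale_single)

lemma loop_bracket_cscale_right: "loop_bracket X (c *\<^sub>C Y) = c *\<^sub>C loop_bracket X Y"
  unfolding loop_bracket_def
  by (subst keys_sum_cscale) (simp_all add: lie_cscale_right cscale_sum_right cscale_single)

lemma loop_cocycle_add_left: "loop_cocycle (X + X') Y = loop_cocycle X Y + loop_cocycle X' Y"
  unfolding loop_cocycle_def
  by (rule keys_sum_add) (simp add: sl2_form_add_left algebra_simps)

lemma loop_cocycle_add_right: "loop_cocycle X (Y + Y') = loop_cocycle X Y + loop_cocycle X Y'"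
  unfolding loop_cocycle_def
  by (simp add: lookup_add sl2_form_add_right algebra_simps sum.distrib)

lemma loop_cocycle_cscale_left: "loop_cocycle (c *\<^sub>C X) Y = c * loop_cocycle X Y"
  unfolding loop_cocycle_def cscale_complex_def[symmetric]
  by (rule keys_sum_cscale) (simp_all add: sl2_form_cscale_left cscale_complex_def)

lemma loop_cocycle_cscale_right: "loop_cocycle X (c *\<^sub>C Y) = c * loop_cocycle X Y"
  unfolding loop_cocycle_def
  by (simp add: cscale_poly_mapping.rep_eq sl2_form_cscale_right sum_distrib_left algebra_simps)

lemma loop_zero [simp]:
  "loop_bracket 0 X = 0" "loop_bracket X 0 = 0" "loop_cocycle 0 X = 0" "loop_cocycle X 0 = 0"
  by (simp_all add: loop_bracket_def loop_cocycle_def)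

lemma lie_flip: "lie x y + lie y x = (0 :: 'a::lie_algebra)"
proof -
  have "0 = lie (x + y) (x + y)" by (simp only: lie_self)
  also have "\<dots> = lie x y + lie y x"
    unfolding lie_add_left lie_add_right by (simp add: lie_self add.commute)
  finally show ?thesis by (rule sym)
qed

lemma add_eq_zero_cong2: "a + b = 0 \<Longrightarrow> c + d = 0 \<Longrightarrow> (a + c) + (b + d) = (0::'a::ab_group_add)"
  by (metis add.assoc add.commute add_0)

lemma add_eq_zero_cong3:
  "a + b + c = 0 \<Longrightarrow> d + e + f = 0 \<Longrightarrow> (a + d) + (b + e) + (c + f) = (0::'a::ab_group_add)"
  using add_eq_zero_cong2[of "a + b" c "d + e" f] by (simp add: add_ac)

lemma loop_bracket_flip: "loop_bracket X Y + loop_bracket Y X = 0"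
proof (induction X rule: poly_mapping_add_induct)
  case (single m a)
  show ?case
  proof (induction Y rule: poly_mapping_add_induct)
    case (single n b)
    show ?case by (simp add: loop_bracket_single add.commute[of n m] lie_flip flip: single_add)
  next
    case (add p q)
    from add_eq_zero_cong2[OF add.IH] show ?case
      by (simp only: loop_bracket_add_left loop_bracket_add_right)
  qed simp
next
  case (add p q)
  from add_eq_zero_cong2[OF add.IH] show ?case
    by (simp only: loop_bracket_add_left loop_bracket_add_right)
qed simp

lemma loop_cocycle_flip: "loop_cocycle X Y + loop_cocycle Y X = 0"
proof (induction X rule: poly_mapping_add_induct)
  case (single m a)
  show ?case
  proof (induction Y rule: poly_mapping_add_induct)
    case (single n b)
    show ?case
    proof (cases "m + n = 0")
      case True
      then have "n = - m" by simp
      then show ?thesis by (simp add: loop_cocycle_single sl2_form_sym[of a])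
    qed (simp add: loop_cocycle_single add.commute)
  next
    case (add p q)
    from add_eq_zero_cong2[OF add.IH] show ?case
      by (simp only: loop_cocycle_add_left loop_cocycle_add_right)
  qed simp
next
  case (add p q)
  from add_eq_zero_cong2[OF add.IH] show ?case
    by (simp only: loop_cocycle_add_left loop_cocycle_add_right)
qed simp

lemma loop_bracket_self: "loop_bracket X X = 0"
proof (induction X rule: poly_mapping_add_induct)
  case (add p q)
  then show ?case using loop_bracket_flip[of p q]
    by (simp add: loop_bracket_add_left loop_bracket_add_right add.commute)
qed (simp_all add: loop_bracket_single lie_self)

lemma loop_cocycle_self: "loop_cocycle X X = 0"
  using loop_cocycle_flip[of X X] by simp

lemma loop_jacobi:
  "loop_bracket (loop_bracket X Y) Z + loop_bracket (loop_bracket Y Z) X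
    + loop_bracket (loop_bracket Z X) Y = 0"
proof (induction X rule: poly_mapping_add_induct)
  case (single m a)
  show ?case
  proof (induction Y rule: poly_mapping_add_induct)
    case (single n b)
    show ?case
    proof (induction Z rule: poly_mapping_add_induct)
      case (single p c)
      have "n + p + m = m + n + p" "p + m + n = m + n + p" by simp_all
      then show ?case
        by (simp only: loop_bracket_single lie_jacobi single_zero flip: single_add)
    next
      case (add p q)
      from add_eq_zero_cong3[OF add.IH] show ?case
        by (simp only: loop_bracket_add_left loop_bracket_add_right)
    qed simp
  next
    case (add p q)
    from add_eq_zero_cong3[OF add.IH] show ?case
      by (simp only: loop_bracket_add_left loop_bracket_add_right)
  qed simp
next
  case (add p q)
  from add_eq_zero_cong3[OF add.IH] show ?case
    by (simp only: loop_bracket_add_left loop_bracket_add_right)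
qed simp

lemma loop_cocycle_jacobi:
  "loop_cocycle (loop_bracket X Y) Z + loop_cocycle (loop_bracket Y Z) X
    + loop_cocycle (loop_bracket Z X) Y = 0"
proof (induction X rule: poly_mapping_add_induct)
  case (single m a)
  show ?case
  proof (induction Y rule: poly_mapping_add_induct)
    case (single n b)
    show ?case
    proof (induction Z rule: poly_mapping_add_induct)
      case (single p c)
      have 1: "n + p + m = m + n + p" "p + m + n = m + n + p" by simp_all
      have 2: "sl2_form (lie b c) a = sl2_form (lie a b) c"
        "sl2_form (lie c a) b = sl2_form (lie a b) c"
        by (metis sl2_form_cyclic)+
      show ?case
      proof (cases "m + n + p = 0")
        case True
        have "(of_int (m + n) + of_int (n + p) + of_int (p + m) :: complex) = of_int (2 * (m + n + p))"
          by simp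
        also have "\<dots> = 0" using True by simp
        finally have 3: "(of_int (m + n) + of_int (n + p) + of_int (p + m) :: complex) = 0" .
        show ?thesis using True
          unfolding loop_bracket_single loop_cocycle_single 1 2
          by (simp only: if_True refl 3 mult_zero_left flip: distrib_right)
      qed (simp add: loop_bracket_single loop_cocycle_single 1)
    next
      case (add p q)
      from add_eq_zero_cong3[OF add.IH] show ?case
        by (simp only: loop_bracket_add_left loop_bracket_add_right
            loop_cocycle_add_left loop_cocycle_add_right)
    qed simp
  next
    case (add p q)
    from add_eq_zero_cong3[OF add.IH] show ?case
      by (simp only: loop_bracket_add_left loop_bracket_add_right
          loop_cocycle_add_left loop_cocycle_add_right)
  qed simp
next
  case (add p q)
  from add_eq_zero_cong3[OF add.IH] show ?case
    by (simp only: loop_bracket_add_left loop_bracket_add_right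
        loop_cocycle_add_left loop_cocycle_add_right)
qed simp

instantiation ghat :: lie_algebra
begin
definition zero_ghat :: ghat where "0 = Ghat 0 0"
definition plus_ghat :: "ghat \<Rightarrow> ghat \<Rightarrow> ghat" where
  "X + Y = Ghat (loop X + loop Y) (cen X + cen Y)"
definition uminus_ghat :: "ghat \<Rightarrow> ghat" where
  "- X = Ghat (- loop X) (- cen X)"
definition minus_ghat :: "ghat \<Rightarrow> ghat \<Rightarrow> ghat" where
  "X - Y = Ghat (loop X - loop Y) (cen X - cen Y)"
definition cscale_ghat :: "complex \<Rightarrow> ghat \<Rightarrow> ghat" where
  "c *\<^sub>C X = Ghat (c *\<^sub>C loop X) (c * cen X)"
definition lie_ghat :: "ghat \<Rightarrow> ghat \<Rightarrow> ghat" where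
  "lie X Y = Ghat (loop_bracket (loop X) (loop Y)) (loop_cocycle (loop X) (loop Y))"
instance
proof
  fix X Y Z :: ghat and c d :: complex
  note defs = zero_ghat_def plus_ghat_def uminus_ghat_def minus_ghat_def cscale_ghat_def lie_ghat_def
  show "X + Y + Z = X + (Y + Z)" "X + Y = Y + X" "0 + X = X" "- X + X = 0" "X - Y = X + - Y"
    by (simp_all add: defs add_ac)
  show "c *\<^sub>C (X + Y) = c *\<^sub>C X + c *\<^sub>C Y" "(c + d) *\<^sub>C X = c *\<^sub>C X + d *\<^sub>C X"
    "c *\<^sub>C d *\<^sub>C X = (c * d) *\<^sub>C X" "1 *\<^sub>C X = X"
    by (simp_all add: defs cscale_add_right cscale_add_left cscale_cscale cscale_one
        distrib_left distrib_right)
  show "lie (X + Y) Z = lie X Z + lie Y Z" "lie X (Y + Z) = lie X Y + lie X Z"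
    "lie (c *\<^sub>C X) Y = c *\<^sub>C lie X Y" "lie X (c *\<^sub>C Y) = c *\<^sub>C lie X Y"
    by (simp_all add: defs loop_bracket_add_left loop_bracket_add_right loop_cocycle_add_left
      loop_cocycle_add_right loop_bracket_cscale_left loop_bracket_cscale_right
      loop_cocycle_cscale_left loop_cocycle_cscale_right)
  show "lie X X = 0"
    by (simp add: defs loop_bracket_self loop_cocycle_self)
  show "lie (lie X Y) Z + lie (lie Y Z) X + lie (lie Z X) Y = 0"
    by (simp add: defs loop_jacobi loop_cocycle_jacobi)
qed
end

definition aff :: "sl2 \<Rightarrow> int \<Rightarrow> ghat" where
  "aff a m = Ghat (Poly_Mapping.single m a) 0"

definition ghat_k :: ghat where
  "ghat_k = Ghat 0 1"

lemma lie_aff: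
  "lie (aff a m) (aff b n) =
    aff (lie a b) (m + n) + ((if m + n = 0 then of_int m * sl2_form a b else 0) *\<^sub>C ghat_k)"
  by (simp add: lie_ghat_def aff_def ghat_k_def plus_ghat_def cscale_ghat_def
      loop_bracket_single loop_cocycle_single)

lemma lie_coef_nonneg:
  assumes X: "\<forall>m<0. coef X m = 0" and Y: "\<forall>m<0. coef Y m = 0"
  shows "\<forall>m<0. coef (lie X Y) m = 0"
proof (intro allI impI)
    fix k :: int assume "k < 0"
    have "Poly_Mapping.lookup (Poly_Mapping.single (m + n) (lie (coef X m) (coef Y n))) k = 0" for m n
    proof (cases "m < 0 \<or> n < 0")
      case True
      then show ?thesis using X Y by (auto simp: lookup_single)
    next
      case False
      then show ?thesis using \<open>k < 0\<close> by (auto simp: lookup_single when_def)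
    qed
    then show "coef (lie X Y) k = 0"
      by (simp add: lie_ghat_def loop_bracket_def lookup_sum)
qed

typedef ghat_nonneg = "{X :: ghat. \<forall>m<0. coef X m = 0}"
  morphisms incl_nonneg Abs_ghat_nonneg
  by (rule exI[of _ "Ghat 0 0"]) simp

setup_lifting type_definition_ghat_nonneg

instantiation ghat_nonneg :: lie_algebra
begin
lift_definition zero_ghat_nonneg :: ghat_nonneg is 0 by (simp add: zero_ghat_def)
lift_definition plus_ghat_nonneg :: "ghat_nonneg \<Rightarrow> ghat_nonneg \<Rightarrow> ghat_nonneg" is "(+)"
  by (simp add: plus_ghat_def lookup_add)
lift_definition uminus_ghat_nonneg :: "ghat_nonneg \<Rightarrow> ghat_nonneg" is uminus
  by (simp add: uminus_ghat_def)
lift_definition minus_ghat_nonneg :: "ghat_nonneg \<Rightarrow> ghat_nonneg \<Rightarrow> ghat_nonneg" is "(-)"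
  by (simp add: minus_ghat_def lookup_minus)
lift_definition cscale_ghat_nonneg :: "complex \<Rightarrow> ghat_nonneg \<Rightarrow> ghat_nonneg" is "(*\<^sub>C)"
  by (simp add: cscale_ghat_def cscale_poly_mapping.rep_eq)
lift_definition lie_ghat_nonneg :: "ghat_nonneg \<Rightarrow> ghat_nonneg \<Rightarrow> ghat_nonneg" is lie
  using lie_coef_nonneg by blast
instance
proof
  fix X Y Z :: ghat_nonneg and c d :: complex
  show "X + Y + Z = X + (Y + Z)" by transfer (rule add.assoc)
  show "X + Y = Y + X" by transfer (rule add.commute)
  show "0 + X = X" "- X + X = 0" "X - Y = X + - Y" by (transfer, simp)+
  show "c *\<^sub>C (X + Y) = c *\<^sub>C X + c *\<^sub>C Y" by transfer (rule cscale_add_right)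
  show "(c + d) *\<^sub>C X = c *\<^sub>C X + d *\<^sub>C X" by transfer (rule cscale_add_left)
  show "c *\<^sub>C d *\<^sub>C X = (c * d) *\<^sub>C X" by transfer (rule cscale_cscale)
  show "1 *\<^sub>C X = X" by transfer (rule cscale_one)
  show "lie (X + Y) Z = lie X Z + lie Y Z" by transfer (rule lie_add_left)
  show "lie X (Y + Z) = lie X Y + lie X Z" by transfer (rule lie_add_right)
  show "lie (c *\<^sub>C X) Y = c *\<^sub>C lie X Y" by transfer (rule lie_cscale_left)
  show "lie X (c *\<^sub>C Y) = c *\<^sub>C lie X Y" by transfer (rule lie_cscale_right)
  show "lie X X = 0" by transfer (rule lie_self)
  show "lie (lie X Y) Z + lie (lie Y Z) X + lie (lie Z X) Y = 0" by transfer (rule lie_jacobi)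
qed
end


section \<open>Universal enveloping algebras\<close>

text \<open>
  The free monoid of words: with the unit \<open>[]\<close> and concatenation, \<open>'a list \<Rightarrow>\<^sub>0 complex\<close> with its
  convolution product is the free associative unital complex algebra on the set \<open>'a\<close>.
\<close>

instantiation list :: (type) monoid_add
begin
definition zero_list :: "'a list" where "0 = []"
definition plus_list :: "'a list \<Rightarrow> 'a list \<Rightarrow> 'a list" where "xs + ys = xs @ ys"
instance by standard (simp_all add: zero_list_def plus_list_def)
end

abbreviation word :: "'a list \<Rightarrow> 'a list \<Rightarrow>\<^sub>0 complex" where
  "word w \<equiv> Poly_Mapping.single w 1"

inductive_set uea_ideal :: "('a::lie_algebra list \<Rightarrow>\<^sub>0 complex) set" where
  zero: "0 \<in> uea_ideal"
| add: "p \<in> uea_ideal \<Longrightarrow> q \<in> uea_ideal \<Longrightarrow> p + q \<in> uea_ideal"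
| mult_left: "p \<in> uea_ideal \<Longrightarrow> r * p \<in> uea_ideal"
| mult_right: "p \<in> uea_ideal \<Longrightarrow> p * r \<in> uea_ideal"
| rel_add: "word [x + y] - word [x] - word [y] \<in> uea_ideal"
| rel_cscale: "word [c *\<^sub>C x] - c *\<^sub>C word [x] \<in> uea_ideal"
| rel_lie: "word [x] * word [y] - word [y] * word [x] - word [lie x y] \<in> uea_ideal"

lemma uea_ideal_uminus: "p \<in> uea_ideal \<Longrightarrow> - p \<in> uea_ideal"
  using uea_ideal.mult_left[of p "- 1"] by simp

lemma uea_ideal_diff: "p \<in> uea_ideal \<Longrightarrow> q \<in> uea_ideal \<Longrightarrow> p - q \<in> uea_ideal"
  using uea_ideal.add[of p "- q"] uea_ideal_uminus[of q] by simp

lemma cscale_free_left: "c *\<^sub>C p = Poly_Mapping.single 0 c * (p :: 'a list \<Rightarrow>\<^sub>0 complex)"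
proof (induction p rule: poly_mapping_add_induct)
  case (single k b)
  show ?case by (simp add: cscale_single mult_single cscale_complex_def)
qed (simp_all add: cscale_add_right distrib_left)

lemma uea_ideal_cscale: "p \<in> uea_ideal \<Longrightarrow> c *\<^sub>C p \<in> uea_ideal"
  by (simp add: cscale_free_left uea_ideal.mult_left)

quotient_type (overloaded) 'a uea = "'a::lie_algebra list \<Rightarrow>\<^sub>0 complex" /
  "\<lambda>p q. p - q \<in> uea_ideal"
proof (rule equivpI)
  show "reflp (\<lambda>p q::'a list \<Rightarrow>\<^sub>0 complex. p - q \<in> uea_ideal)"
    by (rule reflpI) (simp add: uea_ideal.zero)
  show "symp (\<lambda>p q::'a list \<Rightarrow>\<^sub>0 complex. p - q \<in> uea_ideal)"
  proof (rule sympI)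
    fix p q :: "'a list \<Rightarrow>\<^sub>0 complex"
    assume "p - q \<in> uea_ideal"
    from uea_ideal_uminus[OF this] show "q - p \<in> uea_ideal" by simp
  qed
  show "transp (\<lambda>p q::'a list \<Rightarrow>\<^sub>0 complex. p - q \<in> uea_ideal)"
  proof (rule transpI)
    fix p q r :: "'a list \<Rightarrow>\<^sub>0 complex"
    assume "p - q \<in> uea_ideal" "q - r \<in> uea_ideal"
    from uea_ideal.add[OF this] show "p - r \<in> uea_ideal" by simp
  qed
qed

lemma abs_rep_uea: "abs_uea (rep_uea u) = u"
  by (rule Quotient3_abs_rep [OF Quotient3_uea])

instantiation uea :: (lie_algebra) "{ring, monoid_mult, complex_vs}"
begin
lift_definition zero_uea :: "'a uea" is 0 .
lift_definition one_uea :: "'a uea" is 1 .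
lift_definition plus_uea :: "'a uea \<Rightarrow> 'a uea \<Rightarrow> 'a uea" is "(+)"
proof -
  fix p p' q q' :: "'a list \<Rightarrow>\<^sub>0 complex"
  assume "p - p' \<in> uea_ideal" "q - q' \<in> uea_ideal"
  from uea_ideal.add[OF this] show "p + q - (p' + q') \<in> uea_ideal" by (simp add: algebra_simps)
qed
lift_definition uminus_uea :: "'a uea \<Rightarrow> 'a uea" is uminus
proof -
  fix p p' :: "'a list \<Rightarrow>\<^sub>0 complex"
  assume "p - p' \<in> uea_ideal"
  from uea_ideal_uminus[OF this] show "- p - - p' \<in> uea_ideal" by simp
qed
lift_definition minus_uea :: "'a uea \<Rightarrow> 'a uea \<Rightarrow> 'a uea" is "(-)"
proof -
  fix p p' q q' :: "'a list \<Rightarrow>\<^sub>0 complex"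
  assume "p - p' \<in> uea_ideal" "q - q' \<in> uea_ideal"
  then have "(p - p') - (q - q') \<in> uea_ideal" by (rule uea_ideal_diff)
  then show "p - q - (p' - q') \<in> uea_ideal" by (simp add: algebra_simps)
qed
lift_definition times_uea :: "'a uea \<Rightarrow> 'a uea \<Rightarrow> 'a uea" is "(*)"
proof -
  fix p p' q q' :: "'a list \<Rightarrow>\<^sub>0 complex"
  assume "p - p' \<in> uea_ideal" "q - q' \<in> uea_ideal"
  then have "(p - p') * q + p' * (q - q') \<in> uea_ideal"
    by (intro uea_ideal.add uea_ideal.mult_left uea_ideal.mult_right)
  then show "p * q - p' * q' \<in> uea_ideal" by (simp add: algebra_simps)
qed
lift_definition cscale_uea :: "complex \<Rightarrow> 'a uea \<Rightarrow> 'a uea" is "(*\<^sub>C)"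
  using uea_ideal_cscale by (simp flip: cscale_diff_right)
instance
proof
  fix u v w :: "'a uea" and c d :: complex
  obtain p where p: "u = abs_uea p" by (rule that [OF abs_rep_uea [symmetric]])
  obtain q where q: "v = abs_uea q" by (rule that [OF abs_rep_uea [symmetric]])
  obtain r where r: "w = abs_uea r" by (rule that [OF abs_rep_uea [symmetric]])
  note abs = p q r zero_uea_def one_uea_def plus_uea.abs_eq uminus_uea.abs_eq minus_uea.abs_eq
    times_uea.abs_eq cscale_uea.abs_eq
  show "u + v + w = u + (v + w)" "u + v = v + u" "0 + u = u" "- u + u = 0" "u - v = u + - v"
    by (simp_all add: abs add_ac)
  show "u * v * w = u * (v * w)" "1 * u = u" "u * 1 = u"
    "(u + v) * w = u * w + v * w" "u * (v + w) = u * v + u * w"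
    by (simp_all add: abs mult.assoc distrib_left distrib_right)
  show "c *\<^sub>C (u + v) = c *\<^sub>C u + c *\<^sub>C v" "(c + d) *\<^sub>C u = c *\<^sub>C u + d *\<^sub>C u"
    "c *\<^sub>C d *\<^sub>C u = (c * d) *\<^sub>C u" "1 *\<^sub>C u = u"
    by (simp_all add: abs cscale_add_right cscale_add_left cscale_cscale cscale_one)
qed
end

lift_definition uea_of :: "'a::lie_algebra \<Rightarrow> 'a uea" is "\<lambda>x. word [x]" .

inductive_set subalgebra :: "'a::lie_algebra uea set \<Rightarrow> 'a uea set" for S where
  gen: "s \<in> S \<Longrightarrow> s \<in> subalgebra S"
| one: "1 \<in> subalgebra S"
| add: "a \<in> subalgebra S \<Longrightarrow> b \<in> subalgebra S \<Longrightarrow> a + b \<in> subalgebra S"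
| cscale: "a \<in> subalgebra S \<Longrightarrow> c *\<^sub>C a \<in> subalgebra S"
| mult: "a \<in> subalgebra S \<Longrightarrow> b \<in> subalgebra S \<Longrightarrow> a * b \<in> subalgebra S"


section \<open>Modules for a Lie algebra\<close>

locale lie_module =
  fixes rho :: "'a::lie_algebra \<Rightarrow> 'v::complex_vs \<Rightarrow> 'v"
  assumes act_add_left: "rho (x + y) v = rho x v + rho y v"
    and act_add_right: "rho x (v + w) = rho x v + rho x w"
    and act_cscale_left: "rho (c *\<^sub>C x) v = c *\<^sub>C rho x v"
    and act_cscale_right: "rho x (c *\<^sub>C v) = c *\<^sub>C rho x v"
    and act_lie: "rho (lie x y) v = rho x (rho y v) - rho y (rho x v)"

definition free_act :: "('a \<Rightarrow> 'v \<Rightarrow> 'v) \<Rightarrow> ('a list \<Rightarrow>\<^sub>0 complex) \<Rightarrow> 'v \<Rightarrow> 'v::complex_vs" where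
  "free_act rho p v = (\<Sum>w\<in>Poly_Mapping.keys p. Poly_Mapping.lookup p w *\<^sub>C foldr rho w v)"

text \<open>
  The action of the enveloping algebra on a module. For a Lie algebra module it does not depend on
  the representative chosen by \<open>rep_uea\<close>, see \<open>uea_act_abs\<close>.
\<close>

definition uea_act :: "('a::lie_algebra \<Rightarrow> 'v \<Rightarrow> 'v) \<Rightarrow> 'a uea \<Rightarrow> 'v \<Rightarrow> 'v::complex_vs" where
  "uea_act rho u v = free_act rho (rep_uea u) v"

lemma free_act_zero [simp]: "free_act rho 0 v = 0"
  by (simp add: free_act_def)

lemma free_act_single: "free_act rho (Poly_Mapping.single w c) v = c *\<^sub>C foldr rho w v"
  by (simp add: free_act_def)

lemma free_act_add: "free_act rho (p + q) v = free_act rho p v + free_act rho q v"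
  unfolding free_act_def by (rule keys_sum_add) (simp add: cscale_add_left)

lemma free_act_uminus: "free_act rho (- p) v = - free_act rho p v"
  using free_act_add[of rho "- p" p v] by (simp add: eq_neg_iff_add_eq_0)

lemma free_act_diff: "free_act rho (p - q) v = free_act rho p v - free_act rho q v"
  using free_act_add[of rho p "- q" v] by (simp add: free_act_uminus)

lemma free_act_cscale: "free_act rho (c *\<^sub>C p) v = c *\<^sub>C free_act rho p v"
  unfolding free_act_def by (rule keys_sum_cscale) (simp_all add: cscale_cscale cscale_complex_def)

context lie_module
begin

lemma foldr_linear:
  "foldr rho w (v + v') = foldr rho w v + foldr rho w v'"
  "foldr rho w (c *\<^sub>C v) = c *\<^sub>C foldr rho w v"
  by (induction w) (simp_all add: act_add_right act_cscale_right)

lemma free_act_add_right: "free_act rho p (v + v') = free_act rho p v + free_act rho p v'"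
  by (simp add: free_act_def foldr_linear cscale_add_right sum.distrib)

lemma free_act_cscale_right: "free_act rho p (c *\<^sub>C v) = c *\<^sub>C free_act rho p v"
  by (simp add: free_act_def foldr_linear cscale_sum_right cscale_cscale mult.commute)

lemma free_act_zero_right [simp]: "free_act rho p 0 = 0"
  using free_act_add_right[of p 0 0] by simp

lemma free_act_mult: "free_act rho (p * q) v = free_act rho p (free_act rho q v)"
proof (induction p rule: poly_mapping_add_induct)
  case (single w c)
  show ?case
  proof (induction q rule: poly_mapping_add_induct)
    case (single w' c')
    show ?case
      by (simp add: mult_single free_act_single plus_list_def foldr_linear cscale_cscale)
  qed (simp_all add: free_act_add free_act_add_right distrib_left)
qed (simp_all add: free_act_add distrib_right)

lemma free_act_ideal: "p \<in> uea_ideal \<Longrightarrow> free_act rho p v = 0"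
proof (induction arbitrary: v rule: uea_ideal.induct)
  case (rel_lie x y)
  then show ?case
    by (simp add: free_act_diff free_act_mult free_act_single cscale_one act_lie)
qed (simp_all add: free_act_add free_act_diff free_act_mult free_act_single cscale_one
      act_add_left act_cscale_left free_act_cscale)

lemma uea_act_abs: "uea_act rho (abs_uea p) v = free_act rho p v"
proof -
  have "rep_uea (abs_uea p) - p \<in> uea_ideal"
    by (rule Quotient3_rep_abs[OF Quotient3_uea]) (simp add: uea_ideal.zero)
  from free_act_ideal[OF this, of v] show ?thesis
    by (simp add: uea_act_def free_act_diff)
qed

end

definition lie_submodule :: "('a::lie_algebra \<Rightarrow> 'v \<Rightarrow> 'v) \<Rightarrow> 'v::complex_vs set \<Rightarrow> bool" where
  "lie_submodule rho S \<longleftrightarrow> 0 \<in> S \<and> (\<forall>v\<in>S. \<forall>w\<in>S. v + w \<in> S) \<and>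
     (\<forall>c. \<forall>v\<in>S. c *\<^sub>C v \<in> S) \<and> (\<forall>x. \<forall>v\<in>S. rho x v \<in> S)"

definition irreducible_module :: "('a::lie_algebra \<Rightarrow> 'v \<Rightarrow> 'v::complex_vs) \<Rightarrow> bool" where
  "irreducible_module rho \<longleftrightarrow> lie_module rho \<and> (UNIV :: 'v set) \<noteq> {0} \<and>
     (\<forall>S. lie_submodule rho S \<longrightarrow> S = {0} \<or> S = UNIV)"

definition ghat_pos :: "ghat set" where
  "ghat_pos = {X. cen X = 0 \<and> (\<forall>m<0. coef X m = 0) \<and> (\<exists>c. coef X 0 = c *\<^sub>C sl2_xa)}"

text \<open>Highest weights \<open>\<Lambda>\<close> are given by the two values \<open>\<Lambda>(h)\<close> and \<open>\<Lambda>(k)\<close>.\<close>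

definition highest_weight_module ::
  "(ghat \<Rightarrow> 'v \<Rightarrow> 'v::complex_vs) \<Rightarrow> complex \<Rightarrow> complex \<Rightarrow> 'v \<Rightarrow> bool" where
  "highest_weight_module rho lam_h lam_k v \<longleftrightarrow> lie_module rho \<and> v \<noteq> 0 \<and>
     (\<forall>X\<in>ghat_pos. rho X v = 0) \<and> rho (aff sl2_h 0) v = lam_h *\<^sub>C v \<and> rho ghat_k v = lam_k *\<^sub>C v \<and>
     {uea_act rho u v | u. True} = UNIV"

text \<open>\<open>is_L i rho v\<close>: the module is \<open>L(\<Lambda>\<^sub>i)\<close> (which is unique up to isomorphism), with highest
  weight vector \<open>v\<close>.\<close>

definition is_L :: "nat \<Rightarrow> (ghat \<Rightarrow> 'v \<Rightarrow> 'v::complex_vs) \<Rightarrow> 'v \<Rightarrow> bool" where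
  "is_L i rho v \<longleftrightarrow> irreducible_module rho \<and>
     highest_weight_module rho (if i = 1 then 1 else 0) 1 v"


section \<open>Generalized Verma modules\<close>

class ghat_nonneg_module = complex_vs +
  fixes nn_act :: "ghat_nonneg \<Rightarrow> 'a \<Rightarrow> 'a"
  assumes nn_act_add_left: "nn_act (x + y) v = nn_act x v + nn_act y v"
    and nn_act_add_right: "nn_act x (v + w) = nn_act x v + nn_act x w"
    and nn_act_cscale_left: "nn_act (c *\<^sub>C x) v = c *\<^sub>C nn_act x v"
    and nn_act_cscale_right: "nn_act x (c *\<^sub>C v) = c *\<^sub>C nn_act x v"
    and nn_act_lie: "nn_act (lie x y) v = nn_act x (nn_act y v) - nn_act y (nn_act x v)"

text \<open>The algebra map \<open>U(\<gg>\<^sub>\<ge>\<^sub>0) \<rightarrow> U(\<gg>)\<close> (for the affine algebras) induced by the inclusion.\<close>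

definition uea_incl :: "ghat_nonneg uea \<Rightarrow> ghat uea" where
  "uea_incl b = uea_act (\<lambda>X u. uea_of (incl_nonneg X) * u) b 1"

text \<open>
  The tensor product of the right module \<open>U(\<gg>)\<close> and a left module over \<open>U(\<gg>\<^sub>\<ge>\<^sub>0)\<close>, as the quotient
  of the free abelian group on pairs by biadditivity and balancedness.
\<close>

inductive_set tensor_rel :: "(ghat uea \<times> 'm::ghat_nonneg_module \<Rightarrow>\<^sub>0 int) set" where
  zero: "0 \<in> tensor_rel"
| add: "x \<in> tensor_rel \<Longrightarrow> y \<in> tensor_rel \<Longrightarrow> x + y \<in> tensor_rel"
| uminus: "x \<in> tensor_rel \<Longrightarrow> - x \<in> tensor_rel"
| add_left: "frag_of (u + u', m) - frag_of (u, m) - frag_of (u', m) \<in> tensor_rel"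
| add_right: "frag_of (u, m + m') - frag_of (u, m) - frag_of (u, m') \<in> tensor_rel"
| balanced: "frag_of (u * uea_incl b, m) - frag_of (u, uea_act nn_act b m) \<in> tensor_rel"

lemma tensor_rel_diff: "x \<in> tensor_rel \<Longrightarrow> y \<in> tensor_rel \<Longrightarrow> x - y \<in> tensor_rel"
  using tensor_rel.add[of x "- y"] tensor_rel.uminus[of y] by simp

quotient_type (overloaded) 'm induced = "ghat uea \<times> 'm::ghat_nonneg_module \<Rightarrow>\<^sub>0 int" /
  "\<lambda>x y. x - y \<in> tensor_rel"
proof (rule equivpI)
  show "reflp (\<lambda>x y::ghat uea \<times> 'm \<Rightarrow>\<^sub>0 int. x - y \<in> tensor_rel)"
    by (rule reflpI) (simp add: tensor_rel.zero)
  show "symp (\<lambda>x y::ghat uea \<times> 'm \<Rightarrow>\<^sub>0 int. x - y \<in> tensor_rel)"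
  proof (rule sympI)
    fix x y :: "ghat uea \<times> 'm \<Rightarrow>\<^sub>0 int"
    assume "x - y \<in> tensor_rel"
    from tensor_rel.uminus[OF this] show "y - x \<in> tensor_rel" by simp
  qed
  show "transp (\<lambda>x y::ghat uea \<times> 'm \<Rightarrow>\<^sub>0 int. x - y \<in> tensor_rel)"
  proof (rule transpI)
    fix x y r :: "ghat uea \<times> 'm \<Rightarrow>\<^sub>0 int"
    assume "x - y \<in> tensor_rel" "y - r \<in> tensor_rel"
    from tensor_rel.add[OF this] show "x - r \<in> tensor_rel" by simp
  qed
qed

lemma abs_rep_induced: "abs_induced (rep_induced n) = n"
  by (rule Quotient3_abs_rep [OF Quotient3_induced])

instantiation induced :: (ghat_nonneg_module) ab_group_add
begin
lift_definition zero_induced :: "'a induced" is 0 .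
lift_definition plus_induced :: "'a induced \<Rightarrow> 'a induced \<Rightarrow> 'a induced" is "(+)"
proof -
  fix x x' y y' :: "ghat uea \<times> 'a \<Rightarrow>\<^sub>0 int"
  assume "x - x' \<in> tensor_rel" "y - y' \<in> tensor_rel"
  from tensor_rel.add[OF this] show "x + y - (x' + y') \<in> tensor_rel" by (simp add: algebra_simps)
qed
lift_definition uminus_induced :: "'a induced \<Rightarrow> 'a induced" is uminus
proof -
  fix x x' :: "ghat uea \<times> 'a \<Rightarrow>\<^sub>0 int"
  assume "x - x' \<in> tensor_rel"
  from tensor_rel.uminus[OF this] show "- x - - x' \<in> tensor_rel" by simp
qed
lift_definition minus_induced :: "'a induced \<Rightarrow> 'a induced \<Rightarrow> 'a induced" is "(-)"
proof -
  fix x x' y y' :: "ghat uea \<times> 'a \<Rightarrow>\<^sub>0 int"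
  assume "x - x' \<in> tensor_rel" "y - y' \<in> tensor_rel"
  then have "(x - x') - (y - y') \<in> tensor_rel" by (rule tensor_rel_diff)
  then show "x - y - (x' - y') \<in> tensor_rel" by (simp add: algebra_simps)
qed
instance
proof
  fix u v w :: "'a induced"
  obtain p where p: "u = abs_induced p" by (rule that [OF abs_rep_induced [symmetric]])
  obtain q where q: "v = abs_induced q" by (rule that [OF abs_rep_induced [symmetric]])
  obtain r where r: "w = abs_induced r" by (rule that [OF abs_rep_induced [symmetric]])
  note abs = p q r zero_induced_def plus_induced.abs_eq uminus_induced.abs_eq minus_induced.abs_eq
  show "u + v + w = u + (v + w)" "u + v = v + u" "0 + u = u" "- u + u = 0" "u - v = u + - v"
    by (simp_all add: abs add_ac)
qed
end

definition tensor :: "ghat uea \<Rightarrow> 'm \<Rightarrow> 'm::ghat_nonneg_module induced" where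
  "tensor u m = abs_induced (frag_of (u, m))"

text \<open>Left multiplication \<open>u \<cdot> (u' \<otimes> m) = u u' \<otimes> m\<close>, see \<open>umult_tensor\<close>.\<close>

definition umult :: "ghat uea \<Rightarrow> 'm induced \<Rightarrow> 'm::ghat_nonneg_module induced"  (infixr \<open>\<cdot>\<close> 70) where
  "u \<cdot> n = abs_induced (frag_extend (\<lambda>(u', m). frag_of (u * u', m)) (rep_induced n))"

lemma tensor_rel_mult_left:
  "x \<in> tensor_rel \<Longrightarrow> frag_extend (\<lambda>(u', m). frag_of (u * u', m)) x \<in> tensor_rel"
  by (induction rule: tensor_rel.induct)
    (auto simp: frag_extend_add frag_extend_minus frag_extend_diff distrib_left
      simp flip: mult.assoc intro: tensor_rel.intros)

lemma umult_abs:
  "u \<cdot> abs_induced x = abs_induced (frag_extend (\<lambda>(u', m). frag_of (u * u', m)) x)"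
proof -
  have "rep_induced (abs_induced x) - x \<in> tensor_rel"
    by (rule Quotient3_rep_abs[OF Quotient3_induced]) (simp add: tensor_rel.zero)
  from tensor_rel_mult_left[OF this, of u] show ?thesis
    by (simp add: umult_def induced.abs_eq_iff frag_extend_diff)
qed

lemma umult_tensor: "u \<cdot> tensor u' m = tensor (u * u') m"
  by (simp add: tensor_def umult_abs)

lemma umult_add: "u \<cdot> (x + y) = u \<cdot> x + u \<cdot> y"
proof -
  obtain a where "x = abs_induced a" by (rule that [OF abs_rep_induced [symmetric]])
  moreover obtain b where "y = abs_induced b" by (rule that [OF abs_rep_induced [symmetric]])
  ultimately show ?thesis
    by (simp add: umult_abs plus_induced.abs_eq frag_extend_add)
qed

text \<open>
  The modules inducing \<open>N(\<Lambda>\<^sub>0)\<close> and \<open>N(\<Lambda>\<^sub>1)\<close>: \<open>\<complex>\<close>, on which only \<open>k\<close> acts, and \<open>\<complex>\<^sup>2\<close>, the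
  natural \<open>sl2\<close>-module, on which \<open>a \<otimes> t\<^sup>m\<close> with \<open>m > 0\<close> acts by 0.
\<close>

typedef top0 = "UNIV :: complex set" ..
typedef top1 = "UNIV :: (complex^2) set" ..

setup_lifting type_definition_top0
setup_lifting type_definition_top1

lemma lie_nonneg_degree_zero:
  assumes "\<forall>m<0. coef X m = 0" "\<forall>m<0. coef Y m = 0"
  shows "coef (lie X Y) 0 = lie (coef X 0) (coef Y 0)" "cen (lie X Y) = 0"
proof -
  let ?f = "\<lambda>m n. Poly_Mapping.lookup (Poly_Mapping.single (m + n) (lie (coef X m) (coef Y n))) 0"
  have f: "?f m n = (if m = 0 \<and> n = 0 then lie (coef X 0) (coef Y 0) else 0)" for m n
  proof (cases "m < 0 \<or> n < 0")
    case True
    then show ?thesis using assms by (auto simp: lookup_single)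
  next
    case False
    then show ?thesis by (auto simp: lookup_single when_def)
  qed
  have "coef (lie X Y) 0 = (\<Sum>m\<in>Poly_Mapping.keys (loop X). \<Sum>n\<in>Poly_Mapping.keys (loop Y). ?f m n)"
    by (simp add: lie_ghat_def loop_bracket_def lookup_sum)
  also have "\<dots> = (\<Sum>m\<in>insert 0 (Poly_Mapping.keys (loop X)). \<Sum>n\<in>insert 0 (Poly_Mapping.keys (loop Y)). ?f m n)"
    by (auto simp: sum.insert_if lookup_single in_keys_iff)
  also have "\<dots> = (\<Sum>m\<in>insert 0 (Poly_Mapping.keys (loop X)). if m = 0 then lie (coef X 0) (coef Y 0) else 0)"
  proof (rule sum.cong [OF refl])
    fix m assume "m \<in> insert 0 (Poly_Mapping.keys (loop X))"
    have "(\<Sum>n\<in>insert 0 (Poly_Mapping.keys (loop Y)). ?f m n) =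
      (\<Sum>n\<in>insert 0 (Poly_Mapping.keys (loop Y)). if n = 0 then (if m = 0 then lie (coef X 0) (coef Y 0) else 0) else 0)"
      by (rule sum.cong [OF refl]) (auto simp: f)
    also have "\<dots> = (if m = 0 then lie (coef X 0) (coef Y 0) else 0)"
      by (subst sum.delta) auto
    finally show "(\<Sum>n\<in>insert 0 (Poly_Mapping.keys (loop Y)). ?f m n) = (if m = 0 then lie (coef X 0) (coef Y 0) else 0)" .
  qed
  also have "\<dots> = lie (coef X 0) (coef Y 0)"
    by (subst sum.delta) auto
  finally show "coef (lie X Y) 0 = lie (coef X 0) (coef Y 0)" .
  have "of_int m * sl2_form (coef X m) (coef Y (- m)) = 0" for m
    using assms by (cases m "0 :: int" rule: linorder_cases) simp_all
  then show "cen (lie X Y) = 0"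
    unfolding lie_ghat_def loop_cocycle_def ghat.sel by (intro sum.neutral ballI)
qed

lemma coef_lie_nonneg:
  "coef (lie (incl_nonneg X) (incl_nonneg Y)) 0 = lie (coef (incl_nonneg X) 0) (coef (incl_nonneg Y) 0)"
  and cen_lie_nonneg: "cen (lie (incl_nonneg X) (incl_nonneg Y)) = 0"
  using lie_nonneg_degree_zero incl_nonneg by blast+

instantiation top0 :: ghat_nonneg_module
begin
lift_definition zero_top0 :: top0 is 0 .
lift_definition plus_top0 :: "top0 \<Rightarrow> top0 \<Rightarrow> top0" is "(+)" .
lift_definition uminus_top0 :: "top0 \<Rightarrow> top0" is uminus .
lift_definition minus_top0 :: "top0 \<Rightarrow> top0 \<Rightarrow> top0" is "(-)" .
lift_definition cscale_top0 :: "complex \<Rightarrow> top0 \<Rightarrow> top0" is "(*)" .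
lift_definition nn_act_top0 :: "ghat_nonneg \<Rightarrow> top0 \<Rightarrow> top0" is "\<lambda>X z. cen X * z" .
instance
proof
  fix v w z :: top0 and c d :: complex and X Y :: ghat_nonneg
  note rep = Rep_top0_inject[symmetric] zero_top0.rep_eq plus_top0.rep_eq uminus_top0.rep_eq
    minus_top0.rep_eq cscale_top0.rep_eq nn_act_top0.rep_eq
  note nn = plus_ghat_nonneg.rep_eq cscale_ghat_nonneg.rep_eq lie_ghat_nonneg.rep_eq
    plus_ghat_def cscale_ghat_def
  show "v + w + z = v + (w + z)" "v + w = w + v" "0 + v = v" "- v + v = 0" "v - w = v + - w"
    by (simp_all add: rep add_ac)
  show "c *\<^sub>C (v + w) = c *\<^sub>C v + c *\<^sub>C w" "(c + d) *\<^sub>C v = c *\<^sub>C v + d *\<^sub>C v"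
    "c *\<^sub>C d *\<^sub>C v = (c * d) *\<^sub>C v" "1 *\<^sub>C v = v"
    by (simp_all add: rep algebra_simps)
  show "nn_act (X + Y) v = nn_act X v + nn_act Y v" "nn_act X (v + w) = nn_act X v + nn_act X w"
    "nn_act (c *\<^sub>C X) v = c *\<^sub>C nn_act X v" "nn_act X (c *\<^sub>C v) = c *\<^sub>C nn_act X v"
    by (simp_all add: rep nn algebra_simps)
  show "nn_act (lie X Y) v = nn_act X (nn_act Y v) - nn_act Y (nn_act X v)"
    by (simp add: rep nn cen_lie_nonneg algebra_simps)
qed
end

instantiation top1 :: ghat_nonneg_module
begin
lift_definition zero_top1 :: top1 is 0 .
lift_definition plus_top1 :: "top1 \<Rightarrow> top1 \<Rightarrow> top1" is "(+)" .
lift_definition uminus_top1 :: "top1 \<Rightarrow> top1" is uminus .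
lift_definition minus_top1 :: "top1 \<Rightarrow> top1 \<Rightarrow> top1" is "(-)" .
lift_definition cscale_top1 :: "complex \<Rightarrow> top1 \<Rightarrow> top1" is "(*s)" .
lift_definition nn_act_top1 :: "ghat_nonneg \<Rightarrow> top1 \<Rightarrow> top1" is
  "\<lambda>X w. mat_of_sl2 (coef X 0) *v w + cen X *s w" .
instance
proof
  fix v w z :: top1 and c d :: complex and X Y :: ghat_nonneg
  note rep = Rep_top1_inject[symmetric] zero_top1.rep_eq plus_top1.rep_eq uminus_top1.rep_eq
    minus_top1.rep_eq cscale_top1.rep_eq nn_act_top1.rep_eq
  note nn = plus_ghat_nonneg.rep_eq cscale_ghat_nonneg.rep_eq lie_ghat_nonneg.rep_eq
    plus_ghat_def cscale_ghat_def lookup_add cscale_poly_mapping.rep_eq plus_sl2.rep_eq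
    cscale_sl2.rep_eq
  note comps = vec_eq_iff forall_2 sum_2 matrix_vector_mult_def matrix_matrix_mult_def
  show "v + w + z = v + (w + z)" "v + w = w + v" "0 + v = v" "- v + v = 0" "v - w = v + - w"
    by (simp_all add: rep add_ac)
  show "c *\<^sub>C (v + w) = c *\<^sub>C v + c *\<^sub>C w" "(c + d) *\<^sub>C v = c *\<^sub>C v + d *\<^sub>C v"
    "c *\<^sub>C d *\<^sub>C v = (c * d) *\<^sub>C v" "1 *\<^sub>C v = v"
    by (simp_all add: rep vec_eq_iff algebra_simps)
  show "nn_act (X + Y) v = nn_act X v + nn_act Y v" "nn_act X (v + w) = nn_act X v + nn_act X w"
    "nn_act (c *\<^sub>C X) v = c *\<^sub>C nn_act X v" "nn_act X (c *\<^sub>C v) = c *\<^sub>C nn_act X v"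
    by (simp_all add: rep nn comps algebra_simps)
  show "nn_act (lie X Y) v = nn_act X (nn_act Y v) - nn_act Y (nn_act X v)"
    by (simp add: rep lie_ghat_nonneg.rep_eq coef_lie_nonneg cen_lie_nonneg lie_sl2.rep_eq)
      (simp add: comps algebra_simps)
qed
end

type_synonym N0 = "top0 induced"
type_synonym N1 = "top1 induced"

definition vN0 :: N0 where "vN0 = tensor 1 (Abs_top0 1)"
definition vN1 :: N1 where "vN1 = tensor 1 (Abs_top1 (axis 1 1))"

text \<open>The natural map \<open>\<Pi>\<close> from a generalized Verma module (generated by \<open>vN\<close>) to \<open>L\<close>,
  \<open>a \<cdot> vN \<mapsto> a \<cdot> v\<close>.\<close>

definition Pi_map ::
  "'m::ghat_nonneg_module induced \<Rightarrow> (ghat \<Rightarrow> 'v \<Rightarrow> 'v::complex_vs) \<Rightarrow> 'v \<Rightarrow> 'm induced \<Rightarrow> 'v" where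
  "Pi_map vN rho v n = (THE w. \<exists>a. n = a \<cdot> vN \<and> w = uea_act rho a v)"


section \<open>Principal subspaces and ideals\<close>

definition xa :: "int \<Rightarrow> ghat uea" where
  "xa m = uea_of (aff sl2_xa m)"

definition U_nbar :: "ghat uea set" where
  "U_nbar = subalgebra (range xa)"
definition U_nbar_minus :: "ghat uea set" where
  "U_nbar_minus = subalgebra {xa m | m. m \<le> - 1}"
definition U_nbar_le_m2 :: "ghat uea set" where
  "U_nbar_le_m2 = subalgebra {xa m | m. m \<le> - 2}"

definition principal_subspace :: "(ghat \<Rightarrow> 'v \<Rightarrow> 'v::complex_vs) \<Rightarrow> 'v \<Rightarrow> 'v set" where
  "principal_subspace rho v = (\<lambda>a. uea_act rho a v) ` U_nbar"

abbreviation act_on :: "ghat uea set \<Rightarrow> 'm::ghat_nonneg_module induced \<Rightarrow> 'm induced set"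
    (infixr \<open>\<cdot>\<cdot>\<close> 70) where
  "A \<cdot>\<cdot> n \<equiv> (\<lambda>a. a \<cdot> n) ` A"

definition WN0 :: "N0 set" where "WN0 = U_nbar \<cdot>\<cdot> vN0"
definition WN1 :: "N1 set" where "WN1 = U_nbar \<cdot>\<cdot> vN1"
definition WN1' :: "N1 set" where "WN1' = U_nbar_le_m2 \<cdot>\<cdot> vN1"

definition R0 :: "int \<Rightarrow> ghat uea" where
  "R0 t = (\<Sum>(m1, m2) | m1 \<le> - 1 \<and> m2 \<le> - 1 \<and> m1 + m2 = - t. xa m1 * xa m2)"
definition R1 :: "int \<Rightarrow> ghat uea" where
  "R1 t = (\<Sum>(m1, m2) | m1 \<le> - 2 \<and> m2 \<le> - 2 \<and> m1 + m2 = - t. xa m1 * xa m2)"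

definition I_0 :: "ghat uea set" where
  "I_0 = {\<Sum>t\<in>T. a t * R0 t | T a. finite T \<and> T \<subseteq> {2..} \<and> (\<forall>t\<in>T. a t \<in> U_nbar_minus)}"
definition I_1 :: "ghat uea set" where
  "I_1 = {r + a * xa (- 1) | r a. r \<in> I_0 \<and> a \<in> U_nbar_minus}"
definition I_1' :: "ghat uea set" where
  "I_1' = {\<Sum>t\<in>T. a t * R1 t | T a. finite T \<and> T \<subseteq> {4..} \<and> (\<forall>t\<in>T. a t \<in> U_nbar_le_m2)}"

text \<open>The kernel of the restriction of \<open>f\<close> to \<open>A\<close>.\<close>

definition Ker_on :: "'a set \<Rightarrow> ('a \<Rightarrow> 'b::zero) \<Rightarrow> 'a set" where
  "Ker_on A f = {n \<in> A. f n = 0}"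

end

theory Submission
  imports Defs "HOL-Library.Multiset"
begin

text \<open>
  Write \<open>x(m)\<close>, \<open>f(m)\<close> for the modes of \<open>x\<^sub>\<alpha>\<close>, \<open>x\<^sub>-\<^sub>\<alpha>\<close>. Only spanning arguments in the universal objects and an annihilator computation in \<open>L(\<Lambda>\<^sub>i)\<close> are
  needed, not the PBW theorem. The Sugawara operator supplies the missing grading of \<open>L(\<Lambda>\<^sub>i)\<close>, so that
  singular vectors of positive depth vanish; this yields \<open>f(0) v = 0\<close> and, inductively,
  \<open>R\<^sub>t\<^sup>0 v = 0\<close> for \<open>v = v\<^sub>\<Lambda>\<^sub>0\<close>, since \<open>f(1) R\<^sub>t\<^sub>+\<^sub>1\<^sup>0 v = f(0) R\<^sub>t\<^sup>0 v\<close>.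

  Conversely let \<open>p\<close> be a polynomial in the \<open>x(-j)\<close>, \<open>j > 0\<close>, homogeneous of degree \<open>r\<close>, with \<open>p v = 0\<close>,
  and argue by induction on its weight. By Newton's identities the operators \<open>h(i)\<close>, \<open>i > 0\<close>, turn
  \<open>p v = 0\<close> into \<open>p' v = 0\<close>, where \<open>p'\<close> arises from \<open>p\<close> by the index shift \<open>x(m) \<mapsto> x(m + 1)\<close>; this
  replaces the intertwining operators of the usual proof. As \<open>x(0) v = 0\<close>, the induction hypothesis
  applies to the part of \<open>p\<close> without \<open>x(-1)\<close> and reduces \<open>p\<close>, modulo the \<open>R\<^sub>t\<^sup>0\<close>, to a
  polynomial \<open>g x(-1)\<close> in which \<open>g\<close> involves only \<open>x(-3), x(-4), \<dots>\<close>. The spectral flow by 2 makes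
  \<open>x(-1) v\<close> a vacuum vector, so the induction hypothesis applies to \<open>g\<close> as well. The spectral flow by
  1 turns \<open>L(\<Lambda>\<^sub>1)\<close> into a module of type \<open>L(\<Lambda>\<^sub>0)\<close> with vacuum vector \<open>v\<^sub>\<Lambda>\<^sub>1\<close>.
\<close>

section \<open>Level one modules and the Sugawara operator\<close>

global_interpretation cvs: vector_space "cscale :: complex \<Rightarrow> 'v \<Rightarrow> 'v::complex_vs"
  by standard (simp_all add: cscale_add_right cscale_add_left cscale_cscale cscale_one)

lemma cscale_two: "2 *\<^sub>C (u::'v::complex_vs) = u + u"
  using cscale_add_left[of 1 1 u] by (simp add: cscale_one)

text \<open>Stated for mode families rather than a representation of \<open>ghat\<close>, so that a
  spectral flow, which re-indexes modes and corrects \<open>h 0\<close> by a scalar, gives another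
  instance on the same space. The central element appears as the scalar 1, the level.\<close>

locale level_one_ops =
  fixes e f h :: "int \<Rightarrow> 'v \<Rightarrow> 'v::complex_vs"
  assumes e_add: "e m (u + w) = e m u + e m w" and e_cscale: "e m (c *\<^sub>C u) = c *\<^sub>C e m u"
    and f_add: "f m (u + w) = f m u + f m w" and f_cscale: "f m (c *\<^sub>C u) = c *\<^sub>C f m u"
    and h_add: "h m (u + w) = h m u + h m w" and h_cscale: "h m (c *\<^sub>C u) = c *\<^sub>C h m u"
    and ee: "e m (e n u) = e n (e m u)"
    and ff: "f m (f n u) = f n (f m u)"
    and ef: "e m (f n u) = f n (e m u) + h (m + n) u + (if m + n = 0 then of_int m else 0) *\<^sub>C u"
    and he: "h m (e n u) = e n (h m u) + 2 *\<^sub>C e (m + n) u"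
    and hf: "h m (f n u) = f n (h m u) - 2 *\<^sub>C f (m + n) u"
    and hh: "h m (h n u) = h n (h m u) + (if m + n = 0 then 2 * of_int m else 0) *\<^sub>C u"
    and irred: "\<lbrakk>0 \<in> S; \<And>u w. u \<in> S \<Longrightarrow> w \<in> S \<Longrightarrow> u + w \<in> S; \<And>c u. u \<in> S \<Longrightarrow> c *\<^sub>C u \<in> S;
      \<And>m u. u \<in> S \<Longrightarrow> e m u \<in> S; \<And>m u. u \<in> S \<Longrightarrow> f m u \<in> S; \<And>m u. u \<in> S \<Longrightarrow> h m u \<in> S\<rbrakk>
      \<Longrightarrow> S = {0} \<or> S = UNIV"
begin

lemma zero [simp]: "e m 0 = 0" "f m 0 = 0" "h m 0 = 0"
  using e_cscale[of m 0 0] f_cscale[of m 0 0] h_cscale[of m 0 0] by simp_all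

lemma minus: "e m (- u) = - e m u" "f m (- u) = - f m u" "h m (- u) = - h m u"
  using e_cscale[of m "-1" u] f_cscale[of m "-1" u] h_cscale[of m "-1" u]
  by (simp_all add: cvs.scale_minus_left cscale_one)

lemma diff: "e m (u - w) = e m u - e m w" "f m (u - w) = f m u - f m w" "h m (u - w) = h m u - h m w"
  using e_add[of m u "- w"] f_add[of m u "- w"] h_add[of m u "- w"] by (simp_all add: minus)

lemma sum: "e m (\<Sum>i\<in>A. g i) = (\<Sum>i\<in>A. e m (g i))" "f m (\<Sum>i\<in>A. g i) = (\<Sum>i\<in>A. f m (g i))"
  "h m (\<Sum>i\<in>A. g i) = (\<Sum>i\<in>A. h m (g i))"
  by (induction A rule: infinite_finite_induct; simp add: e_add f_add h_add)+

lemmas lin = e_add e_cscale f_add f_cscale h_add h_cscale minus diff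

text \<open>The elements \<open>e 0\<close>, \<open>f 1\<close>, \<open>f 0\<close>, \<open>e (-1)\<close> are the Chevalley generators.\<close>

lemma irred_generators:
  assumes 0: "0 \<in> S" and add: "\<And>u w. u \<in> S \<Longrightarrow> w \<in> S \<Longrightarrow> u + w \<in> S"
    and sc: "\<And>c u. u \<in> S \<Longrightarrow> c *\<^sub>C u \<in> S"
    and e0: "\<And>u. u \<in> S \<Longrightarrow> e 0 u \<in> S" and f1: "\<And>u. u \<in> S \<Longrightarrow> f 1 u \<in> S"
    and f0: "\<And>u. u \<in> S \<Longrightarrow> f 0 u \<in> S" and em: "\<And>u. u \<in> S \<Longrightarrow> e (-1) u \<in> S"
  shows "S = {0} \<or> S = UNIV"
proof -
  have sub: "u - w \<in> S" if "u \<in> S" "w \<in> S" for u w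
    using add[OF that(1) sc[OF that(2), of "-1"]] by (simp add: cvs.scale_minus_left cscale_one)
  have h1: "h 1 u \<in> S" if "u \<in> S" for u
  proof -
    have "h 1 u = e 0 (f 1 u) - f 1 (e 0 u)" by (simp add: ef)
    then show ?thesis using that by (simp add: sub e0 f1)
  qed
  have h0: "h 0 u \<in> S" if "u \<in> S" for u
  proof -
    have "h 0 u = e 0 (f 0 u) - f 0 (e 0 u)" by (simp add: ef)
    then show ?thesis using that by (simp add: sub e0 f0)
  qed
  have hm: "h (-1) u \<in> S" if "u \<in> S" for u
  proof -
    have "h (-1) u = e (-1) (f 0 u) - f 0 (e (-1) u)" by (simp add: ef)
    then show ?thesis using that by (simp add: sub em f0)
  qed
  have step_e: "e (m + n) u \<in> S" if "u \<in> S" "\<And>u. u \<in> S \<Longrightarrow> e n u \<in> S" "\<And>u. u \<in> S \<Longrightarrow> h m u \<in> S" for m n u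
  proof -
    have "e (m + n) u = (1/2) *\<^sub>C (h m (e n u) - e n (h m u))"
      by (simp add: he cscale_cscale cscale_one)
    then show ?thesis using that by (simp add: sub sc)
  qed
  have step_f: "f (m + n) u \<in> S" if "u \<in> S" "\<And>u. u \<in> S \<Longrightarrow> f n u \<in> S" "\<And>u. u \<in> S \<Longrightarrow> h m u \<in> S" for m n u
  proof -
    have "f (m + n) u = (1/2) *\<^sub>C (f n (h m u) - h m (f n u))"
      by (simp add: hf cscale_cscale cscale_one)
    then show ?thesis using that by (simp add: sub sc)
  qed
  have e: "e m u \<in> S" if "u \<in> S" for m u
    using that
  proof (induction m arbitrary: u rule: int_induct[where k = 0])
    case (step1 i)
    then show ?case using step_e[of u i 1] h1 by (simp add: add.commute)
  next
    case (step2 i)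
    then show ?case using step_e[of u i "-1"] hm by simp
  qed (simp add: e0)
  have f: "f m u \<in> S" if "u \<in> S" for m u
    using that
  proof (induction m arbitrary: u rule: int_induct[where k = 0])
    case (step1 i)
    then show ?case using step_f[of u i 1] h1 by (simp add: add.commute)
  next
    case (step2 i)
    then show ?case using step_f[of u i "-1"] hm by simp
  qed (simp add: f0)
  have h: "h m u \<in> S" if "u \<in> S" for m u
  proof (cases "m = 0")
    case False
    then have "h m u = e m (f 0 u) - f 0 (e m u)" by (simp add: ef)
    then show ?thesis using that by (simp add: sub e f)
  qed (simp add: h0 that)
  show ?thesis by (rule irred) (fact 0 add sc e f h)+
qed

section \<open>Singular vectors and vectors killed by all high modes\<close>

definition singular :: "complex \<Rightarrow> 'v \<Rightarrow> bool" where
  "singular \<mu> w \<longleftrightarrow> e 0 w = 0 \<and> f 1 w = 0 \<and> h 0 w = \<mu> *\<^sub>C w"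

text \<open>The commutator of \<open>e 0\<close> and \<open>f 1\<close> is \<open>h 1\<close>, and
  brackets with \<open>h 1\<close> raise the index of \<open>e\<close> and \<open>f\<close> by one.
  The zero vector counts as singular, so that the vanishing of a singular vector can be a conclusion
  later.\<close>

lemma singular_pos:
  assumes "singular \<mu> w"
  shows "m \<ge> 0 \<Longrightarrow> e m w = 0" "m \<ge> 1 \<Longrightarrow> f m w = 0" "m \<ge> 1 \<Longrightarrow> h m w = 0"
proof -
  have e0: "e 0 w = 0" and f1: "f 1 w = 0" using assms by (auto simp: singular_def)
  have h1: "h 1 w = 0" using ef[of 0 1 w] e0 f1 by simp
  show e: "e m w = 0" if "m \<ge> 0" for m
    using that
  proof (induction m rule: int_ge_induct)
    case (step i)
    then show ?case using he[of 1 i w] h1 by (simp add: add.commute)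
  qed (fact e0)
  show "f m w = 0" if "m \<ge> 1"
    using that
  proof (induction m rule: int_ge_induct)
    case (step i)
    then show ?case using hf[of 1 i w] h1 by (simp add: add.commute)
  qed (fact f1)
  show "h m w = 0" if "m \<ge> 1"
    using ef[of "m - 1" 1 w] e[of "m - 1"] f1 that by simp
qed

definition killed_above :: "int \<Rightarrow> 'v \<Rightarrow> bool" where
  "killed_above N u \<longleftrightarrow> N \<ge> 1 \<and> (\<forall>n\<ge>N. e n u = 0 \<and> f n u = 0 \<and> h n u = 0)"

lemma killed_aboveD:
  assumes "killed_above N u" "n \<ge> N"
  shows "e n u = 0" "f n u = 0" "h n u = 0"
  using assms by (auto simp: killed_above_def)

lemma killed_above_mono: "killed_above N u \<Longrightarrow> N \<le> N' \<Longrightarrow> killed_above N' u"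
  by (auto simp: killed_above_def)

lemma killed_above_add: "killed_above N u \<Longrightarrow> killed_above N w \<Longrightarrow> killed_above N (u + w)"
  by (auto simp: killed_above_def lin)

text \<open>Moving a mode \<open>n\<close> past a mode \<open>m\<close> leaves the modes
  \<open>n\<close> and \<open>m + n\<close> on \<open>u\<close>. The bound makes both at least
  \<open>N\<close>, and \<open>N \<ge> 1\<close> excludes \<open>m + n = 0\<close>, so no central
  term appears.\<close>

lemma killed_above_ops:
  assumes "killed_above N u"
  shows "killed_above (N + 1 + \<bar>m\<bar>) (e m u)" "killed_above (N + 1 + \<bar>m\<bar>) (f m u)"
    "killed_above (N + 1 + \<bar>m\<bar>) (h m u)"
proof -
  have N: "N \<ge> 1" using assms by (simp add: killed_above_def)
  have z: "e n u = 0 \<and> f n u = 0 \<and> h n u = 0 \<and> e (n+m) u = 0 \<and> f (n+m) u = 0 \<and> h (n+m) u = 0 \<and> e (m+n) u = 0 \<and> f (m+n) u = 0 \<and> h (m+n) u = 0 \<and> n + m \<noteq> 0 \<and> m + n \<noteq> 0"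
    if "n \<ge> N + 1 + \<bar>m\<bar>" for n
    using assms that by (auto simp: killed_above_def)
  have fe: "f n (e m u) = e m (f n u) - h (m + n) u - (if m + n = 0 then of_int m else 0) *\<^sub>C u" for n
    by (simp add: ef)
  have eh: "e n (h m u) = h m (e n u) - 2 *\<^sub>C e (m + n) u" for n
    by (simp add: he)
  have fh: "f n (h m u) = h m (f n u) + 2 *\<^sub>C f (m + n) u" for n
    by (simp add: hf)
  show "killed_above (N + 1 + \<bar>m\<bar>) (e m u)"
    unfolding killed_above_def using N z by (simp add: ee[of _ m] fe he)
  show "killed_above (N + 1 + \<bar>m\<bar>) (f m u)"
    unfolding killed_above_def using N z by (simp add: ff[of _ m] ef hf)
  show "killed_above (N + 1 + \<bar>m\<bar>) (h m u)"
    unfolding killed_above_def using N z by (simp add: eh fh hh[of _ m])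
qed

section \<open>The Sugawara operator\<close>

definition sug_term :: "int \<Rightarrow> 'v \<Rightarrow> 'v" where
  "sug_term n u = e (-n) (f n u) + e (-n) (f n u) + f (-n) (e n u) + f (-n) (e n u) + h (-n) (h n u)"

lemma fe: "f n (e m u) = e m (f n u) - h (m + n) u - (if m + n = 0 then of_int m else 0) *\<^sub>C u"
  and eh: "e n (h m u) = h m (e n u) - 2 *\<^sub>C e (m + n) u"
  and fh: "f n (h m u) = h m (f n u) + 2 *\<^sub>C f (m + n) u"
  by (simp_all add: ef he hf)

lemma sug_term_f0: "f 0 (sug_term n u) = sug_term n (f 0 u)"
  unfolding sug_term_def
  by (simp add: lin fe[of 0] fh[of 0] ff[of 0] cscale_two algebra_simps)

text \<open>Chosen so that the commutator of \<open>e (-1)\<close> with \<open>sug_term n\<close> is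
  a difference of consecutive values, up to a central term at \<open>n = 1\<close>; summation over
  \<open>n\<close> then telescopes.\<close>

definition e_defect :: "int \<Rightarrow> 'v \<Rightarrow> 'v" where
  "e_defect n u = 2 *\<^sub>C (e (- n) (h (n - 1) u) - h (- n) (e (n - 1) u))"

lemma sug_term_em1:
  assumes "n \<ge> 0"
  shows "e (-1) (sug_term n u) = sug_term n (e (-1) u) + e_defect n u - e_defect (n + 1) u
    - (if n = 1 then 2 *\<^sub>C e (-1) u else 0)"
proof -
  have c: "- n - 1 = - 1 - n" "n + 1 \<noteq> 0" using assms by auto
  show ?thesis
  unfolding sug_term_def e_defect_def using c
  by (simp add: lin ef[of "-1"] eh[of "-1"] ee[of "-1"] cscale_two cvs.scale_minus_left cscale_one algebra_simps)
qed

lemma sug_term_add: "sug_term n (u + w) = sug_term n u + sug_term n w"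
  by (simp add: sug_term_def lin algebra_simps)

lemma sug_term_cscale: "sug_term n (c *\<^sub>C u) = c *\<^sub>C sug_term n u"
  by (simp add: sug_term_def lin cscale_add_right)

text \<open>For the trace form the Casimir element is ef + fe + hh/2, and \<open>sug_term\<close>
  carries twice it. Normal ordering folds the terms for n and -n into one, hence the factor 2. As
  the Sugawara denominator at level 1 is 2 (1 + 2), the untruncated sum is 12 L(0).\<close>

definition sug :: "nat \<Rightarrow> 'v \<Rightarrow> 'v" where
  "sug N u = sug_term 0 u + 2 *\<^sub>C (\<Sum>n=1..N. sug_term (int n) u)"

lemma sug_em1:
  assumes "killed_above (int N) u"
  shows "e (-1) (sug N u) = sug N (e (-1) u) - 12 *\<^sub>C e (-1) u"
proof -
  have N: "N \<ge> 1" using assms by (simp add: killed_above_def)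
  have "(\<Sum>n=1..N. e (-1) (sug_term (int n) u)) =
    (\<Sum>n=1..N. sug_term (int n) (e (-1) u)) + (\<Sum>n=1..N. e_defect (int n) u - e_defect (int (n+1)) u)
    - (\<Sum>n=1..N. if n = 1 then 2 *\<^sub>C e (-1) u else 0)"
    unfolding sum.distrib[symmetric] sum_subtractf[symmetric]
    by (rule sum.cong) (auto simp: sug_term_em1 add.commute)
  also have "(\<Sum>n=1..N. e_defect (int n) u - e_defect (int (n+1)) u) = e_defect 1 u - e_defect (int N + 1) u"
    using N by (induction N rule: dec_induct) (simp_all add: add.commute)
  also have "e_defect (int N + 1) u = 0"
    using killed_aboveD[OF assms, of "int N"] by (simp add: e_defect_def)
  also have "(\<Sum>n=1..N. if n = 1 then 2 *\<^sub>C e (-1) u else 0) = 2 *\<^sub>C e (-1) u"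
    using N by (simp add: sum.delta)
  finally have s: "(\<Sum>n=1..N. e (-1) (sug_term (int n) u)) =
    (\<Sum>n=1..N. sug_term (int n) (e (-1) u)) + e_defect 1 u - 2 *\<^sub>C e (-1) u" by simp
  \<comment> \<open>\<open>sug_term 0\<close> counts once and the other terms twice, so telescoping
    leaves this sum. Its 8 comes from the dual Coxeter number 2 and the further 4 below from the
    level: 4 (1 + 2) = 12.\<close>
  have d: "e_defect 0 u + e_defect 1 u = - (8 *\<^sub>C e (-1) u)"
  proof -
    have "e_defect 0 u + e_defect 1 u = - (2 *\<^sub>C (2 *\<^sub>C e (-1) u + 2 *\<^sub>C e (-1) u))"
      by (simp add: e_defect_def eh cscale_two algebra_simps)
    also have "\<dots> = - (8 *\<^sub>C e (-1) u)"
      by (simp add: cscale_cscale flip: cscale_add_left)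
    finally show ?thesis .
  qed
  have "e (-1) (sug N u) = e (-1) (sug_term 0 u) + 2 *\<^sub>C (\<Sum>n=1..N. e (-1) (sug_term (int n) u))"
    by (simp add: sug_def lin sum)
  also have "\<dots> = sug N (e (-1) u) + (e_defect 0 u + e_defect 1 u) - (2 *\<^sub>C 2 *\<^sub>C e (-1) u)"
    unfolding s by (simp add: sug_def sug_term_em1 cscale_two algebra_simps)
  also have "\<dots> = sug N (e (-1) u) - (8 *\<^sub>C e (-1) u + 4 *\<^sub>C e (-1) u)"
    unfolding d by (simp add: cscale_cscale algebra_simps)
  also have "\<dots> = sug N (e (-1) u) - 12 *\<^sub>C e (-1) u"
    by (simp flip: cscale_add_left)
  finally show ?thesis .
qed

end

section \<open>Highest weight modules and the grading operator\<close>

locale level_one_hw = level_one_ops e f h for e f h :: "int \<Rightarrow> 'v \<Rightarrow> 'v::complex_vs" +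
  fixes v :: 'v and lam :: complex
  assumes v_nonzero: "v \<noteq> 0" and v_singular: "singular lam v" and lam_sq: "lam * lam = lam"
begin

lemma cyclic:
  assumes "v \<in> S" "0 \<in> S" "\<And>u w. u \<in> S \<Longrightarrow> w \<in> S \<Longrightarrow> u + w \<in> S" "\<And>c u. u \<in> S \<Longrightarrow> c *\<^sub>C u \<in> S"
    "\<And>m u. u \<in> S \<Longrightarrow> e m u \<in> S" "\<And>m u. u \<in> S \<Longrightarrow> f m u \<in> S" "\<And>m u. u \<in> S \<Longrightarrow> h m u \<in> S"
  shows "u \<in> S"
  using irred[of S] assms v_nonzero by auto

text \<open>The vectors killed by all high modes form a submodule containing \<open>v\<close>. Hence
  the infinite Sugawara sum is finite on every vector, and \<open>sug_op\<close> below does not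
  depend on the truncation chosen.\<close>

lemma restricted: "\<exists>N. killed_above N u"
proof -
  have "u \<in> {u. \<exists>N. killed_above N u}"
  proof (rule cyclic)
    show "v \<in> {u. \<exists>N. killed_above N u}"
      using singular_pos[OF v_singular] by (auto simp: killed_above_def intro!: exI[of _ 1])
    show "u + w \<in> {u. \<exists>N. killed_above N u}"
      if "u \<in> {u. \<exists>N. killed_above N u}" "w \<in> {u. \<exists>N. killed_above N u}" for u w
    proof -
      from that obtain N N' where "killed_above N u" "killed_above N' w" by auto
      then have "killed_above (max N N') (u + w)"
        by (intro killed_above_add) (auto elim: killed_above_mono)
      then show ?thesis by auto
    qed
  qed (auto simp: killed_above_def[of _ 0] killed_above_def[of _ "_ *\<^sub>C _"] lin
      dest: killed_aboveD intro: killed_above_ops, auto simp: killed_above_def)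
  then show ?thesis by simp
qed

definition sug_op :: "'v \<Rightarrow> 'v" where
  "sug_op u = sug (SOME N. killed_above (int N) u) u"

lemma restricted_nat: "\<exists>N. killed_above (int N) u"
proof -
  obtain N where "killed_above N u" using restricted by blast
  moreover from this have "N = int (nat N)" by (simp add: killed_above_def)
  ultimately show ?thesis by metis
qed

lemma sug_mono:
  assumes "killed_above (int N) u" "N \<le> M"
  shows "sug M u = sug N u"
  using assms(2)
proof (induction M rule: dec_induct)
  case (step n)
  have "sug_term (int (Suc n)) u = 0"
    using killed_aboveD[OF assms(1), of "int (Suc n)"] step by (simp add: sug_term_def)
  then show ?case using step by (simp add: sug_def)
qed simp

lemma sug_op_eq: "killed_above (int N) u \<Longrightarrow> sug_op u = sug N u"
proof -
  assume N: "killed_above (int N) u"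
  define M where "M = (SOME N. killed_above (int N) u)"
  have M: "killed_above (int M) u"
    unfolding M_def by (rule someI_ex[OF restricted_nat])
  have "sug M u = sug N u"
    using sug_mono[OF N, of M] sug_mono[OF M, of N] by (cases "N \<le> M") auto
  then show ?thesis by (simp add: sug_op_def M_def)
qed

lemma restricted_common: "\<exists>N. \<forall>u\<in>set us. killed_above (int N) u"
proof (induction us)
  case (Cons a us)
  then obtain N M where "\<forall>u\<in>set us. killed_above (int N) u" "killed_above (int M) a"
    using restricted_nat by blast
  then have "\<forall>u\<in>set (a # us). killed_above (int (max N M)) u"
    using killed_above_mono[of "int N" _ "int (max N M)"] killed_above_mono[of "int M" _ "int (max N M)"]
    by simp
  then show ?case by blast
qed simp

lemma sug_op_add: "sug_op (u + w) = sug_op u + sug_op w"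
proof -
  obtain N where "\<forall>x\<in>set [u, w, u + w]. killed_above (int N) x" using restricted_common by blast
  then show ?thesis
    by (simp add: sug_op_eq[of N] sug_def sug_term_add sum.distrib cscale_add_right algebra_simps)
qed

lemma sug_op_cscale: "sug_op (c *\<^sub>C u) = c *\<^sub>C sug_op u"
proof -
  obtain N where "\<forall>x\<in>set [u, c *\<^sub>C u]. killed_above (int N) x" using restricted_common by blast
  then show ?thesis
    by (simp add: sug_op_eq[of N] sug_def sug_term_cscale cscale_add_right cscale_cscale
        mult.commute flip: cscale_sum_right)
qed

text \<open>A multiple of the principal grading operator, shifted so that the eigenvalue on the highest
  weight vectors of weights 0 and 1 is 0.\<close>

definition grading_op :: "'v \<Rightarrow> 'v" where
  "grading_op u = 3 *\<^sub>C h 0 u - sug_op u"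

lemma grading_op_add: "grading_op (u + w) = grading_op u + grading_op w"
  by (simp add: grading_op_def lin sug_op_add cscale_add_right)

lemma grading_op_cscale: "grading_op (c *\<^sub>C u) = c *\<^sub>C grading_op u"
  by (simp add: grading_op_def lin sug_op_cscale cscale_diff_right cscale_cscale mult.commute)

lemma grading_op_f0: "grading_op (f 0 u) = f 0 (grading_op u) - 6 *\<^sub>C f 0 u"
proof -
  obtain N where "\<forall>x\<in>set [u, f 0 u]. killed_above (int N) x" using restricted_common by blast
  then have "sug_op (f 0 u) = f 0 (sug_op u)"
    by (simp add: sug_op_eq[of N] sug_def sug_term_f0 lin sum)
  then show ?thesis
    by (simp add: grading_op_def lin hf cscale_diff_right cscale_cscale)
qed

lemma grading_op_em1: "grading_op (e (-1) u) = e (-1) (grading_op u) - 6 *\<^sub>C e (-1) u"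
proof -
  obtain N where "\<forall>x\<in>set [u, e (-1) u]. killed_above (int N) x" using restricted_common by blast
  then have "sug_op (e (-1) u) = e (-1) (sug_op u) + 12 *\<^sub>C e (-1) u"
    using sug_em1[of N u] by (simp add: sug_op_eq[of N])
  then have "grading_op (e (-1) u) = e (-1) (grading_op u) + (6 *\<^sub>C e (-1) u - 12 *\<^sub>C e (-1) u)"
    by (simp add: grading_op_def lin he cscale_add_right cscale_cscale)
  also have "12 *\<^sub>C e (-1) u = 6 *\<^sub>C e (-1) u + 6 *\<^sub>C e (-1) u"
    by (simp flip: cscale_add_left)
  finally show ?thesis by simp
qed

text \<open>On a singular vector only \<open>sug_term 0\<close> contributes, so the weight alone
  determines the eigenvalue: 3 \<mu> minus 2 \<mu> + \<mu> * \<mu>.\<close>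

lemma grading_op_singular:
  assumes "singular \<mu> w"
  shows "grading_op w = (\<mu> - \<mu> * \<mu>) *\<^sub>C w"
proof -
  have k: "killed_above (int 1) w"
    using singular_pos[OF assms] by (auto simp: killed_above_def)
  have z: "e 0 w = 0" "f 1 w = 0" "h 1 w = 0" "e 1 w = 0" "h 0 w = \<mu> *\<^sub>C w"
    using singular_pos[OF assms] assms by (auto simp: singular_def)
  have "sug_op w = \<mu> *\<^sub>C w + \<mu> *\<^sub>C w + \<mu> *\<^sub>C \<mu> *\<^sub>C w"
    by (simp add: sug_op_eq[OF k] sug_def sug_term_def z ef lin)
  moreover have "3 *\<^sub>C x = x + x + x" for x :: 'v
    using cscale_add_left[of 2 1 x] by (simp add: cscale_two cscale_one)
  ultimately show ?thesis
    by (simp add: grading_op_def z cvs.scale_left_diff_distrib del: cvs.scale_scale flip: cscale_cscale)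
qed

text \<open>The product of the operators \<open>grading_op + 6 (d + j)\<close> for
  \<open>j < n\<close>. If a singular vector has eigenvalue -6d and the lowering generators take
  steps of -6, a long enough product kills any given vector below it; this replaces a decomposition
  into eigenspaces.\<close>

primrec annih :: "nat \<Rightarrow> nat \<Rightarrow> 'v \<Rightarrow> 'v" where
  "annih d 0 u = u"
| "annih d (Suc n) u = grading_op (annih d n u) + of_nat (6 * (d + n)) *\<^sub>C annih d n u"

lemma annih_add: "annih d n (u + w) = annih d n u + annih d n w"
  by (induction n) (simp_all add: grading_op_add cscale_add_right add_ac)

lemma annih_cscale: "annih d n (c *\<^sub>C u) = c *\<^sub>C annih d n u"
  by (induction n) (simp_all add: grading_op_cscale cscale_add_right cvs.scale_left_commute[of c])

lemma annih_mono:
  assumes "annih d n u = 0" "n \<le> m"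
  shows "annih d m u = 0"
  using assms(2)
proof (induction m rule: dec_induct)
  case (step m)
  then show ?case using grading_op_cscale[of 0 0] by simp
qed (fact assms(1))

text \<open>Moving \<open>x\<close> to the left past a factor decreases the constant of that factor
  by 6. The factors for j = 1, ..., n become those of \<open>annih d n\<close>, and the factor for j
  = 0 becomes the extra one with constant 6d - 6.\<close>

lemma annih_lower:
  assumes x: "\<And>u w. x (u + w) = x u + x w" "\<And>c u. x (c *\<^sub>C u) = c *\<^sub>C x u"
    and g: "\<And>u. grading_op (x u) = x (grading_op u) - 6 *\<^sub>C x u"
  shows "annih d (Suc n) (x u) = x (grading_op (annih d n u) + (6 * of_nat d - 6) *\<^sub>C annih d n u)"
proof (induction n)
  case 0
  have "x (u - w) = x u - x w" for u w
    using x(1)[of "u - w" w] by simp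
  then show ?case by (simp add: g x cvs.scale_left_diff_distrib)
next
  case (Suc n)
  define \<alpha> \<beta> :: complex where "\<alpha> = 6 * of_nat d - 6" and "\<beta> = of_nat (6 * (d + n))"
  define y where "y = grading_op (annih d n u) + \<alpha> *\<^sub>C annih d n u"
  have \<beta>: "of_nat (6 * (d + Suc n)) = \<beta> + 6" by (simp add: \<beta>_def)
  have "annih d (Suc (Suc n)) (x u) = grading_op (x y) + (\<beta> + 6) *\<^sub>C x y"
    using Suc unfolding annih.simps(2)[of d "Suc n"] \<beta> by (simp only: y_def \<alpha>_def)
  also have "\<dots> = x (grading_op y + \<beta> *\<^sub>C y)"
    by (simp add: g x cscale_add_left)
  also have "grading_op y + \<beta> *\<^sub>C y = grading_op (annih d (Suc n) u) + \<alpha> *\<^sub>C annih d (Suc n) u"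
    unfolding annih.simps \<beta>_def[symmetric] y_def
    by (simp add: grading_op_add grading_op_cscale cscale_add_right cscale_cscale mult.commute add_ac)
  finally show ?case unfolding \<alpha>_def .
qed

section \<open>The submodule generated by a singular vector\<close>

inductive_set lower_span :: "'v \<Rightarrow> 'v set" for w where
  base: "w \<in> lower_span w"
| add: "u \<in> lower_span w \<Longrightarrow> u' \<in> lower_span w \<Longrightarrow> u + u' \<in> lower_span w"
| cscale: "u \<in> lower_span w \<Longrightarrow> c *\<^sub>C u \<in> lower_span w"
| f0: "u \<in> lower_span w \<Longrightarrow> f 0 u \<in> lower_span w"
| em1: "u \<in> lower_span w \<Longrightarrow> e (-1) u \<in> lower_span w"

lemma lower_span_diff: "u \<in> lower_span w \<Longrightarrow> u' \<in> lower_span w \<Longrightarrow> u - u' \<in> lower_span w"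
  using lower_span.add[of u w "(-1) *\<^sub>C u'"] lower_span.cscale[of u' w "-1"]
  by (simp add: cscale_minus_left cscale_one)

lemma lower_span_zero: "0 \<in> lower_span w"
  using lower_span.cscale[OF lower_span.base, of 0 w] by simp

lemma lower_span_h0:
  assumes "singular \<mu> w" "u \<in> lower_span w"
  shows "h 0 u \<in> lower_span w"
  using assms(2)
proof induction
  case base
  then show ?case using assms(1) by (simp add: singular_def lower_span.base lower_span.cscale)
qed (simp_all add: lin hf he lower_span.intros lower_span_diff)

text \<open>The raising generators are commuted to the right until they reach \<open>w\<close> and
  kill it. This makes \<open>irred_generators\<close> applicable to
  \<open>lower_span w\<close>.\<close>

lemma lower_span_raise:
  assumes "singular \<mu> w" "u \<in> lower_span w"
  shows "e 0 u \<in> lower_span w \<and> f 1 u \<in> lower_span w"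
  using assms(2)
proof induction
  case base
  then show ?case using assms(1) by (simp add: singular_def lower_span_zero)
next
  case (f0 u)
  have "e 0 (f 0 u) = f 0 (e 0 u) + h 0 u" "f 1 (f 0 u) = f 0 (f 1 u)"
    by (simp_all add: ef) (rule ff)
  then show ?case using f0 lower_span_h0[OF assms(1) f0.hyps] by (simp add: lower_span.f0 lower_span.add)
next
  case (em1 u)
  have "e 0 (e (-1) u) = e (-1) (e 0 u)" "f 1 (e (-1) u) = e (-1) (f 1 u) - h 0 u + u"
    by (rule ee) (simp add: fe cscale_minus_left cscale_one)
  then show ?case using em1 lower_span_h0[OF assms(1) em1.hyps]
    by (simp add: lower_span.em1 lower_span.add lower_span_diff)
qed (simp_all add: lin lower_span.intros)

lemma lower_span_annih:
  assumes "annih d 1 w = 0" "u \<in> lower_span w"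
  shows "\<exists>n. annih d n u = 0"
  using assms(2)
proof induction
  case (add u u')
  then obtain n m where "annih d n u = 0" "annih d m u' = 0" by blast
  then have "annih d (max n m) (u + u') = 0" by (simp add: annih_add annih_mono)
  then show ?case by blast
next
  case (f0 u)
  then obtain n where "annih d n u = 0" by blast
  then have "annih d (Suc n) (f 0 u) = 0"
    using annih_lower[of "f 0" d n u, OF f_add f_cscale grading_op_f0] grading_op_cscale[of 0 0] by simp
  then show ?case by blast
next
  case (em1 u)
  then obtain n where "annih d n u = 0" by blast
  then have "annih d (Suc n) (e (-1) u) = 0"
    using annih_lower[of "e (-1)" d n u, OF e_add e_cscale grading_op_em1] grading_op_cscale[of 0 0] by simp
  then show ?case by blast
next
  case base
  then show ?case using assms(1) by blast
next
  case (cscale u c)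
  then show ?case by (metis annih_cscale cscale_zero_right)
qed

text \<open>A nonzero singular vector of positive depth would generate a submodule on which the grading
  operator has negative eigenvalues only, and which therefore misses \<open>v\<close>.\<close>

lemma singular_eq_zero:
  assumes w: "singular \<mu> w" and \<mu>: "\<mu> * \<mu> - \<mu> = of_nat (6 * d)" and d: "d > 0"
  shows "w = 0"
proof (rule ccontr)
  assume "w \<noteq> 0"
  have "lower_span w = {0} \<or> lower_span w = UNIV"
    by (rule irred_generators)
      (auto intro: lower_span.intros lower_span_zero dest: lower_span_raise[OF w])
  then have "v \<in> lower_span w" using \<open>w \<noteq> 0\<close> lower_span.base[of w] by auto
  moreover have "annih d 1 w = 0"
  proof -
    have "annih d 1 w = (\<mu> - \<mu> * \<mu> + of_nat (6 * d)) *\<^sub>C w"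
      by (simp add: grading_op_singular[OF w] cscale_add_left)
    also have "\<mu> - \<mu> * \<mu> + of_nat (6 * d) = 0" unfolding \<mu>[symmetric] by simp
    finally show ?thesis by simp
  qed
  ultimately obtain n where n: "annih d n v = 0" using lower_span_annih by blast
  \<comment> \<open>By \<open>lam_sq\<close> the eigenvalue on \<open>v\<close> is 0, so
    \<open>annih d n\<close> multiplies \<open>v\<close> by a product of the numbers 6 (d + j), none
    of which is 0 as \<open>d > 0\<close>.\<close>
  have v: "grading_op v = 0" using grading_op_singular[OF v_singular] lam_sq by simp
  have "annih d m v = (\<Prod>j<m. of_nat (6 * (d + j))) *\<^sub>C v" for m
  proof (induction m)
    case (Suc m)
    then show ?case by (simp add: grading_op_cscale v cscale_cscale mult.commute)
  qed (simp add: cscale_one)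
  with n have "(\<Prod>j<n. of_nat (6 * (d + j)) :: complex) = 0" using v_nonzero by simp
  then show False using d by (auto simp flip: of_nat_add of_nat_mult)
qed

end

section \<open>Polynomials and the ideal of relations\<close>

type_synonym cpoly = "nat multiset \<Rightarrow>\<^sub>0 complex"

text \<open>\<open>Var j\<close> stands for x(-j), up to an index shift. Monomials are multisets of
  indices, so relations, gradings and shifts are commutative algebra; modules and the enveloping
  algebra enter through \<open>act\<close>.\<close>

definition Var :: "nat \<Rightarrow> cpoly" where
  "Var j = Poly_Mapping.single {#j#} 1"

definition act :: "(nat \<Rightarrow> 'w \<Rightarrow> 'w) \<Rightarrow> cpoly \<Rightarrow> 'w \<Rightarrow> 'w::complex_vs" where
  "act x p u = (\<Sum>M\<in>Poly_Mapping.keys p. Poly_Mapping.lookup p M *\<^sub>C fold_mset x u M)"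

lemma act_zero [simp]: "act x 0 u = 0"
  by (simp add: act_def)

lemma act_single: "act x (Poly_Mapping.single M c) u = c *\<^sub>C fold_mset x u M"
  by (simp add: act_def)

lemma act_add: "act x (p + q) u = act x p u + act x q u"
  unfolding act_def by (rule keys_sum_add) (simp add: cscale_add_left)

lemma act_cscale: "act x (c *\<^sub>C p) u = c *\<^sub>C act x p u"
  unfolding act_def by (rule keys_sum_cscale) (simp_all add: cscale_cscale cscale_complex_def)

lemma act_uminus: "act x (- p) u = - act x p u"
  using act_add[of x "- p" p u] by (simp add: eq_neg_iff_add_eq_0)

lemma act_diff: "act x (p - q) u = act x p u - act x q u"
  using act_add[of x p "- q" u] by (simp add: act_uminus)

lemma act_sum: "act x (\<Sum>i\<in>A. p i) u = (\<Sum>i\<in>A. act x (p i) u)"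
  by (induction A rule: infinite_finite_induct) (simp_all add: act_add)

lemma cscale_cpoly: "c *\<^sub>C p = Poly_Mapping.single 0 c * (p :: cpoly)"
proof (induction p rule: poly_mapping_add_induct)
  case (single k b)
  show ?case by (simp add: cscale_single mult_single cscale_complex_def)
qed (simp_all add: cscale_add_right distrib_left)

lemma cscale_cpoly_mult: "(c *\<^sub>C p) * q = c *\<^sub>C (p * (q :: cpoly))" "p * (c *\<^sub>C q) = c *\<^sub>C (p * q)"
  by (simp_all add: cscale_cpoly mult_ac)

lemma keys_induct [consumes 1, case_names zero single add]:
  assumes "Poly_Mapping.keys (p :: cpoly) \<subseteq> B" "P 0" "\<And>M c. M \<in> B \<Longrightarrow> P (Poly_Mapping.single M c)"
    "\<And>p q. P p \<Longrightarrow> P q \<Longrightarrow> P (p + q)"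
  shows "P p"
proof -
  have "p = (\<Sum>k\<in>Poly_Mapping.keys p. Poly_Mapping.single k (Poly_Mapping.lookup p k))"
    by (rule poly_mapping_eqI)
      (simp add: lookup_sum lookup_single when_def in_keys_iff)
  moreover have "P (\<Sum>k\<in>A. Poly_Mapping.single k (Poly_Mapping.lookup p k))" if "finite A" "A \<subseteq> B" for A
    using that by induction (auto intro: assms)
  ultimately show ?thesis using assms(1) by (metis finite_keys)
qed

locale commuting_ops =
  fixes x :: "nat \<Rightarrow> 'w \<Rightarrow> 'w::complex_vs"
  assumes x_add: "x j (u + w) = x j u + x j w" and x_cscale: "x j (c *\<^sub>C u) = c *\<^sub>C x j u"
    and x_comm: "x j (x k u) = x k (x j u)"
begin

sublocale cf: comp_fun_commute x
  by standard (simp add: fun_eq_iff x_comm)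

lemma x_zero [simp]: "x j 0 = 0"
  using x_cscale[of j 0 0] by simp

lemma mon_add: "fold_mset x (u + w) M = fold_mset x u M + fold_mset x w M"
  by (induction M) (simp_all add: x_add)

lemma mon_cscale: "fold_mset x (c *\<^sub>C u) M = c *\<^sub>C fold_mset x u M"
  by (induction M) (simp_all add: x_cscale)

lemma mon_union: "fold_mset x u (M + N) = fold_mset x (fold_mset x u N) M"
  by (induction M) simp_all

lemma mon_commute: "fold_mset x (fold_mset x u N) M = fold_mset x (fold_mset x u M) N"
  by (metis mon_union add.commute)

lemma act_add_right: "act x p (u + w) = act x p u + act x p w"
  by (simp add: act_def mon_add cscale_add_right sum.distrib)

lemma act_cscale_right: "act x p (c *\<^sub>C u) = c *\<^sub>C act x p u"
  by (simp add: act_def mon_cscale cscale_sum_right mult.commute)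

lemma act_zero_right [simp]: "act x p 0 = 0"
  using act_cscale_right[of p 0 0] by simp

lemma act_mult: "act x (p * q) u = act x p (act x q u)"
proof (induction p rule: poly_mapping_add_induct)
  case (single w c)
  show ?case
  proof (induction q rule: poly_mapping_add_induct)
    case (single w' c')
    show ?case
      by (simp add: mult_single act_single mon_union mon_cscale mon_commute[of u w w'])
  qed (simp_all add: act_add act_add_right distrib_left)
qed (simp_all add: act_add distrib_right)

lemma act_Var: "act x (Var j) u = x j u"
  by (simp add: Var_def act_single cscale_one)

lemma act_one: "act x 1 u = u"
  by (simp add: act_single cscale_one flip: single_one)

end

section \<open>Index shifts of polynomials\<close>

definition shift :: "nat \<Rightarrow> cpoly \<Rightarrow> cpoly" where
  "shift s p = act (\<lambda>j q. Var (j + s) * q) p 1"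

lemma Var_mult_single: "Var j * Poly_Mapping.single M c = Poly_Mapping.single (add_mset j M) c"
  by (simp add: Var_def mult_single)

lemma commuting_ops_Var: "commuting_ops (\<lambda>j q. Var (j + s) * q)"
  by standard (simp_all add: distrib_left cscale_cpoly_mult mult.left_commute)

lemma fold_mset_Var: "fold_mset (\<lambda>j q. Var (j + s) * q) 1 M = Poly_Mapping.single (image_mset (\<lambda>j. j + s) M) 1"
proof -
  interpret commuting_ops "\<lambda>j q. Var (j + s) * q" by (rule commuting_ops_Var)
  show ?thesis by (induction M) (simp_all add: Var_mult_single)
qed

lemma shift_zero [simp]: "shift s 0 = 0"
  by (simp add: shift_def)

lemma shift_single: "shift s (Poly_Mapping.single M c) = Poly_Mapping.single (image_mset (\<lambda>j. j + s) M) c"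
  by (simp add: shift_def act_single fold_mset_Var cscale_single cscale_complex_def)

lemma shift_Var: "shift s (Var j) = Var (j + s)"
  by (simp add: Var_def shift_single)

lemma shift_add: "shift s (p + q) = shift s p + shift s q"
  by (simp add: shift_def act_add)

lemma shift_two: "shift s 2 = 2"
proof -
  have "shift s 1 = 1" by (simp add: shift_single flip: single_one)
  then show ?thesis using shift_add[of s 1 1] by simp
qed

lemma shift_diff: "shift s (p - q) = shift s p - shift s q"
  by (simp add: shift_def act_diff)

lemma shift_sum: "shift s (\<Sum>i\<in>A. p i) = (\<Sum>i\<in>A. shift s (p i))"
  by (simp add: shift_def act_sum)

lemma shift_mult: "shift s (p * q) = shift s p * shift s q"
proof (induction p rule: poly_mapping_add_induct)
  case (single w c)
  show ?case
  proof (induction q rule: poly_mapping_add_induct)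
    case (single w' c')
    show ?case by (simp add: mult_single shift_single)
  qed (simp_all add: shift_add distrib_left)
qed (simp_all add: shift_add distrib_right)

lemma shift_shift: "shift s (shift t p) = shift (s + t) p"
  by (induction p rule: poly_mapping_add_induct)
    (simp_all add: shift_add shift_single multiset.map_comp comp_def add_ac)

lemma act_shift:
  assumes "commuting_ops x"
  shows "act x (shift s p) u = act (\<lambda>j. x (j + s)) p u"
proof -
  interpret commuting_ops x by fact
  interpret s: commuting_ops "\<lambda>j. x (j + s)"
    by standard (simp_all add: x_add x_cscale x_comm)
  have "fold_mset x u (image_mset (\<lambda>j. j + s) M) = fold_mset (\<lambda>j. x (j + s)) u M" for M
    by (induction M) simp_all
  then show ?thesis
    by (induction p rule: poly_mapping_add_induct) (simp_all add: shift_add shift_single act_single act_add)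
qed

text \<open>Polynomials in the variables of index at least 1, homogeneous of degree \<open>r\<close> and of weight at
  most \<open>n\<close>. Integer bounds keep the arithmetic below free of truncated subtraction.\<close>

definition graded :: "int \<Rightarrow> int \<Rightarrow> cpoly set" where
  "graded r n = {p. \<forall>M\<in>Poly_Mapping.keys p. int (size M) = r \<and> int (sum_mset M) \<le> n \<and> 0 \<notin># M}"

lemma graded_zero [simp]: "0 \<in> graded r n"
  by (simp add: graded_def)

lemma graded_single_iff:
  "Poly_Mapping.single M c \<in> graded r n \<longleftrightarrow>
    c = 0 \<or> int (size M) = r \<and> int (sum_mset M) \<le> n \<and> 0 \<notin># M"
  by (auto simp: graded_def)

lemma graded_add: "p \<in> graded r n \<Longrightarrow> q \<in> graded r n \<Longrightarrow> p + q \<in> graded r n"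
  unfolding graded_def using Poly_Mapping.keys_add[of p q] by blast

lemma graded_mult: "p \<in> graded r n \<Longrightarrow> q \<in> graded s m \<Longrightarrow> p * q \<in> graded (r + s) (n + m)"
  unfolding graded_def using keys_mult[of p q] by fastforce

lemma graded_cscale: "p \<in> graded r n \<Longrightarrow> c *\<^sub>C p \<in> graded r n"
proof -
  have "Poly_Mapping.single 0 c \<in> graded 0 0" by (auto simp: graded_def)
  then show "p \<in> graded r n \<Longrightarrow> c *\<^sub>C p \<in> graded r n"
    using graded_mult[of "Poly_Mapping.single 0 c" 0 0 p r n] by (simp add: cscale_cpoly)
qed

lemma graded_Var: "j \<ge> 1 \<Longrightarrow> Var j \<in> graded 1 (int j)"
  by (simp add: Var_def graded_single_iff)

lemma graded_uminus: "p \<in> graded r n \<Longrightarrow> - p \<in> graded r n"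
  by (simp add: graded_def)

lemma graded_mono: "p \<in> graded r n \<Longrightarrow> n \<le> m \<Longrightarrow> p \<in> graded r m"
  by (force simp: graded_def)

lemma graded_induct [consumes 1, case_names zero single add]:
  assumes "p \<in> graded r n" "P 0"
    "\<And>M c. int (size M) = r \<Longrightarrow> int (sum_mset M) \<le> n \<Longrightarrow> 0 \<notin># M \<Longrightarrow> P (Poly_Mapping.single M c)"
    "\<And>p q. P p \<Longrightarrow> P q \<Longrightarrow> P (p + q)"
  shows "P p"
  by (rule keys_induct[of p "{M. int (size M) = r \<and> int (sum_mset M) \<le> n \<and> 0 \<notin># M}"])
    (use assms in \<open>auto simp: graded_def\<close>)

lemma graded_shift: "p \<in> graded r n \<Longrightarrow> shift s p \<in> graded r (n + int s * r)"
proof (induction rule: graded_induct)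
  case (single M c)
  have "sum_mset (image_mset (\<lambda>j. j + s) M) = sum_mset M + s * size M"
    by (induction M) simp_all
  then show ?case using single by (auto simp: shift_single graded_single_iff algebra_simps)
qed (simp_all add: shift_add graded_add)

text \<open>A monomial without \<open>Var 1\<close> involves only indices from 2 on and is therefore
  a shift. Shifting by 1 raises the weight by the degree, which explains the bound
  \<open>n - r\<close>.\<close>

lemma graded_decompose:
  assumes "p \<in> graded r n"
  shows "\<exists>b g. p = shift 1 b + g * Var 1 \<and> b \<in> graded r (n - r) \<and> g \<in> graded (r - 1) (n - 1)"
  using assms
proof (induction rule: graded_induct)
  case zero
  have "0 = shift 1 0 + 0 * Var 1" by simp
  then show ?case by (metis graded_zero)
next
  case (single M c)
  show ?case
  proof (cases "1 \<in># M")
    case True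
    then obtain N where "M = add_mset 1 N" by (metis multi_member_split)
    then have "Poly_Mapping.single M c = shift 1 0 + Poly_Mapping.single N c * Var 1"
      "Poly_Mapping.single N c \<in> graded (r - 1) (n - 1)"
      using single by (auto simp: Var_def mult_single graded_single_iff)
    then show ?thesis by (metis graded_zero)
  next
    case False
    \<comment> \<open>Every index in \<open>M\<close> is at least 2 here, so the truncated
      subtraction is exact and \<open>N\<close> avoids the index 0.\<close>
    define N where "N = image_mset (\<lambda>j. j - 1) M"
    have "j \<ge> 2" if "j \<in># M" for j
      using that single False by (cases "j = 0 \<or> j = 1") (auto simp: not_le)
    note ge = this
    have "image_mset (\<lambda>j. j + 1) N = image_mset (\<lambda>j. j) M"
      unfolding N_def multiset.map_comp comp_def by (rule image_mset_cong) (use ge in force)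
    then have M: "M = image_mset (\<lambda>j. j + 1) N" by simp
    have N0: "0 \<notin># N" unfolding N_def using ge by force
    have "sum_mset (image_mset (\<lambda>j. j + 1) N) = sum_mset N + size N"
      by (induction N) simp_all
    then have "Poly_Mapping.single M c = shift 1 (Poly_Mapping.single N c) + 0 * Var 1"
      "Poly_Mapping.single N c \<in> graded r (n - r)"
      using single N0 by (auto simp: M shift_single graded_single_iff)
    then show ?thesis by (metis graded_zero)
  qed
next
  case (add p q)
  then obtain b g b' g' where "p = shift 1 b + g * Var 1" "b \<in> graded r (n - r)" "g \<in> graded (r - 1) (n - 1)"
    "q = shift 1 b' + g' * Var 1" "b' \<in> graded r (n - r)" "g' \<in> graded (r - 1) (n - 1)"
    by blast
  then show ?case
    by (intro exI[of _ "b + b'"] exI[of _ "g + g'"]) (simp add: graded_add shift_add algebra_simps)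
qed

section \<open>The quadratic relations and their ideal\<close>

definition Rel :: "nat \<Rightarrow> cpoly" where
  "Rel t = (\<Sum>j\<in>{1..<t}. Var j * Var (t - j))"

lemma Rel_2: "Rel 2 = Var 1 * Var 1"
  by (simp add: Rel_def numeral_2_eq_2)

lemma Rel_3: "Rel 3 = 2 * (Var 2 * Var 1)"
proof -
  have "{1..<3::nat} = {1, 2}" by auto
  then show ?thesis by (simp add: Rel_def mult_ac)
qed

text \<open>The terms of \<open>Rel (t + 2)\<close> without \<open>Var 1\<close> are the shifts of
  those of \<open>Rel t\<close>; the others are its two end terms. At \<open>t = 0\<close> the end
  terms coincide, which is why \<open>t \<ge> 1\<close> is assumed.\<close>

lemma shift_Rel: "t \<ge> 1 \<Longrightarrow> shift 1 (Rel t) = Rel (t + 2) - 2 * (Var 1 * Var (t + 1))"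
proof -
  assume t: "t \<ge> 1"
  have "Rel (t + 2) = (\<Sum>j\<in>{0..<Suc t}. Var (Suc j) * Var (t + 1 - j))"
    unfolding Rel_def using sum.shift_bounds_Suc_ivl[of "\<lambda>j. Var j * Var (t + 2 - j)" 0 "Suc t"] by simp
  also have "\<dots> = (\<Sum>j\<in>{0..<t}. Var (Suc j) * Var (t + 1 - j)) + Var (Suc t) * Var 1"
    by simp
  also have "(\<Sum>j\<in>{0..<t}. Var (Suc j) * Var (t + 1 - j)) =
      Var 1 * Var (t + 1) + (\<Sum>j\<in>{1..<t}. Var (Suc j) * Var (t + 1 - j))"
    using t by (simp add: sum.atLeast_Suc_lessThan)
  also have "(\<Sum>j\<in>{1..<t}. Var (Suc j) * Var (t + 1 - j)) = shift 1 (Rel t)"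
    unfolding Rel_def shift_sum by (rule sum.cong) (auto simp: shift_mult shift_Var Suc_diff_le)
  finally show ?thesis by (simp add: algebra_simps)
qed

lemma shift_2_Rel:
  "t \<ge> 1 \<Longrightarrow> shift 2 (Rel t) = Rel (t + 4) - 2 * (Var 1 * Var (t + 3)) - 2 * (Var 2 * Var (t + 2))"
proof -
  assume t: "t \<ge> 1"
  have "shift 2 (Rel t) = shift 1 (shift 1 (Rel t))"
    unfolding shift_shift by (simp only: one_add_one)
  moreover have "shift 1 (Rel (t + 2)) = Rel (t + 4) - 2 * (Var 1 * Var (t + 3))"
    using shift_Rel[of "t + 2"] by (simp add: numeral_eq_Suc)
  ultimately show ?thesis
    unfolding shift_Rel[OF t] shift_diff shift_mult shift_two shift_Var add.assoc one_add_one by simp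
qed

text \<open>Degree and weight bounds are recorded on the cofactors, so that the quotient by
  \<open>Var 1\<close> produced in \<open>rel_ideal_shift_1\<close> is graded again and an induction
  on the weight can continue with it.\<close>

inductive_set rel_ideal :: "int \<Rightarrow> int \<Rightarrow> cpoly set" for r n where
  zero: "0 \<in> rel_ideal r n"
| add: "p \<in> rel_ideal r n \<Longrightarrow> q \<in> rel_ideal r n \<Longrightarrow> p + q \<in> rel_ideal r n"
| gen: "p \<in> graded (r - 2) (n - int t) \<Longrightarrow> 2 \<le> t \<Longrightarrow> p * Rel t \<in> rel_ideal r n"

text \<open>By \<open>shift_Rel\<close>, shifting takes relations to relations modulo
  \<open>Var 1\<close>.\<close>

lemma rel_ideal_shift_1:
  assumes "q \<in> rel_ideal r n"
  shows "\<exists>p g. shift 1 q = p + g * Var 1 \<and> p \<in> rel_ideal r (n + r) \<and> g \<in> graded (r - 1) (n + r - 1)"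
  using assms
proof induction
  case zero
  have "shift 1 0 = 0 + 0 * Var 1" by simp
  then show ?case by (metis graded_zero rel_ideal.zero)
next
  case (add q q')
  then obtain p g p' g' where "shift 1 q = p + g * Var 1" "p \<in> rel_ideal r (n + r)" "g \<in> graded (r - 1) (n + r - 1)"
    "shift 1 q' = p' + g' * Var 1" "p' \<in> rel_ideal r (n + r)" "g' \<in> graded (r - 1) (n + r - 1)"
    by blast
  then show ?case
    by (intro exI[of _ "p + p'"] exI[of _ "g + g'"]) (simp add: graded_add rel_ideal.add shift_add algebra_simps)
next
  case (gen p t)
  have t: "t \<ge> 1" using gen(2) by simp
  have p: "shift 1 p \<in> graded (r - 2) (n - int t + (r - 2))"
    using graded_shift[OF gen(1), of 1] by simp
  then have "shift 1 p * Rel (t + 2) \<in> rel_ideal r (n + r)"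
    by (intro rel_ideal.gen) (simp_all add: algebra_simps)
  moreover have "- (shift 1 p * Var (t + 1)) \<in> graded (r - 1) (n + r - 1)"
    using graded_mult[OF p graded_Var[of "t + 1"]] by (intro graded_uminus) (simp add: algebra_simps)
  then have "- (shift 1 p * Var (t + 1)) + - (shift 1 p * Var (t + 1)) \<in> graded (r - 1) (n + r - 1)"
    by (rule graded_add) fact
  moreover have "shift 1 (p * Rel t) = shift 1 p * Rel (t + 2) +
      (- (shift 1 p * Var (t + 1)) + - (shift 1 p * Var (t + 1))) * Var 1"
    unfolding shift_mult shift_Rel[OF t] by (simp add: algebra_simps)
  ultimately show ?case by blast
qed

text \<open>The factor \<open>Var 1\<close> absorbs both error terms of \<open>shift_2_Rel\<close>:
  one becomes a multiple of \<open>Var 1 * Var 1 = Rel 2\<close>, the other of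
  \<open>2 * (Var 2 * Var 1) = Rel 3\<close>. This is the polynomial counterpart of passing from
  \<open>v\<close> to \<open>e (-1) v\<close> by a spectral flow.\<close>

lemma rel_ideal_shift_2:
  assumes "q \<in> rel_ideal r n"
  shows "shift 2 q * Var 1 \<in> rel_ideal (r + 1) (n + 2 * r + 1)"
  using assms
proof induction
  case (gen p t)
  have p: "shift 2 p \<in> graded (r - 2) (n - int t + 2 * (r - 2))"
    using graded_shift[OF gen(1), of 2] by simp
  have "shift 2 p * Var 1 * Rel (t + 4) \<in> rel_ideal (r + 1) (n + 2 * r + 1)"
    using graded_mult[OF p graded_Var[of 1]] by (intro rel_ideal.gen) (simp_all add: algebra_simps)
  moreover have m: "- (shift 2 p * Var (t + 3)) \<in> graded (r - 1) (n + 2 * r - 1)"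
    using graded_mult[OF p graded_Var[of "t + 3"]] by (intro graded_uminus) (simp add: algebra_simps)
  then have "(- (shift 2 p * Var (t + 3)) + - (shift 2 p * Var (t + 3))) * Rel 2 \<in> rel_ideal (r + 1) (n + 2 * r + 1)"
    using graded_add[OF m m] by (intro rel_ideal.gen) simp_all
  moreover have m: "- (shift 2 p * Var (t + 2)) \<in> graded (r - 1) (n + 2 * r - 2)"
    using graded_mult[OF p graded_Var[of "t + 2"]] by (intro graded_uminus) (simp add: algebra_simps)
  then have "- (shift 2 p * Var (t + 2)) * Rel 3 \<in> rel_ideal (r + 1) (n + 2 * r + 1)"
    by (intro rel_ideal.gen) simp_all
  ultimately have "shift 2 p * Var 1 * Rel (t + 4)
      + (- (shift 2 p * Var (t + 3)) + - (shift 2 p * Var (t + 3))) * Rel 2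
      + - (shift 2 p * Var (t + 2)) * Rel 3 \<in> rel_ideal (r + 1) (n + 2 * r + 1)"
    by (intro rel_ideal.add)
  also have "shift 2 p * Var 1 * Rel (t + 4)
      + (- (shift 2 p * Var (t + 3)) + - (shift 2 p * Var (t + 3))) * Rel 2
      + - (shift 2 p * Var (t + 2)) * Rel 3 = shift 2 (p * Rel t) * Var 1"
    using gen(2) by (simp add: shift_mult shift_2_Rel Rel_2 Rel_3 algebra_simps)
  finally show ?case .
qed (simp_all add: shift_add distrib_right rel_ideal.intros)

section \<open>The annihilator of the vacuum vector\<close>

context level_one_ops
begin

text \<open>Index shifts and spectral flows both become changes of \<open>s\<close>:
  \<open>shift k\<close> lowers it by \<open>k\<close>.\<close>

definition mode :: "int \<Rightarrow> nat \<Rightarrow> 'v \<Rightarrow> 'v" where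
  "mode s j = e (s - int j)"

lemma commuting_ops_mode: "commuting_ops (mode s)"
  by standard (auto simp: mode_def lin intro: ee)

lemma act_mode_shift: "act (mode s) (shift k p) u = act (mode (s - int k)) p u"
proof -
  have "(\<lambda>j. mode s (j + k)) = mode (s - int k)"
    by (simp add: fun_eq_iff mode_def algebra_simps)
  then show ?thesis by (simp add: act_shift[OF commuting_ops_mode])
qed

text \<open>These are the translation automorphisms of the affine algebra. The central term of e(m -
  s) and f(n + s) changes by -s, which the correction of \<open>h 0\<close> absorbs. Invariant
  subspaces stay the same, so irreducibility is kept.\<close>

lemma spectral_flow:
  "level_one_ops (\<lambda>n. e (n - s)) (\<lambda>n. f (n + s))
    (\<lambda>n u. h n u - (if n = 0 then of_int s else 0) *\<^sub>C u)"
proof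
  fix S :: "'v set"
  assume S: "0 \<in> S" "\<And>u w. u \<in> S \<Longrightarrow> w \<in> S \<Longrightarrow> u + w \<in> S" "\<And>c u. u \<in> S \<Longrightarrow> c *\<^sub>C u \<in> S"
    "\<And>m u. u \<in> S \<Longrightarrow> e (m - s) u \<in> S" "\<And>m u. u \<in> S \<Longrightarrow> f (m + s) u \<in> S"
    "\<And>m u. u \<in> S \<Longrightarrow> h m u - (if m = 0 then of_int s else 0) *\<^sub>C u \<in> S"
  show "S = {0} \<or> S = UNIV"
  proof (rule irred)
    fix m u assume u: "u \<in> S"
    show "e m u \<in> S" "f m u \<in> S" using S(4)[OF u, of "m + s"] S(5)[OF u, of "m - s"] by simp_all
    show "h m u \<in> S"
      using S(2)[OF S(6)[OF u] S(3)[OF u], of m "if m = 0 then of_int s else 0"] by simp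
  qed (fact S)+
next
  fix m n c and u w :: 'v
  let ?a = "\<lambda>m::int. if m = 0 then of_int s else 0 :: complex"
  have shift: "m + (n - s) = m + n - s" "m + (n + s) = m + n + s" "m - s + (n + s) = m + n" by simp_all
  show "e (m - s) (u + w) = e (m - s) u + e (m - s) w" "e (m - s) (c *\<^sub>C u) = c *\<^sub>C e (m - s) u"
    "f (m + s) (u + w) = f (m + s) u + f (m + s) w" "f (m + s) (c *\<^sub>C u) = c *\<^sub>C f (m + s) u"
    by (simp_all only: lin)
  show "h m (u + w) - ?a m *\<^sub>C (u + w) = h m u - ?a m *\<^sub>C u + (h m w - ?a m *\<^sub>C w)"
    by (simp add: lin cscale_add_right)
  show "h m (c *\<^sub>C u) - ?a m *\<^sub>C c *\<^sub>C u = c *\<^sub>C (h m u - ?a m *\<^sub>C u)"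
    by (simp add: lin cscale_diff_right mult.commute)
  show "e (m - s) (e (n - s) u) = e (n - s) (e (m - s) u)" by (rule ee)
  show "f (m + s) (f (n + s) u) = f (n + s) (f (m + s) u)" by (rule ff)
  show "e (m - s) (f (n + s) u) = f (n + s) (e (m - s) u) +
      (h (m + n) u - ?a (m + n) *\<^sub>C u) + (if m + n = 0 then of_int m else 0) *\<^sub>C u"
    unfolding ef[of "m - s"] shift by (simp add: cvs.scale_left_diff_distrib)
  show "h m (e (n - s) u) - ?a m *\<^sub>C e (n - s) u =
      e (n - s) (h m u - ?a m *\<^sub>C u) + 2 *\<^sub>C e (m + n - s) u"
    unfolding he shift lin by simp
  show "h m (f (n + s) u) - ?a m *\<^sub>C f (n + s) u =
      f (n + s) (h m u - ?a m *\<^sub>C u) - 2 *\<^sub>C f (m + n + s) u"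
    unfolding hf shift lin by simp
  show "h m (h n u - ?a n *\<^sub>C u) - ?a m *\<^sub>C (h n u - ?a n *\<^sub>C u) =
      h n (h m u - ?a m *\<^sub>C u) - ?a n *\<^sub>C (h m u - ?a m *\<^sub>C u) + (if m + n = 0 then 2 * of_int m else 0) *\<^sub>C u"
    unfolding lin hh[of m n] by (simp add: cscale_diff_right mult.commute)
qed

end

context level_one_hw
begin

section \<open>Vanishing of singular vectors of small depth\<close>

lemma v_ops: "m \<ge> 0 \<Longrightarrow> e m v = 0" "m \<ge> 1 \<Longrightarrow> f m v = 0" "m \<ge> 1 \<Longrightarrow> h m v = 0" "h 0 v = lam *\<^sub>C v"
  using singular_pos[OF v_singular] v_singular by (auto simp: singular_def)

text \<open>\<open>f 0 v\<close> is singular of weight -2, and 4 + 2 = 6 is the case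
  \<open>d = 1\<close> of \<open>singular_eq_zero\<close>. The next two lemmas argue alike, with
  weight 3 and \<open>d = 1\<close>, and with weight -3 and \<open>d = 2\<close>.\<close>

lemma f0_v:
  assumes "lam = 0"
  shows "f 0 v = 0"
proof (rule singular_eq_zero[of "-2" _ 1])
  show "singular (-2) (f 0 v)"
    using assms ff[of 1 0 v] by (simp add: singular_def ef hf v_ops cscale_minus_left)
qed simp_all

lemma em1_v:
  assumes "lam = 1"
  shows "e (-1) v = 0"
proof (rule singular_eq_zero[of 3 _ 1])
  have "3 *\<^sub>C x = x + x + x" for x :: 'v
    using cscale_add_left[of 2 1 x] by (simp add: cscale_two cscale_one)
  then show "singular 3 (e (-1) v)"
    using assms ee[of 0 "-1" v]
    by (simp add: singular_def fe he v_ops cscale_minus_left cscale_one cscale_two)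
qed simp_all

lemma f0_f0_v:
  assumes "lam = 1"
  shows "f 0 (f 0 v) = 0"
proof (rule singular_eq_zero[of "-3" _ 2])
  have "3 *\<^sub>C x = x + x + x" for x :: 'v
    using cscale_add_left[of 2 1 x] by (simp add: cscale_two cscale_one)
  then show "singular (-3) (f 0 (f 0 v))"
    using assms ff[of 1 0]
    by (simp add: singular_def ef hf lin v_ops cscale_minus_left cscale_one cscale_two)
qed simp_all

lemma spectral_flow_hw:
  assumes "w \<noteq> 0" "e (- s) w = 0" "f (1 + s) w = 0" "h 0 w = (\<mu> + of_int s) *\<^sub>C w" "\<mu> * \<mu> = \<mu>"
  shows "level_one_hw (\<lambda>n. e (n - s)) (\<lambda>n. f (n + s))
    (\<lambda>n u. h n u - (if n = 0 then of_int s else 0) *\<^sub>C u) w \<mu>"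
proof -
  interpret s: level_one_ops "\<lambda>n. e (n - s)" "\<lambda>n. f (n + s)"
    "\<lambda>n u. h n u - (if n = 0 then of_int s else 0) *\<^sub>C u"
    by (rule spectral_flow)
  show ?thesis
    by unfold_locales (use assms in \<open>auto simp: s.singular_def cscale_add_left\<close>)
qed

end

locale level_one_vacuum = level_one_hw e f h v 0
  for e f h :: "int \<Rightarrow> 'v \<Rightarrow> 'v::complex_vs" and v :: 'v
begin

section \<open>The relations annihilate the vacuum vector\<close>

definition rel_vec :: "nat \<Rightarrow> 'v" where
  "rel_vec t = (\<Sum>j\<in>{1..<t}. e (- int j) (e (- int (t - j)) v))"

text \<open>On both sides \<open>f\<close> turns one of the two factors \<open>e\<close> into
  \<open>-h\<close>, with the same indices. Boundary terms arise on the left only: two copies of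
  \<open>e (- int t) v\<close> from the central term, and \<open>- h 0 (e (- int t) v)\<close>,
  which is minus two copies. At level 1 they cancel.\<close>

lemma f1_rel_vec:
  assumes "t \<ge> 1"
  shows "f 1 (rel_vec (Suc t)) = f 0 (rel_vec t)"
proof -
  let ?s = "\<Sum>j\<in>{1..<t}. - h (- int j) (e (- int (t - j)) v)"
  let ?s' = "\<Sum>j\<in>{1..<t}. - e (- int j) (h (- int (t - j)) v)"
  have f1: "f 1 (e (- int m) v) = (if m = 1 then v else - h (1 - int m) v)" if "m \<ge> 1" for m
    using that by (auto simp: fe v_ops cscale_minus_left cscale_one)
  have "f 1 (rel_vec (Suc t)) = (\<Sum>j\<in>{1..<Suc t}. f 1 (e (- int j) (e (- int (Suc t - j)) v)))"
    unfolding rel_vec_def sum ..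
  also have "\<dots> = (\<Sum>j\<in>{1..<Suc t}. e (- int j) (f 1 (e (- int (Suc t - j)) v))
     + (- h (1 - int j) (e (- int (Suc t - j)) v) + (if j = 1 then e (- int t) v else 0)))"
    by (rule sum.cong) (auto simp: fe[of 1 _ "e _ _"] cscale_minus_left cscale_one)
  also have "\<dots> = (\<Sum>j\<in>{1..<Suc t}. e (- int j) (f 1 (e (- int (Suc t - j)) v)))
     + ((\<Sum>j\<in>{1..<Suc t}. - h (1 - int j) (e (- int (Suc t - j)) v)) + e (- int t) v)"
    unfolding sum.distrib using assms by simp
  also have "(\<Sum>j\<in>{1..<Suc t}. e (- int j) (f 1 (e (- int (Suc t - j)) v))) = ?s' + e (- int t) v"
  proof -
    have "(\<Sum>j\<in>{1..<t}. e (- int j) (f 1 (e (- int (Suc t - j)) v))) = ?s'"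
    proof (rule sum.cong)
      fix j assume "j \<in> {1..<t}"
      then have "Suc t - j \<ge> 1" "Suc t - j \<noteq> 1" "1 - int (Suc t - j) = - int (t - j)" by auto
      then have "f 1 (e (- int (Suc t - j)) v) = - h (- int (t - j)) v"
        by (simp only: f1 if_False)
      then show "e (- int j) (f 1 (e (- int (Suc t - j)) v)) = - e (- int j) (h (- int (t - j)) v)"
        by (simp only: minus)
    qed simp
    then show ?thesis using assms f1[of 1] by (simp add: Suc_diff_le)
  qed
  also have "(\<Sum>j\<in>{1..<Suc t}. - h (1 - int j) (e (- int (Suc t - j)) v)) = ?s - (e (- int t) v + e (- int t) v)"
  proof -
    have "(\<Sum>j\<in>{1..<Suc t}. - h (1 - int j) (e (- int (Suc t - j)) v)) =
       (\<Sum>j\<in>{0..<t}. - h (- int j) (e (- int (t - j)) v))"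
      using sum.shift_bounds_Suc_ivl[of "\<lambda>j. - h (1 - int j) (e (- int (Suc t - j)) v)" 0 t] by simp
    also have "\<dots> = - h 0 (e (- int t) v) + ?s"
      using assms by (simp add: sum.atLeast_Suc_lessThan)
    finally show ?thesis by (simp add: he v_ops cscale_two)
  qed
  also have "?s' + e (- int t) v + (?s - (e (- int t) v + e (- int t) v) + e (- int t) v) = ?s + ?s'"
    by simp
  also have "\<dots> = f 0 (rel_vec t)"
    unfolding rel_vec_def sum sum.distrib[symmetric]
    by (rule sum.cong) (auto simp: fe f0_v minus v_ops)
  finally show ?thesis .
qed

text \<open>By induction and \<open>f1_rel_vec\<close>, \<open>f 1\<close> kills the next vector,
  and so does \<open>e 0\<close>, which commutes with all \<open>e\<close> modes. It is thus
  singular of weight 4, and 16 - 4 = 6 * 2 makes it vanish.\<close>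

lemma rel_vec_zero: "rel_vec t = 0"
proof (induction t)
  case (Suc t)
  show ?case
  proof (cases "t \<ge> 1")
    case True
    have "4 *\<^sub>C x = x + x + (x + x)" for x :: 'v
      using cscale_add_left[of 2 2 x] by (simp add: cscale_two)
    then have "h 0 (rel_vec (Suc t)) = 4 *\<^sub>C rel_vec (Suc t)"
      unfolding rel_vec_def sum cscale_sum_right
      by (intro sum.cong refl) (simp add: he v_ops lin cscale_two add_ac)
    moreover have "e 0 (rel_vec (Suc t)) = 0"
      unfolding rel_vec_def sum by (intro sum.neutral ballI) (simp add: ee[of 0] v_ops)
    moreover have "f 1 (rel_vec (Suc t)) = 0"
      using f1_rel_vec[OF True] Suc by simp
    ultimately have "singular 4 (rel_vec (Suc t))" by (simp add: singular_def)
    then show ?thesis by (rule singular_eq_zero[of _ _ 2]) simp_all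
  qed (simp add: rel_vec_def)
qed (simp add: rel_vec_def)

lemma act_Rel: "act (mode 0) (Rel t) v = 0"
proof -
  interpret m: commuting_ops "mode 0" by (rule commuting_ops_mode)
  have "act (mode 0) (Rel t) v = rel_vec t"
    by (simp add: Rel_def rel_vec_def act_sum m.act_mult m.act_Var mode_def)
  then show ?thesis by (simp add: rel_vec_zero)
qed

lemma act_rel_ideal: "p \<in> rel_ideal r n \<Longrightarrow> act (mode 0) p v = 0"
proof (induction rule: rel_ideal.induct)
  case (gen p t)
  interpret m: commuting_ops "mode 0" by (rule commuting_ops_mode)
  show ?case by (simp add: m.act_mult act_Rel)
qed (simp_all add: act_add)

text \<open>
  On a product of \<open>r\<close> factors \<open>e (-j)\<close> the operators \<open>h i / 2\<close> act like the power sums of \<open>r\<close>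
  commuting index shifts. By Newton's identities, these generate the elementary symmetric functions
  \<open>F k\<close> (up to sign), of which the last one shifts all indices at once.
\<close>

definition newton_family :: "nat \<Rightarrow> (nat \<Rightarrow> 'v) \<Rightarrow> bool" where
  "newton_family r F \<longleftrightarrow> (\<forall>k>r. F k = 0) \<and>
    (\<forall>k. of_nat (2 * Suc k) *\<^sub>C F (Suc k) = - (\<Sum>i\<le>k. h (int i + 1) (F (k - i))))"

lemma newton_family_mset:
  "\<exists>F. newton_family (size M) F \<and> F 0 = fold_mset (mode 0) v M \<and>
    F (size M) = (-1) ^ size M *\<^sub>C fold_mset (mode 1) v M"
proof (induction M)
  case empty
  have "newton_family 0 (\<lambda>k. if k = 0 then v else 0)"
    by (auto simp: newton_family_def v_ops(3) intro!: sum.neutral)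
  then show ?case by (intro exI[of _ "\<lambda>k. if k = 0 then v else 0"]) (simp add: cscale_one)
next
  case (add a M)
  interpret m0: commuting_ops "mode 0" by (rule commuting_ops_mode)
  interpret m1: commuting_ops "mode 1" by (rule commuting_ops_mode)
  obtain F where F: "\<And>k. k > size M \<Longrightarrow> F k = 0"
    "\<And>k. of_nat (2 * Suc k) *\<^sub>C F (Suc k) = - (\<Sum>i\<le>k. h (int i + 1) (F (k - i)))"
    "F 0 = fold_mset (mode 0) v M" "F (size M) = (-1) ^ size M *\<^sub>C fold_mset (mode 1) v M"
    using add unfolding newton_family_def by blast
  \<comment> \<open>A new factor multiplies the generating function of \<open>F\<close> by a linear
    factor: it keeps its index, or is shifted once with a minus sign. \<open>H\<close> is the
    shifted part, with value 0 at \<open>k = 0\<close>.\<close>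
  define H where "H k = (case k of 0 \<Rightarrow> 0 | Suc l \<Rightarrow> e (1 - int a) (F l))" for k
  define G where "G k = e (- int a) (F k) - H k" for k
  have G_Suc: "G (Suc k) = e (- int a) (F (Suc k)) - e (1 - int a) (F k)" for k
    by (simp add: G_def H_def)
  have "of_nat (2 * Suc k) *\<^sub>C G (Suc k) = - (\<Sum>i\<le>k. h (int i + 1) (G (k - i)))" for k
  proof -
    let ?A = "\<Sum>i\<le>k. e (- int a) (h (int i + 1) (F (k - i)))"
    let ?B = "\<Sum>i<k. e (1 - int a) (h (int i + 1) (F (k - Suc i)))"
    let ?T = "\<Sum>i<k. 2 *\<^sub>C e (int i + 2 - int a) (F (k - Suc i))"
    have A: "?A = - (of_nat (2 * Suc k) *\<^sub>C e (- int a) (F (Suc k)))"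
      using arg_cong[OF F(2)[of k], of "e (- int a)"] unfolding e_cscale minus sum by simp
    have B: "?B = - (of_nat (2 * k) *\<^sub>C e (1 - int a) (F k))"
    proof (cases k)
      case (Suc l)
      have "?B = (\<Sum>i\<le>l. e (1 - int a) (h (int i + 1) (F (l - i))))"
        by (simp add: Suc lessThan_Suc_atMost)
      then show ?thesis
        using arg_cong[OF F(2)[of l], of "e (1 - int a)"] unfolding e_cscale minus sum by (simp add: Suc)
    qed simp
    \<comment> \<open>The commutators of \<open>h\<close> with the unshifted and the shifted new
      factor cancel except for the single term \<open>2 *\<^sub>C e (1 - int a) (F k)\<close>, which
      raises the coefficient 2k from \<open>B\<close> to 2 (k + 1).\<close>
    have "(\<Sum>i\<le>k. h (int i + 1) (G (k - i))) =
      (\<Sum>i\<le>k. h (int i + 1) (e (- int a) (F (k - i)))) - (\<Sum>i<k. h (int i + 1) (e (1 - int a) (F (k - Suc i))))"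
    proof -
      have H: "H (k - i) = e (1 - int a) (F (k - Suc i))" if "i < k" for i
      proof -
        have "k - i = Suc (k - Suc i)" using that by simp
        then show ?thesis by (simp only: H_def nat.case)
      qed
      have "(\<Sum>i\<le>k. h (int i + 1) (G (k - i))) =
         (\<Sum>i\<le>k. h (int i + 1) (e (- int a) (F (k - i)))) - (\<Sum>i\<le>k. h (int i + 1) (H (k - i)))"
        by (simp add: G_def diff sum_subtractf)
      also have "(\<Sum>i\<le>k. h (int i + 1) (H (k - i))) = (\<Sum>i<k. h (int i + 1) (H (k - i)))"
        by (simp add: H_def flip: lessThan_Suc_atMost)
      also have "\<dots> = (\<Sum>i<k. h (int i + 1) (e (1 - int a) (F (k - Suc i))))"
        by (rule sum.cong) (simp_all add: H)
      finally show ?thesis .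
    qed
    also have "(\<Sum>i\<le>k. h (int i + 1) (e (- int a) (F (k - i)))) =
        ?A + (\<Sum>i\<le>k. 2 *\<^sub>C e (int i + 1 - int a) (F (k - i)))"
      unfolding sum.distrib[symmetric] by (rule sum.cong) (auto simp: he algebra_simps)
    also have "(\<Sum>i\<le>k. 2 *\<^sub>C e (int i + 1 - int a) (F (k - i))) = 2 *\<^sub>C e (1 - int a) (F k) + ?T"
      unfolding lessThan_Suc_atMost[symmetric] sum.lessThan_Suc_shift
      by (simp add: algebra_simps)
    also have "(\<Sum>i<k. h (int i + 1) (e (1 - int a) (F (k - Suc i)))) = ?B + ?T"
      unfolding sum.distrib[symmetric] by (rule sum.cong) (auto simp: he algebra_simps)
    finally have "(\<Sum>i\<le>k. h (int i + 1) (G (k - i))) = ?A + 2 *\<^sub>C e (1 - int a) (F k) - ?B" by simp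
    also have "\<dots> = - (of_nat (2 * Suc k) *\<^sub>C G (Suc k))"
      unfolding A B G_Suc by (simp add: cscale_diff_right cscale_add_left algebra_simps)
    finally show ?thesis by simp
  qed
  moreover have "G k = 0" if "k > Suc (size M)" for k
    using that F(1)[of k] F(1)[of "k - 1"] by (cases k) (auto simp: G_def H_def)
  moreover have "G 0 = fold_mset (mode 0) v (add_mset a M)"
    by (simp add: G_def H_def F(3) mode_def)
  moreover have "G (Suc (size M)) = (-1) ^ Suc (size M) *\<^sub>C fold_mset (mode 1) v (add_mset a M)"
    by (simp add: G_Suc F(1) F(4) mode_def e_cscale cscale_minus_left)
  ultimately show ?case unfolding newton_family_def by auto
qed

lemma newton_family_act:
  assumes "p \<in> graded (int r) n"
  shows "\<exists>F. newton_family r F \<and> F 0 = act (mode 0) p v \<and> F r = (-1) ^ r *\<^sub>C act (mode 1) p v"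
  using assms
proof (induction rule: graded_induct)
  case zero
  show ?case by (intro exI[of _ "\<lambda>_. 0"]) (simp add: newton_family_def)
next
  case (single M c)
  then obtain F where "newton_family r F" "F 0 = fold_mset (mode 0) v M"
    "F r = (-1) ^ r *\<^sub>C fold_mset (mode 1) v M"
    using newton_family_mset[of M] by auto
  note F = this
  have "of_nat (2 * Suc k) *\<^sub>C c *\<^sub>C F (Suc k) = - (\<Sum>i\<le>k. h (int i + 1) (c *\<^sub>C F (k - i)))" for k
  proof -
    have "of_nat (2 * Suc k) *\<^sub>C c *\<^sub>C F (Suc k) = c *\<^sub>C of_nat (2 * Suc k) *\<^sub>C F (Suc k)"
      by (rule cvs.scale_left_commute)
    also have "of_nat (2 * Suc k) *\<^sub>C F (Suc k) = - (\<Sum>i\<le>k. h (int i + 1) (F (k - i)))"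
      using F(1) unfolding newton_family_def by blast
    finally show ?thesis by (simp only: cscale_minus_right cscale_sum_right h_cscale)
  qed
  moreover have "c *\<^sub>C F k = 0" if "k > r" for k
    using that F(1) by (simp add: newton_family_def)
  moreover have "c *\<^sub>C F r = (-1) ^ r *\<^sub>C act (mode 1) (Poly_Mapping.single M c) v"
    unfolding F(3) act_single by (rule cvs.scale_left_commute)
  ultimately show ?case
    unfolding newton_family_def using F(2) by (intro exI[of _ "\<lambda>k. c *\<^sub>C F k"]) (simp add: act_single)
next
  case (add p q)
  then obtain F G where "newton_family r F" "F 0 = act (mode 0) p v" "F r = (-1) ^ r *\<^sub>C act (mode 1) p v"
    "newton_family r G" "G 0 = act (mode 0) q v" "G r = (-1) ^ r *\<^sub>C act (mode 1) q v" by blast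
  then show ?case
    by (intro exI[of _ "\<lambda>k. F k + G k"]) (simp add: newton_family_def act_add lin sum.distrib cscale_add_right)
qed

text \<open>If \<open>F 0\<close> vanishes, the recursion of a Newton family makes every
  \<open>F k\<close> vanish, since its left coefficient is a nonzero number; the last one is
  \<open>act (mode 1) p v\<close> up to sign.\<close>

lemma act_mode_1:
  assumes "p \<in> graded r n" "act (mode 0) p v = 0"
  shows "act (mode 1) p v = 0"
proof (cases "r \<ge> 0")
  case True
  then obtain F where F: "newton_family (nat r) F" "F 0 = 0" "F (nat r) = (-1) ^ nat r *\<^sub>C act (mode 1) p v"
    using newton_family_act[of p "nat r" n] assms by auto
  have "F k = 0" for k
  proof (induction k rule: less_induct)
    case (less k)
    show ?case
    proof (cases k)
      case (Suc l)
      have "of_nat (2 * Suc l) *\<^sub>C F (Suc l) = - (\<Sum>i\<le>l. h (int i + 1) (F (l - i)))"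
        using F(1) by (simp only: newton_family_def)
      also have "(\<Sum>i\<le>l. h (int i + 1) (F (l - i))) = 0"
        by (intro sum.neutral) (simp add: less Suc)
      finally have "of_nat (2 * Suc l) *\<^sub>C F (Suc l) = 0" by simp
      then show ?thesis unfolding Suc cvs.scale_eq_0_iff of_nat_eq_0_iff by simp
    qed (simp add: F(2))
  qed
  with F(3) show ?thesis by (metis cvs.scale_eq_0_iff power_not_zero neg_equal_0_iff_equal one_neq_zero)
next
  case False
  with assms(1) have "Poly_Mapping.keys p = {}" unfolding graded_def by fastforce
  then show ?thesis by (simp add: keys_eq_empty)
qed

text \<open>The relation for t = 3 says that twice \<open>e (-2) (e (-1) v)\<close> is 0. The weight
  2 of \<open>e (-1) v\<close> becomes 0 after the flow, and \<open>f 1\<close> maps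
  \<open>e (-1) v\<close> back to \<open>v\<close>, so it is nonzero.\<close>

lemma spectral_flow_vacuum:
  "level_one_vacuum (\<lambda>n. e (n - 2)) (\<lambda>n. f (n + 2)) (\<lambda>n u. h n u - (if n = 0 then of_int 2 else 0) *\<^sub>C u)
    (e (-1) v)"
proof -
  have 1: "f 1 (e (-1) v) = v"
    by (simp add: fe v_ops cscale_minus_left cscale_one)
  have "{1..<3::nat} = {1, 2}" by auto
  then have "e (-1) (e (-2) v) + e (-2) (e (-1) v) = 0"
    using rel_vec_zero[of 3] by (simp add: rel_vec_def)
  then have "2 *\<^sub>C e (-2) (e (-1) v) = 0"
    using ee[of "-1" "-2" v] by (simp add: cscale_two)
  then have "e (-2) (e (-1) v) = 0" by simp
  moreover have "f 3 (e (-1) v) = 0" by (simp add: fe v_ops)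
  moreover have "e (-1) v \<noteq> 0" using 1 v_nonzero by auto
  ultimately have "level_one_hw (\<lambda>n. e (n - 2)) (\<lambda>n. f (n + 2))
    (\<lambda>n u. h n u - (if n = 0 then of_int 2 else 0) *\<^sub>C u) (e (-1) v) 0"
    by (intro spectral_flow_hw) (simp_all add: he v_ops)
  then show ?thesis by (rule level_one_vacuum.intro)
qed

end

section \<open>Polynomials that kill the vacuum vector are relations\<close>

lemma graded_neg: "p \<in> graded r n \<Longrightarrow> r < 0 \<or> n < 0 \<Longrightarrow> p = 0"
proof (induction rule: graded_induct)
  case (single M c)
  moreover have "0 \<le> int (size M)" "0 \<le> int (sum_mset M)" by (rule of_nat_0_le_iff)+
  ultimately show ?case by linarith
qed auto

lemma graded_degree_zero: "p \<in> graded 0 n \<Longrightarrow> \<exists>c. p = Poly_Mapping.single {#} c"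
proof (induction rule: graded_induct)
  case zero
  then show ?case by (metis single_zero)
next
  case (add p q)
  then show ?case by (metis single_add)
qed auto

text \<open>Induction on the weight for all mode families at once, since the second use of the
  induction hypothesis concerns a spectral flow of the given family. The integer bound
  \<open>n\<close> is negative in the base case, which leaves only the zero polynomial.\<close>

lemma rel_ideal_if_kills:
  assumes "level_one_vacuum e f h (v :: 'v::complex_vs)" "p \<in> graded r n" "n < int N"
    "act (level_one_ops.mode e 0) p v = 0"
  shows "p \<in> rel_ideal r n"
  using assms
proof (induction N arbitrary: e f h v p r n)
  case 0
  then show ?case using graded_neg[of p r n] by (simp add: rel_ideal.zero)
next
  case (Suc N)
  interpret level_one_vacuum e f h v by fact
  interpret m0: commuting_ops "mode 0" by (rule commuting_ops_mode)
  interpret m1: commuting_ops "mode 1" by (rule commuting_ops_mode)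
  note p = Suc.prems(2) and kill = Suc.prems(4)
  consider "r < 0" | "r = 0" | "r \<ge> 1" by linarith
  then show ?case
  proof cases
    case 1
    then show ?thesis using graded_neg[OF p] by (simp add: rel_ideal.zero)
  next
    case 2
    then obtain c where "p = Poly_Mapping.single {#} c" using graded_degree_zero p by blast
    with kill v_nonzero have "p = 0" by (simp add: act_single)
    then show ?thesis by (simp add: rel_ideal.zero)
  next
    case 3
    obtain b g where b: "p = shift 1 b + g * Var 1" "b \<in> graded r (n - r)" "g \<in> graded (r - 1) (n - 1)"
      using graded_decompose[OF p] by blast
    \<comment> \<open>Under \<open>mode 1\<close> the variable \<open>Var 1\<close> acts as
      \<open>e 0\<close> and kills \<open>v\<close>, while \<open>shift 1 b\<close> acts as
      \<open>b\<close> does under \<open>mode 0\<close>.\<close>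
    have "act (mode 1) p v = act (mode 0) b v"
      by (simp add: b(1) act_add m1.act_mult m1.act_Var act_mode_shift) (simp add: mode_def v_ops)
    then have "act (mode 0) b v = 0" using act_mode_1[OF p kill] by simp
    then have "b \<in> rel_ideal r (n - r)"
      using Suc.IH[OF Suc.prems(1) b(2)] Suc.prems(3) 3 by simp
    \<comment> \<open>Since \<open>q\<close> is in the ideal, what remains of \<open>p\<close> is a
      multiple of \<open>Var 1\<close>, with cofactor \<open>g + g'\<close>.\<close>
    then obtain q g' where q: "shift 1 b = q + g' * Var 1" "q \<in> rel_ideal r n" "g' \<in> graded (r - 1) (n - 1)"
      using rel_ideal_shift_1[of b r "n - r"] by auto
    have "g + g' \<in> graded (r - 1) (n - 1)" using b(3) q(3) by (rule graded_add)
    \<comment> \<open>\<open>Var 1\<close> and then \<open>Var 2\<close> are split off from the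
      cofactor. Times \<open>Var 1\<close>, the parts split off are multiples of
      \<open>Rel 2\<close> and of half of \<open>Rel 3\<close>, whence the 1/2 in \<open>g3\<close>.
      The rest, \<open>shift 2 b2\<close>, has only indices from 3 on.\<close>
    then obtain b1 g1 where g1: "g + g' = shift 1 b1 + g1 * Var 1" "b1 \<in> graded (r - 1) (n - r)"
      "g1 \<in> graded (r - 2) (n - 2)"
      using graded_decompose[of "g + g'" "r - 1" "n - 1"] by auto
    obtain b2 g2 where g2: "b1 = shift 1 b2 + g2 * Var 1" "b2 \<in> graded (r - 1) (n - 2 * r + 1)"
      "g2 \<in> graded (r - 2) (n - r - 1)"
      using graded_decompose[OF g1(2)] by (auto simp: algebra_simps)
    define g3 where "g3 = (1/2) *\<^sub>C shift 1 g2"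
    have g3: "g3 \<in> graded (r - 2) (n - 3)"
      using graded_shift[OF g2(3), of 1] unfolding g3_def by (intro graded_cscale) (simp add: algebra_simps)
    have g3': "shift 1 g2 = g3 * 2"
      unfolding g3_def mult_2_right by (simp add: cscale_cscale cscale_one flip: cscale_add_left)
    have "shift 1 b1 = shift 2 b2 + shift 1 g2 * Var 2"
      unfolding g2(1) shift_add shift_mult shift_shift shift_Var one_add_one ..
    then have "g + g' = shift 2 b2 + g3 * 2 * Var 2 + g1 * Var 1"
      by (simp only: g1(1) g3')
    moreover have "p = q + (g + g') * Var 1"
      by (simp only: b(1) q(1) distrib_right add_ac)
    ultimately have decomp: "p = q + g1 * Rel 2 + g3 * Rel 3 + shift 2 b2 * Var 1"
      by (simp add: Rel_2 Rel_3 algebra_simps)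
    have rest: "q + g1 * Rel 2 + g3 * Rel 3 \<in> rel_ideal r n"
      using q(2) g1(3) g3 by (intro rel_ideal.add rel_ideal.gen) simp_all
    have "act (mode 0) (shift 2 b2 * Var 1) v = 0"
      using kill act_rel_ideal[OF rest] unfolding decomp by (simp add: act_add)
    \<comment> \<open>\<open>Var 1\<close> turns \<open>v\<close> into \<open>e (-1) v\<close>, and
      the shift by 2 turns \<open>mode 0\<close> into \<open>mode (- 2)\<close>, which is
      \<open>mode 0\<close> of the spectral flow by 2. The weight bound of \<open>b2\<close> is
      below \<open>n\<close> because \<open>r \<ge> 1\<close>.\<close>
    then have "act (mode (- 2)) b2 (e (-1) v) = 0"
      by (simp add: m0.act_mult m0.act_Var act_mode_shift) (simp add: mode_def)
    moreover have "mode (- 2) = level_one_ops.mode (\<lambda>n. e (n - 2)) 0"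
    proof
      fix j
      have "- 2 - int j = 0 - int j - 2" by simp
      then show "mode (- 2) j = level_one_ops.mode (\<lambda>n. e (n - 2)) 0 j"
        unfolding level_one_ops.mode_def[OF spectral_flow] mode_def by (simp only:)
    qed
    ultimately have "b2 \<in> rel_ideal (r - 1) (n - 2 * r + 1)"
      using Suc.IH[OF spectral_flow_vacuum g2(2)] Suc.prems(3) 3 by simp
    then have "shift 2 b2 * Var 1 \<in> rel_ideal r n"
      using rel_ideal_shift_2[of b2 "r - 1" "n - 2 * r + 1"] by simp
    with rest show ?thesis unfolding decomp by (rule rel_ideal.add)
  qed
qed

section \<open>The enveloping algebra of the affine Lie algebra\<close>

lift_definition sl2_xma :: sl2 is "\<chi> i j. if i = 2 \<and> j = 1 then 1 else 0"
  by (simp add: trace_def sum_2)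

lemmas sl2_reps = mat_of_sl2_inject[symmetric] zero_sl2.rep_eq plus_sl2.rep_eq uminus_sl2.rep_eq
  cscale_sl2.rep_eq lie_sl2.rep_eq sl2_h.rep_eq sl2_xa.rep_eq sl2_xma.rep_eq sl2_form.rep_eq

lemma sl2_brackets:
  "lie sl2_xa sl2_xma = sl2_h" "lie sl2_h sl2_xa = 2 *\<^sub>C sl2_xa" "lie sl2_h sl2_xma = (-2) *\<^sub>C sl2_xma"
  by (simp_all add: sl2_reps vec_eq_iff forall_2 matrix_matrix_mult_def sum_2)

lemma sl2_forms:
  "sl2_form sl2_xa sl2_xma = 1" "sl2_form sl2_h sl2_h = 2" "sl2_form sl2_h sl2_xa = 0"
  "sl2_form sl2_h sl2_xma = 0" "sl2_form sl2_xa sl2_xa = 0" "sl2_form sl2_xma sl2_xma = 0"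
  by (simp_all add: sl2_reps trace_def matrix_matrix_mult_def sum_2)

lemma sl2_decompose:
  "a = mat_of_sl2 a $ 1 $ 1 *\<^sub>C sl2_h + mat_of_sl2 a $ 1 $ 2 *\<^sub>C sl2_xa + mat_of_sl2 a $ 2 $ 1 *\<^sub>C sl2_xma"
proof -
  have "trace (mat_of_sl2 a) = 0" using mat_of_sl2[of a] by simp
  then have "mat_of_sl2 a $ 2 $ 2 = - mat_of_sl2 a $ 1 $ 1"
    by (simp add: trace_def sum_2 add_eq_0_iff2)
  then show ?thesis by (simp add: sl2_reps vec_eq_iff forall_2)
qed

lemma aff_add: "aff (a + b) m = aff a m + aff b m"
  and aff_cscale: "aff (c *\<^sub>C a) m = c *\<^sub>C aff a m"
  and aff_zero: "aff 0 m = 0"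
  by (simp_all add: aff_def plus_ghat_def cscale_ghat_def single_add zero_ghat_def flip: cscale_single)

lemma ghat_decompose:
  "X = (\<Sum>m\<in>Poly_Mapping.keys (loop X). aff (coef X m) m) + cen X *\<^sub>C ghat_k"
proof -
  have "(\<Sum>m\<in>A. aff (g m) m) = Ghat (\<Sum>m\<in>A. Poly_Mapping.single m (g m)) 0" for A g
    by (induction A rule: infinite_finite_induct) (simp_all add: zero_ghat_def plus_ghat_def aff_def)
  moreover have "loop X = (\<Sum>m\<in>Poly_Mapping.keys (loop X). Poly_Mapping.single m (coef X m))"
    by (rule poly_mapping_eqI) (simp add: lookup_sum lookup_single when_def in_keys_iff)
  ultimately show ?thesis
    by (simp add: plus_ghat_def cscale_ghat_def ghat_k_def ghat.expand)
qed

lemma ghat_k_central: "lie X ghat_k = 0" "lie ghat_k X = 0"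
  by (simp_all add: lie_ghat_def ghat_k_def zero_ghat_def)

context lie_module
begin

lemma act_zero_left [simp]: "rho 0 u = 0"
  using act_cscale_left[of 0 0 u] by simp

lemma act_zero_right [simp]: "rho x 0 = 0"
  using act_cscale_right[of x 0 0] by simp

lemma act_sum_left: "rho (\<Sum>i\<in>A. g i) u = (\<Sum>i\<in>A. rho (g i) u)"
  by (induction A rule: infinite_finite_induct) (simp_all add: act_add_left)

lemma uea_act_add: "uea_act rho (a + b) u = uea_act rho a u + uea_act rho b u"
proof -
  have "uea_act rho (abs_uea p + abs_uea q) u = uea_act rho (abs_uea p) u + uea_act rho (abs_uea q) u" for p q
    by (simp add: plus_uea.abs_eq uea_act_abs free_act_add)
  then show ?thesis by (metis abs_rep_uea)
qed

lemma uea_act_cscale: "uea_act rho (c *\<^sub>C a) u = c *\<^sub>C uea_act rho a u"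
proof -
  have "uea_act rho (c *\<^sub>C abs_uea p) u = c *\<^sub>C uea_act rho (abs_uea p) u" for p
    by (simp add: cscale_uea.abs_eq uea_act_abs free_act_cscale)
  then show ?thesis by (metis abs_rep_uea)
qed

lemma uea_act_mult: "uea_act rho (a * b) u = uea_act rho a (uea_act rho b u)"
proof -
  have "uea_act rho (abs_uea p * abs_uea q) u = uea_act rho (abs_uea p) (uea_act rho (abs_uea q) u)" for p q
    by (simp add: times_uea.abs_eq uea_act_abs free_act_mult)
  then show ?thesis by (metis abs_rep_uea)
qed

lemma uea_act_one [simp]: "uea_act rho 1 u = u"
  by (simp add: one_uea_def uea_act_abs free_act_single cscale_one zero_list_def flip: single_one)

lemma uea_act_of [simp]: "uea_act rho (uea_of x) u = rho x u"
  by (simp add: uea_of_def uea_act_abs free_act_single cscale_one)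

lemma uea_act_add_right: "uea_act rho a (u + w) = uea_act rho a u + uea_act rho a w"
  by (simp add: uea_act_def free_act_add_right)

lemma uea_act_zero [simp]: "uea_act rho 0 u = 0" "uea_act rho a 0 = 0"
  using uea_act_cscale[of 0 0 u] by (simp_all add: uea_act_def)

end

lemma cscale_free_right: "c *\<^sub>C p = (p :: 'a list \<Rightarrow>\<^sub>0 complex) * Poly_Mapping.single 0 c"
proof (induction p rule: poly_mapping_add_induct)
  case (single k b)
  show ?case by (simp add: cscale_single mult_single cscale_complex_def mult.commute)
qed (simp_all add: cscale_add_right distrib_right)

lemma uea_cscale_mult:
  fixes a b :: "'a::lie_algebra uea"
  shows "(c *\<^sub>C a) * b = c *\<^sub>C (a * b)" "a * (c *\<^sub>C b) = c *\<^sub>C (a * b)"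
proof -
  have "(c *\<^sub>C abs_uea p) * abs_uea q = c *\<^sub>C (abs_uea p * abs_uea q)" for p q :: "'a list \<Rightarrow>\<^sub>0 complex"
    by (simp add: times_uea.abs_eq cscale_uea.abs_eq cscale_free_left mult.assoc)
  then show "(c *\<^sub>C a) * b = c *\<^sub>C (a * b)" by (metis abs_rep_uea)
  have "abs_uea p * (c *\<^sub>C abs_uea q) = c *\<^sub>C (abs_uea p * abs_uea q)" for p q :: "'a list \<Rightarrow>\<^sub>0 complex"
    by (simp add: times_uea.abs_eq cscale_uea.abs_eq cscale_free_right mult.assoc)
  then show "a * (c *\<^sub>C b) = c *\<^sub>C (a * b)" by (metis abs_rep_uea)
qed

lemma uea_of_add: "uea_of (x + y) = uea_of x + uea_of y"
  and uea_of_cscale: "uea_of (c *\<^sub>C x) = c *\<^sub>C uea_of x"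
  and uea_of_lie: "uea_of (lie x y) = uea_of x * uea_of y - uea_of y * uea_of x"
  using uea_ideal.rel_add[of x y] uea_ideal.rel_cscale[of c x] uea_ideal_uminus[OF uea_ideal.rel_lie[of x y]]
  by (simp_all add: uea_of_def plus_uea.abs_eq cscale_uea.abs_eq times_uea.abs_eq minus_uea.abs_eq
      uea.abs_eq_iff algebra_simps)

lemma uea_of_zero [simp]: "uea_of 0 = 0"
  using uea_of_cscale[of 0 0] by simp

lemma uea_induct [case_names one mult cscale add]:
  assumes one: "P 1" and mult: "\<And>x a. P a \<Longrightarrow> P (uea_of x * a)"
    and sc: "\<And>c a. P a \<Longrightarrow> P (c *\<^sub>C a)" and add: "\<And>a b. P a \<Longrightarrow> P b \<Longrightarrow> P (a + b)"
  shows "P (a :: 'a::lie_algebra uea)"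
proof -
  have word: "P (abs_uea (word w))" for w :: "'a list"
  proof (induction w)
    case Nil
    then show ?case using one by (simp add: one_uea_def zero_list_def flip: single_one)
  next
    case (Cons x w)
    have "abs_uea (word (x # w)) = uea_of x * abs_uea (word w)"
      by (simp add: uea_of_def times_uea.abs_eq mult_single plus_list_def)
    then show ?case using mult Cons by simp
  qed
  have "P (abs_uea p)" for p :: "'a list \<Rightarrow>\<^sub>0 complex"
  proof (induction p rule: poly_mapping_add_induct)
    case zero
    then show ?case using sc[OF one, of 0] by (simp add: zero_uea_def)
  next
    case (single w c)
    have "abs_uea (Poly_Mapping.single w c) = c *\<^sub>C abs_uea (word w)"
      by (simp add: cscale_uea.abs_eq cscale_single cscale_complex_def)
    then show ?case using sc word by simp
  qed (simp add: add flip: plus_uea.abs_eq)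
  then show ?thesis by (metis abs_rep_uea)
qed

section \<open>From the affine Lie algebra to its modes\<close>

text \<open>A subspace stable under the modes is a submodule, because every element of
  \<open>ghat\<close> is a finite combination of modes and \<open>ghat_k\<close>, and
  \<open>ghat_k\<close> acts as 1.\<close>

lemma lie_module_level_one_ops:
  assumes mod: "lie_module rho" and k: "\<And>u. rho ghat_k u = u"
    and irr: "irreducible_module rho"
  shows "level_one_ops (\<lambda>n. rho (aff sl2_xa n)) (\<lambda>n. rho (aff sl2_xma n)) (\<lambda>n. rho (aff sl2_h n))"
proof -
  interpret lie_module rho by fact
  have br: "rho (aff a m) (rho (aff b n) u) = rho (aff b n) (rho (aff a m) u) + rho (aff (lie a b) (m + n)) u
      + (if m + n = 0 then of_int m * sl2_form a b else 0) *\<^sub>C u" for a b m n u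
  proof -
    have "rho (aff a m) (rho (aff b n) u) - rho (aff b n) (rho (aff a m) u) =
      rho (aff (lie a b) (m + n)) u + (if m + n = 0 then of_int m * sl2_form a b else 0) *\<^sub>C u"
      unfolding act_lie[symmetric] lie_aff act_add_left act_cscale_left k ..
    then show ?thesis by (simp add: algebra_simps)
  qed
  show ?thesis
  proof
    fix S :: "'a set"
    assume S: "0 \<in> S" "\<And>u w. u \<in> S \<Longrightarrow> w \<in> S \<Longrightarrow> u + w \<in> S" "\<And>c u. u \<in> S \<Longrightarrow> c *\<^sub>C u \<in> S"
      "\<And>m u. u \<in> S \<Longrightarrow> rho (aff sl2_xa m) u \<in> S" "\<And>m u. u \<in> S \<Longrightarrow> rho (aff sl2_xma m) u \<in> S"
      "\<And>m u. u \<in> S \<Longrightarrow> rho (aff sl2_h m) u \<in> S"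
    have "rho (aff a m) u \<in> S" if "u \<in> S" for a m u
      by (subst sl2_decompose[of a]) (simp add: aff_add aff_cscale act_add_left act_cscale_left S that)
    moreover have "(\<Sum>i\<in>A. g i) \<in> S" if "\<And>i. i \<in> A \<Longrightarrow> g i \<in> S" for A and g :: "int \<Rightarrow> 'a"
      using that by (induction A rule: infinite_finite_induct) (simp_all add: S)
    ultimately have "rho X u \<in> S" if "u \<in> S" for X u
      using that by (subst ghat_decompose[of X]) (simp add: act_add_left act_sum_left act_cscale_left k S)
    then have "lie_submodule rho S" using S by (simp add: lie_submodule_def)
    then show "S = {0} \<or> S = UNIV" using irr by (simp add: irreducible_module_def)
  next
    fix m n u
    show "rho (aff sl2_h m) (rho (aff sl2_xma n) u) =
       rho (aff sl2_xma n) (rho (aff sl2_h m) u) - 2 *\<^sub>C rho (aff sl2_xma (m + n)) u"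
      unfolding br[of sl2_h] sl2_brackets sl2_forms aff_cscale act_cscale_left by simp
    show "rho (aff sl2_xa m) (rho (aff sl2_xa n) u) = rho (aff sl2_xa n) (rho (aff sl2_xa m) u)"
      "rho (aff sl2_xma m) (rho (aff sl2_xma n) u) = rho (aff sl2_xma n) (rho (aff sl2_xma m) u)"
      by (simp_all add: br[of _ m _ n] lie_self sl2_forms aff_zero)
    show "rho (aff sl2_xa m) (rho (aff sl2_xma n) u) = rho (aff sl2_xma n) (rho (aff sl2_xa m) u) +
        rho (aff sl2_h (m + n)) u + (if m + n = 0 then of_int m else 0) *\<^sub>C u"
      by (simp add: br[of sl2_xa] sl2_brackets sl2_forms)
    show "rho (aff sl2_h m) (rho (aff sl2_xa n) u) =
        rho (aff sl2_xa n) (rho (aff sl2_h m) u) + 2 *\<^sub>C rho (aff sl2_xa (m + n)) u"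
      by (simp add: br[of sl2_h] sl2_brackets sl2_forms aff_cscale act_cscale_left)
    show "rho (aff sl2_h m) (rho (aff sl2_h n) u) =
        rho (aff sl2_h n) (rho (aff sl2_h m) u) + (if m + n = 0 then 2 * of_int m else 0) *\<^sub>C u"
      by (subst br) (simp add: lie_self sl2_forms aff_zero mult.commute)
  qed (simp_all add: act_add_right act_cscale_right)
qed

lemma is_L_module:
  assumes "is_L i rho v"
  shows "lie_module rho" "rho ghat_k u = u"
    "level_one_hw (\<lambda>n. rho (aff sl2_xa n)) (\<lambda>n. rho (aff sl2_xma n)) (\<lambda>n. rho (aff sl2_h n)) v (if i = 1 then 1 else 0)"
proof -
  have irr: "irreducible_module rho" and hw: "highest_weight_module rho (if i = 1 then 1 else 0) 1 v"
    using assms by (auto simp: is_L_def)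
  show mod: "lie_module rho" using hw by (simp add: highest_weight_module_def)
  interpret lie_module rho by fact
  have v: "v \<noteq> 0" "\<And>X. X \<in> ghat_pos \<Longrightarrow> rho X v = 0" "rho (aff sl2_h 0) v = (if i = 1 then 1 else 0) *\<^sub>C v"
    "rho ghat_k v = v"
    using hw by (auto simp: highest_weight_module_def cscale_one)
  have "rho ghat_k (rho X u) = rho X (rho ghat_k u)" for X u
    using act_lie[of X ghat_k u] by (simp add: ghat_k_central)
  \<comment> \<open>As \<open>ghat_k\<close> is central, its fixed vectors form a submodule; it
    contains \<open>v\<close> and hence is everything.\<close>
  then have "lie_submodule rho {u. rho ghat_k u = u}"
    by (simp add: lie_submodule_def act_add_right act_cscale_right)
  then have "{u. rho ghat_k u = u} = {0} \<or> {u. rho ghat_k u = u} = UNIV"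
    using irr unfolding irreducible_module_def by blast
  then show k: "rho ghat_k u = u" for u using v(1,4) by auto
  interpret ops: level_one_ops "\<lambda>n. rho (aff sl2_xa n)" "\<lambda>n. rho (aff sl2_xma n)" "\<lambda>n. rho (aff sl2_h n)"
    by (rule lie_module_level_one_ops[OF mod k irr])
  have "aff sl2_xa 0 \<in> ghat_pos"
    by (auto simp: ghat_pos_def aff_def lookup_single when_def intro!: exI[of _ 1] cscale_one[symmetric])
  moreover have "aff sl2_xma 1 \<in> ghat_pos"
    by (auto simp: ghat_pos_def aff_def lookup_single when_def intro!: exI[of _ 0])
  ultimately show "level_one_hw (\<lambda>n. rho (aff sl2_xa n)) (\<lambda>n. rho (aff sl2_xma n)) (\<lambda>n. rho (aff sl2_h n)) v
     (if i = 1 then 1 else 0)"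
    by unfold_locales (simp_all add: ops.singular_def v)
qed

section \<open>Generalized Verma modules\<close>

lemma tensor_add_left: "tensor (a + b) m = tensor a m + tensor b m"
  using tensor_rel.add_left[of a b m]
  by (simp add: tensor_def plus_induced.abs_eq induced.abs_eq_iff algebra_simps)

lemma tensor_zero_right: "tensor a (0 :: 'm::ghat_nonneg_module) = 0"
proof -
  have "tensor a ((0::'m) + 0) = tensor a 0 + tensor a (0::'m)"
    using tensor_rel.add_right[of a "0::'m" 0]
    unfolding tensor_def plus_induced.abs_eq induced.abs_eq_iff by (simp add: algebra_simps)
  then show ?thesis by simp
qed

lemma tensor_zero_left: "tensor 0 m = 0"
  using tensor_add_left[of 0 0 m] by simp

lemma tensor_balanced: "tensor (a * uea_incl b) m = tensor a (uea_act nn_act b m)"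
  using tensor_rel.balanced[of a b m] by (simp add: tensor_def induced.abs_eq_iff)

lemma lie_module_incl: "lie_module (\<lambda>X u. uea_of (incl_nonneg X) * u)"
  by standard (simp_all add: plus_ghat_nonneg.rep_eq cscale_ghat_nonneg.rep_eq lie_ghat_nonneg.rep_eq
      uea_of_add uea_of_cscale uea_of_lie uea_cscale_mult distrib_left distrib_right left_diff_distrib mult.assoc)

lemma lie_module_nn_act: "lie_module (nn_act :: _ \<Rightarrow> 'm::ghat_nonneg_module \<Rightarrow> 'm)"
  by standard (fact nn_act_add_left nn_act_add_right nn_act_cscale_left nn_act_cscale_right nn_act_lie)+

lemma uea_incl_simps:
  "uea_incl 1 = 1" "uea_incl (a + b) = uea_incl a + uea_incl b" "uea_incl (c *\<^sub>C a) = c *\<^sub>C uea_incl a"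
  "uea_incl (uea_of X * a) = uea_of (incl_nonneg X) * uea_incl a"
proof -
  interpret lie_module "\<lambda>X u. uea_of (incl_nonneg X) * u" by (rule lie_module_incl)
  show "uea_incl 1 = 1" "uea_incl (a + b) = uea_incl a + uea_incl b" "uea_incl (c *\<^sub>C a) = c *\<^sub>C uea_incl a"
    "uea_incl (uea_of X * a) = uea_of (incl_nonneg X) * uea_incl a"
    by (simp_all add: uea_incl_def uea_act_add uea_act_cscale uea_act_mult)
qed

lemma tensor_nonneg:
  fixes m :: "'m::ghat_nonneg_module"
  shows "tensor (uea_of (incl_nonneg X)) m = tensor 1 (nn_act X m)"
proof -
  interpret lie_module "nn_act :: _ \<Rightarrow> 'm \<Rightarrow> 'm" by (rule lie_module_nn_act)
  have "uea_incl (uea_of X) = uea_of (incl_nonneg X)"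
    using uea_incl_simps(4)[of X 1] by (simp add: uea_incl_simps(1))
  then show ?thesis using tensor_balanced[of 1 "uea_of X" m] by simp
qed

text \<open>The universal property of the induced module, for the map \<open>a \<otimes> m \<mapsto> a \<cdot> \<phi> m\<close>.\<close>

lemma tensor_eq_imp_act_eq:
  fixes \<phi> :: "'m::ghat_nonneg_module \<Rightarrow> 'v::complex_vs"
  assumes mod: "lie_module rho"
    and \<phi>: "\<And>m m'. \<phi> (m + m') = \<phi> m + \<phi> m'" "\<And>c m. \<phi> (c *\<^sub>C m) = c *\<^sub>C \<phi> m"
      "\<And>X m. \<phi> (nn_act X m) = rho (incl_nonneg X) (\<phi> m)"
    and eq: "tensor a m = tensor b m'"
  shows "uea_act rho a (\<phi> m) = uea_act rho b (\<phi> m')"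
proof -
  interpret lie_module rho by fact
  interpret nn: lie_module "nn_act :: _ \<Rightarrow> 'm \<Rightarrow> 'm" by (rule lie_module_nn_act)
  define g where "g = (\<lambda>(u, m). uea_act rho u (\<phi> m))"
  \<comment> \<open>The additive extension of \<open>g\<close> to the free abelian group on pairs.
    It vanishes on \<open>tensor_rel\<close>, so pairs with equal tensors have equal values.\<close>
  define \<Phi> where "\<Phi> x = (\<Sum>k\<in>Poly_Mapping.keys x. of_int (Poly_Mapping.lookup x k) *\<^sub>C g k)" for x
  have \<Phi>_add: "\<Phi> (x + y) = \<Phi> x + \<Phi> y" for x y
    unfolding \<Phi>_def by (rule keys_sum_add) (simp add: cscale_add_left)
  have \<Phi>_0: "\<Phi> 0 = 0" by (simp add: \<Phi>_def)
  have \<Phi>_minus: "\<Phi> (- x) = - \<Phi> x" for x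
    using \<Phi>_add[of "- x" x] by (simp add: \<Phi>_0 eq_neg_iff_add_eq_0)
  have \<Phi>_diff: "\<Phi> (x - y) = \<Phi> x - \<Phi> y" for x y
    using \<Phi>_add[of x "- y"] by (simp add: \<Phi>_minus)
  have \<Phi>_of: "\<Phi> (frag_of k) = g k" for k
    by (simp add: \<Phi>_def cscale_one)
  have incl: "uea_act rho (uea_incl c) (\<phi> m) = \<phi> (uea_act nn_act c m)" for c m
    by (induction c rule: uea_induct)
      (simp_all add: uea_incl_simps uea_act_mult uea_act_add uea_act_cscale nn.uea_act_mult nn.uea_act_add
        nn.uea_act_cscale \<phi>)
  have "\<Phi> x = 0" if "x \<in> tensor_rel" for x
    using that
    by induction (simp_all add: \<Phi>_add \<Phi>_0 \<Phi>_minus \<Phi>_diff \<Phi>_of g_def uea_act_add uea_act_add_right uea_act_mult incl \<phi>(1))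
  moreover have "frag_of (a, m) - frag_of (b, m') \<in> tensor_rel"
    using eq by (simp add: tensor_def induced.abs_eq_iff)
  ultimately have "\<Phi> (frag_of (a, m) - frag_of (b, m')) = 0" by blast
  then show ?thesis by (simp add: \<Phi>_diff \<Phi>_of g_def)
qed

section \<open>From homogeneous to arbitrary polynomials\<close>

lemma eigenvectors_sum_zero:
  fixes T :: "'v::complex_vs \<Rightarrow> 'v"
  assumes "finite D" "inj_on c D"
    and T: "\<And>u w. T (u + w) = T u + T w" "\<And>a u. T (a *\<^sub>C u) = a *\<^sub>C T u"
    and "\<And>i. i \<in> D \<Longrightarrow> T (u i) = c i *\<^sub>C u i" "(\<Sum>i\<in>D. u i) = 0" "i \<in> D"
  shows "u i = 0"
  using assms(1,2,5-)
proof (induction D arbitrary: u i)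
  case (insert d D)
  have T_zero: "T 0 = 0" using T(2)[of 0 0] by simp
  have T_sum: "T (\<Sum>i\<in>A. g i) = (\<Sum>i\<in>A. T (g i))" for A and g :: "_ \<Rightarrow> 'v"
    by (induction A rule: infinite_finite_induct) (simp_all add: T(1) T_zero)
  have eig: "T (u i) = c i *\<^sub>C u i" if "i \<in> insert d D" for i using insert.prems that by blast
  have sum: "(\<Sum>i\<in>D. u i) = (-1) *\<^sub>C u d"
    using insert.prems(3) insert.hyps by (simp add: cscale_minus_left cscale_one eq_neg_iff_add_eq_0 add.commute)
  have D: "u i = 0" if i: "i \<in> D" for i
  proof -
    \<comment> \<open>Applying \<open>T - c d\<close> to the relation removes \<open>u d\<close> and
      only rescales the other eigenvectors.\<close>
    have "(\<Sum>i\<in>D. (c i - c d) *\<^sub>C u i) = (\<Sum>i\<in>D. T (u i)) - c d *\<^sub>C (\<Sum>i\<in>D. u i)"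
      by (simp add: eig cvs.scale_left_diff_distrib sum_subtractf cscale_sum_right)
    also have "\<dots> = 0"
      unfolding T_sum[symmetric] sum T(2) by (simp add: eig mult.commute)
    finally have "(c i - c d) *\<^sub>C u i = 0"
      using insert.prems(1) i
      by (intro insert.IH[of "\<lambda>i. (c i - c d) *\<^sub>C u i"]) (auto simp: T(2) eig mult.commute)
    moreover have "c i \<noteq> c d" using insert.prems(1) insert.hyps i by (auto simp: inj_on_def)
    ultimately show ?thesis by simp
  qed
  then have "u d = 0" using insert.prems(3) insert.hyps by simp
  with D show ?case using insert.prems(4) by blast
qed simp

context level_one_vacuum
begin

lemma h0_act:
  assumes "p \<in> graded r n"
  shows "h 0 (act (mode 0) p v) = (2 * of_int r) *\<^sub>C act (mode 0) p v"
proof -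
  interpret m: commuting_ops "mode 0" by (rule commuting_ops_mode)
  have monomial: "h 0 (fold_mset (mode 0) v M) = (2 * of_nat (size M)) *\<^sub>C fold_mset (mode 0) v M" for M
  proof (induction M)
    case (add j M)
    have "h 0 (mode 0 j w) = mode 0 j (h 0 w) + 2 *\<^sub>C mode 0 j w" for w
      by (simp add: mode_def he)
    with add show ?case by (simp add: m.x_cscale cscale_add_left distrib_left add.commute)
  qed (simp add: v_ops)
  show ?thesis
    using assms
    by (induction rule: graded_induct) (auto simp: monomial act_single act_add lin cscale_add_right mult.commute)
qed

end

definition positive :: "cpoly set" where
  "positive = {p. \<forall>M\<in>Poly_Mapping.keys p. 0 \<notin># M}"

lemma positive_induct [consumes 1, case_names zero single add]:
  assumes "p \<in> positive" "P 0" "\<And>M c. 0 \<notin># M \<Longrightarrow> P (Poly_Mapping.single M c)"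
    "\<And>p q. P p \<Longrightarrow> P q \<Longrightarrow> P (p + q)"
  shows "P p"
  by (rule keys_induct[of p "{M. 0 \<notin># M}"]) (use assms in \<open>auto simp: positive_def\<close>)

lemma graded_positive: "p \<in> graded r n \<Longrightarrow> p \<in> positive"
  by (auto simp: graded_def positive_def)

lemma positive_zero: "0 \<in> positive" and positive_one: "1 \<in> positive"
  and positive_Var: "j \<ge> 1 \<Longrightarrow> Var j \<in> positive"
  by (auto simp: positive_def Var_def simp flip: single_one)

lemma positive_add: "p \<in> positive \<Longrightarrow> q \<in> positive \<Longrightarrow> p + q \<in> positive"
  unfolding positive_def using Poly_Mapping.keys_add[of p q] by blast

lemma positive_mult: "p \<in> positive \<Longrightarrow> q \<in> positive \<Longrightarrow> p * q \<in> positive"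
  unfolding positive_def using keys_mult[of p q] by fastforce

lemma positive_cscale: "p \<in> positive \<Longrightarrow> c *\<^sub>C p \<in> positive"
  using positive_mult[of "Poly_Mapping.single 0 c" p] by (simp add: cscale_cpoly positive_def)

lemma positive_decompose: "p \<in> positive \<Longrightarrow> \<exists>b\<in>positive. \<exists>g\<in>positive. p = shift 1 b + g * Var 1"
proof (induction rule: positive_induct)
  case zero
  then show ?case by (intro bexI[of _ 0]) (simp_all add: positive_zero)
next
  case (single M c)
  then have "Poly_Mapping.single M c \<in> graded (int (size M)) (int (sum_mset M))"
    by (simp add: graded_single_iff)
  from graded_decompose[OF this] show ?case using graded_positive by blast
next
  case (add p q)
  then obtain b g b' g' where *: "b \<in> positive" "g \<in> positive" "p = shift 1 b + g * Var 1"
    "b' \<in> positive" "g' \<in> positive" "q = shift 1 b' + g' * Var 1" by blast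
  then have "p + q = shift 1 (b + b') + (g + g') * Var 1"
    by (simp add: shift_add algebra_simps)
  with * show ?case using positive_add by blast
qed

text \<open>The components are a total function vanishing outside \<open>D\<close>, with one weight
  bound for all, so that two decompositions can be added pointwise.\<close>

lemma positive_homogeneous:
  assumes "p \<in> positive"
  shows "\<exists>D q n. finite D \<and> p = (\<Sum>r\<in>D. q r) \<and> (\<forall>r. q r \<in> graded (int r) n) \<and> (\<forall>r. r \<notin> D \<longrightarrow> q r = 0)"
  using assms
proof (induction rule: positive_induct)
  case zero
  show ?case by (intro exI[of _ "{}"] exI[of _ "\<lambda>_. 0"]) simp
next
  case (single M c)
  then show ?case
    by (intro exI[of _ "{size M}"] exI[of _ "\<lambda>r. if r = size M then Poly_Mapping.single M c else 0"]
        exI[of _ "int (sum_mset M)"]) (simp add: graded_single_iff)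
next
  case (add p p')
  obtain D q n D' q' n' where q: "finite D" "p = (\<Sum>r\<in>D. q r)" "\<And>r. q r \<in> graded (int r) n" "\<And>r. r \<notin> D \<Longrightarrow> q r = 0"
    and q': "finite D'" "p' = (\<Sum>r\<in>D'. q' r)" "\<And>r. q' r \<in> graded (int r) n'" "\<And>r. r \<notin> D' \<Longrightarrow> q' r = 0"
    using add by blast
  have "p = (\<Sum>r\<in>D \<union> D'. q r)" "p' = (\<Sum>r\<in>D \<union> D'. q' r)"
    unfolding q(2) q'(2) by (rule sum.mono_neutral_left; use q(1,4) q'(1,4) in auto)+
  then have "p + p' = (\<Sum>r\<in>D \<union> D'. q r + q' r)" by (simp add: sum.distrib)
  moreover have "q r + q' r \<in> graded (int r) (max n n')" for r
    using graded_mono[OF q(3)[of r]] graded_mono[OF q'(3)[of r]] by (simp add: graded_add)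
  ultimately show ?case using q(1,4) q'(1,4)
    by (intro exI[of _ "D \<union> D'"] exI[of _ "\<lambda>r. q r + q' r"] exI[of _ "max n n'"]) auto
qed

text \<open>\<open>h 0\<close> has eigenvalue 2r on the component of degree r, so every component
  kills \<open>v\<close> by itself and lies in some \<open>rel_ideal\<close>. The form of an
  induction rule suits the different images of these polynomials in the enveloping algebra.\<close>

lemma vacuum_annihilator_induct:
  assumes vac: "level_one_vacuum e f h v" and p: "p \<in> positive" and kill: "act (level_one_ops.mode e 0) p v = 0"
    and P: "P 0" "\<And>p q. P p \<Longrightarrow> P q \<Longrightarrow> P (p + q)" "\<And>q r n. q \<in> rel_ideal r n \<Longrightarrow> P q"
  shows "P p"
proof -
  interpret level_one_vacuum e f h v by fact
  obtain D q n where q: "finite D" "p = (\<Sum>r\<in>D. q r)" "\<And>r. q r \<in> graded (int r) n"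
    using positive_homogeneous[OF p] by blast
  have component: "P (q r)" if "r \<in> D" for r
  proof -
    have "act (mode 0) (q r) v = 0"
      by (rule eigenvectors_sum_zero[of D "\<lambda>r. 2 * of_int (int r)" "h 0"])
        (use q that kill in \<open>auto simp: h0_act[OF q(3)] lin inj_on_def act_sum\<close>)
    then have "q r \<in> rel_ideal (int r) n"
      by (intro rel_ideal_if_kills[OF vac q(3), of "nat (n + 1)"]) auto
    then show ?thesis by (rule P(3))
  qed
  have "P (\<Sum>r\<in>E. q r)" if "finite E" "E \<subseteq> D" for E
    using that by (induction rule: finite_induct) (auto intro: P component)
  then show ?thesis using q(1) by (simp add: q(2))
qed

section \<open>Evaluation of polynomials in the enveloping algebra\<close>

lemma lie_xa: "lie (aff sl2_xa m) (aff sl2_xa n) = 0"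
  by (simp add: lie_aff lie_self sl2_forms aff_zero)

lemma xa_commute: "xa m * xa n = xa n * xa m"
  using uea_of_lie[of "aff sl2_xa m" "aff sl2_xa n"] by (simp add: xa_def lie_xa)

lemma commuting_ops_xa: "commuting_ops (\<lambda>j a. xa (s - int j) * a)"
  by standard (simp_all add: distrib_left uea_cscale_mult xa_commute flip: mult.assoc)

text \<open>The algebra map sending \<open>Var j\<close> to \<open>xa (s - int j)\<close>. It maps
  \<open>positive\<close> onto \<open>U_nbar_minus\<close> for \<open>s = 0\<close> and onto
  \<open>U_nbar_le_m2\<close> for \<open>s = -1\<close>.\<close>

definition ev :: "int \<Rightarrow> cpoly \<Rightarrow> ghat uea" where
  "ev s p = act (\<lambda>j a. xa (s - int j) * a) p 1"

lemma act_xa: "act (\<lambda>j a. xa (s - int j) * a) p b = ev s p * b"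
proof -
  interpret commuting_ops "\<lambda>j a. xa (s - int j) * a" by (rule commuting_ops_xa)
  have "fold_mset (\<lambda>j a. xa (s - int j) * a) b M = fold_mset (\<lambda>j a. xa (s - int j) * a) 1 M * b" for M
    by (induction M) (simp_all add: mult.assoc)
  then show ?thesis
    by (induction p rule: poly_mapping_add_induct)
      (simp_all add: ev_def act_single act_add distrib_right uea_cscale_mult)
qed

lemma ev_zero [simp]: "ev s 0 = 0"
  by (simp add: ev_def)

lemma ev_one [simp]: "ev s 1 = 1"
  unfolding ev_def by (rule commuting_ops.act_one[OF commuting_ops_xa])

lemma ev_Var: "ev s (Var j) = xa (s - int j)"
  unfolding ev_def using commuting_ops.act_Var[OF commuting_ops_xa, of s j 1] by simp

lemma ev_add: "ev s (p + q) = ev s p + ev s q"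
  and ev_cscale: "ev s (c *\<^sub>C p) = c *\<^sub>C ev s p"
  and ev_sum: "ev s (\<Sum>i\<in>A. g i) = (\<Sum>i\<in>A. ev s (g i))"
  by (simp_all add: ev_def act_add act_cscale act_sum)

lemma ev_mult: "ev s (p * q) = ev s p * ev s q"
  unfolding ev_def commuting_ops.act_mult[OF commuting_ops_xa] unfolding act_xa by simp

lemma ev_shift: "ev s (shift k p) = ev (s - int k) p"
  unfolding ev_def act_shift[OF commuting_ops_xa] by (simp add: algebra_simps)

lemma uea_act_ev:
  assumes "lie_module rho"
  shows "uea_act rho (ev s p) u = act (\<lambda>j. rho (aff sl2_xa (s - int j))) p u"
proof -
  interpret lie_module rho by fact
  interpret U: commuting_ops "\<lambda>j a. xa (s - int j) * a" by (rule commuting_ops_xa)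
  interpret L: commuting_ops "\<lambda>j. rho (aff sl2_xa (s - int j))"
  proof
    fix j k u
    have "rho (lie (aff sl2_xa (s - int j)) (aff sl2_xa (s - int k))) u = 0" by (simp add: lie_xa)
    then show "rho (aff sl2_xa (s - int j)) (rho (aff sl2_xa (s - int k)) u) =
      rho (aff sl2_xa (s - int k)) (rho (aff sl2_xa (s - int j)) u)"
      by (simp add: act_lie)
  qed (simp_all add: act_add_right act_cscale_right)
  have "uea_act rho (fold_mset (\<lambda>j a. xa (s - int j) * a) 1 M) u =
      fold_mset (\<lambda>j. rho (aff sl2_xa (s - int j))) u M" for M
  proof (induction M)
    case (add j M)
    have "uea_act rho (xa m * a) u = rho (aff sl2_xa m) (uea_act rho a u)" for m a
      by (simp add: uea_act_mult xa_def)
    with add show ?case by simp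
  qed simp
  then show ?thesis
    by (induction p rule: poly_mapping_add_induct)
      (simp_all add: ev_def act_single act_add uea_act_add uea_act_cscale)
qed

lemma subalgebra_xa: "subalgebra {xa m | m. m \<le> s - 1} = ev s ` positive"
proof
  show "subalgebra {xa m | m. m \<le> s - 1} \<subseteq> ev s ` positive"
  proof
    fix a assume "a \<in> subalgebra {xa m | m. m \<le> s - 1}"
    then show "a \<in> ev s ` positive"
    proof induction
      case (gen x)
      then obtain m where m: "m \<le> s - 1" "x = xa m" by auto
      then have "x = ev s (Var (nat (s - m)))" by (simp add: ev_Var)
      moreover have "Var (nat (s - m)) \<in> positive" using m by (intro positive_Var) simp
      ultimately show ?case by blast
    next
      case one
      then show ?case by (rule image_eqI[of _ _ 1]) (simp_all add: positive_one)
    next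
      case (add a b)
      then show ?case using positive_add by (auto simp flip: ev_add)
    next
      case (cscale a c)
      then show ?case using positive_cscale by (auto simp flip: ev_cscale)
    next
      case (mult a b)
      then show ?case using positive_mult by (auto simp flip: ev_mult)
    qed
  qed
  have "ev s p \<in> subalgebra {xa m | m. m \<le> s - 1}" if "p \<in> positive" for p
    using that
  proof (induction rule: positive_induct)
    case zero
    show ?case using subalgebra.cscale[OF subalgebra.one, of 0] by simp
  next
    case (single M c)
    interpret commuting_ops "\<lambda>j a. xa (s - int j) * a" by (rule commuting_ops_xa)
    have "fold_mset (\<lambda>j a. xa (s - int j) * a) 1 M \<in> subalgebra {xa m | m. m \<le> s - 1}"
      using single
    proof (induction M)
      case (add j M)
      then have "s - int j \<le> s - 1" by simp
      then have "xa (s - int j) \<in> subalgebra {xa m | m. m \<le> s - 1}" by (blast intro: subalgebra.gen)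
      then show ?case using add by (simp add: subalgebra.mult)
    qed (simp add: subalgebra.one)
    then show ?case by (simp add: ev_def act_single subalgebra.cscale)
  qed (simp add: ev_add subalgebra.add)
  then show "ev s ` positive \<subseteq> subalgebra {xa m | m. m \<le> s - 1}" by blast
qed

lemma U_nbar_minus_eq: "U_nbar_minus = ev 0 ` positive"
  using subalgebra_xa[of 0] by (simp add: U_nbar_minus_def)

lemma U_nbar_le_m2_eq: "U_nbar_le_m2 = ev (-1) ` positive"
  using subalgebra_xa[of "-1"] by (simp add: U_nbar_le_m2_def)

lemma ev_Rel:
  "ev s (Rel t) = (\<Sum>(m1, m2) | m1 \<le> s - 1 \<and> m2 \<le> s - 1 \<and> m1 + m2 = 2 * s - int t. xa m1 * xa m2)"
proof -
  have "ev s (Rel t) = (\<Sum>j\<in>{1..<t}. xa (s - int j) * xa (s - int (t - j)))"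
    by (simp add: Rel_def ev_sum ev_mult ev_Var)
  also have "\<dots> = (\<Sum>(m1, m2) | m1 \<le> s - 1 \<and> m2 \<le> s - 1 \<and> m1 + m2 = 2 * s - int t. xa m1 * xa m2)"
    by (rule sum.reindex_bij_witness[of _ "\<lambda>(m1, m2). nat (s - m1)" "\<lambda>j. (s - int j, s - int (t - j))"]) auto
  finally show ?thesis .
qed

lemma R0_eq: "R0 (int t) = ev 0 (Rel t)"
  by (simp add: R0_def ev_Rel)

text \<open>Both indices are lowered by one, so their sum drops by 2.\<close>

lemma R1_eq: "R1 (int t + 2) = ev (-1) (Rel t)"
proof -
  have "(-1::int) - 1 = - 2" "2 * (-1) - int t = - (int t + 2)" by simp_all
  then show ?thesis unfolding R1_def ev_Rel by (simp only:)
qed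

section \<open>The ideals of relations in the enveloping algebra\<close>

definition lincombs :: "ghat uea set \<Rightarrow> (int \<Rightarrow> ghat uea) \<Rightarrow> int set \<Rightarrow> ghat uea set" where
  "lincombs U R S = {\<Sum>t\<in>T. a t * R t | T a. finite T \<and> T \<subseteq> S \<and> (\<forall>t\<in>T. a t \<in> U)}"

lemma lincombs_zero: "0 \<in> lincombs U R S"
  unfolding lincombs_def by (intro CollectI exI[of _ "{}"]) simp

lemma lincombs_single: "a \<in> U \<Longrightarrow> t \<in> S \<Longrightarrow> a * R t \<in> lincombs U R S"
  unfolding lincombs_def by (intro CollectI exI[of _ "{t}"] exI[of _ "\<lambda>_. a"]) simp

lemma lincombs_add:
  assumes U: "0 \<in> U" "\<And>a b. a \<in> U \<Longrightarrow> b \<in> U \<Longrightarrow> a + b \<in> U"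
    and "x \<in> lincombs U R S" "y \<in> lincombs U R S"
  shows "x + y \<in> lincombs U R S"
proof -
  obtain T a T' a' where T: "x = (\<Sum>t\<in>T. a t * R t)" "finite T" "T \<subseteq> S" "\<forall>t\<in>T. a t \<in> U"
    and T': "y = (\<Sum>t\<in>T'. a' t * R t)" "finite T'" "T' \<subseteq> S" "\<forall>t\<in>T'. a' t \<in> U"
    using assms(3,4) unfolding lincombs_def by blast
  let ?a = "\<lambda>t. if t \<in> T then a t else 0" and ?a' = "\<lambda>t. if t \<in> T' then a' t else 0"
  have "x = (\<Sum>t\<in>T \<union> T'. ?a t * R t)" "y = (\<Sum>t\<in>T \<union> T'. ?a' t * R t)"
    unfolding T(1) T'(1) by (rule sum.mono_neutral_cong_left; use T(2) T'(2) in auto)+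
  then have "x + y = (\<Sum>t\<in>T \<union> T'. (?a t + ?a' t) * R t)"
    by (simp only: distrib_right sum.distrib)
  moreover have "\<forall>t\<in>T \<union> T'. ?a t + ?a' t \<in> U" using T(4) T'(4) U by auto
  ultimately show ?thesis
    using T(2,3) T'(2,3) unfolding lincombs_def
    by (intro CollectI exI[of _ "T \<union> T'"] exI[of _ "\<lambda>t. ?a t + ?a' t"]) auto
qed

lemma lincombs_induct [consumes 1, case_names zero add]:
  assumes "x \<in> lincombs U R S" "P 0" "\<And>x a t. P x \<Longrightarrow> a \<in> U \<Longrightarrow> t \<in> S \<Longrightarrow> P (a * R t + x)"
  shows "P x"
proof -
  obtain T a where T: "x = (\<Sum>t\<in>T. a t * R t)" "finite T" "T \<subseteq> S" "\<forall>t\<in>T. a t \<in> U"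
    using assms(1) unfolding lincombs_def by blast
  from T(2-4) have "P (\<Sum>t\<in>T. a t * R t)" by induction (auto intro: assms(2,3))
  then show ?thesis by (simp add: T(1))
qed

lemma I_0_eq: "I_0 = lincombs U_nbar_minus R0 {2..}"
  by (simp add: I_0_def lincombs_def)

lemma I_1'_eq: "I_1' = lincombs U_nbar_le_m2 R1 {4..}"
  by (simp add: I_1'_def lincombs_def)

lemma U_nbar_minus_zero: "0 \<in> U_nbar_minus" and U_nbar_le_m2_zero: "0 \<in> U_nbar_le_m2"
  using subalgebra.cscale[OF subalgebra.one, of 0] by (simp_all add: U_nbar_minus_def U_nbar_le_m2_def)

lemma I_0_add: "x \<in> I_0 \<Longrightarrow> y \<in> I_0 \<Longrightarrow> x + y \<in> I_0"
  unfolding I_0_eq by (rule lincombs_add) (auto simp: U_nbar_minus_zero, auto simp: U_nbar_minus_def intro: subalgebra.add)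

lemma I_1'_add: "x \<in> I_1' \<Longrightarrow> y \<in> I_1' \<Longrightarrow> x + y \<in> I_1'"
  unfolding I_1'_eq by (rule lincombs_add) (auto simp: U_nbar_le_m2_zero, auto simp: U_nbar_le_m2_def intro: subalgebra.add)

lemma ev_rel_ideal: "p \<in> rel_ideal r n \<Longrightarrow> ev 0 p \<in> I_0 \<and> ev (-1) p \<in> I_1'"
proof (induction rule: rel_ideal.induct)
  case zero
  show ?case by (simp add: I_0_eq I_1'_eq lincombs_zero)
next
  case (add p q)
  then show ?case by (simp add: ev_add I_0_add I_1'_add)
next
  case (gen p t)
  then have "ev 0 p \<in> U_nbar_minus" "ev (-1) p \<in> U_nbar_le_m2"
    using graded_positive by (auto simp: U_nbar_minus_eq U_nbar_le_m2_eq)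
  with gen show ?case
    unfolding ev_mult R0_eq[symmetric] R1_eq[symmetric] I_0_eq I_1'_eq
    by (intro conjI lincombs_single) auto
qed

text \<open>A shifted relation is a relation up to a multiple of \<open>Var 1\<close>, and
  \<open>I_1\<close> contains the multiples of x(-1).\<close>

lemma ev_shift_rel_ideal:
  assumes "p \<in> rel_ideal r n"
  shows "ev 0 (shift 1 p) \<in> I_1"
proof -
  obtain q g where q: "shift 1 p = q + g * Var 1" "q \<in> rel_ideal r (n + r)" "g \<in> graded (r - 1) (n + r - 1)"
    using rel_ideal_shift_1[OF assms] by blast
  have "ev 0 (shift 1 p) = ev 0 q + ev 0 g * xa (-1)"
    unfolding q(1) by (simp add: ev_add ev_mult ev_Var)
  moreover have "ev 0 q \<in> I_0" using ev_rel_ideal[OF q(2)] by blast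
  moreover have "ev 0 g \<in> U_nbar_minus" using graded_positive[OF q(3)] by (simp add: U_nbar_minus_eq)
  ultimately show ?thesis unfolding I_1_def by blast
qed

lemma U_nbar_minus_add: "a \<in> U_nbar_minus \<Longrightarrow> b \<in> U_nbar_minus \<Longrightarrow> a + b \<in> U_nbar_minus"
  by (simp add: U_nbar_minus_def subalgebra.add)

lemma I_1_add: "x \<in> I_1 \<Longrightarrow> y \<in> I_1 \<Longrightarrow> x + y \<in> I_1"
proof -
  assume "x \<in> I_1" "y \<in> I_1"
  then obtain r a r' a' where "x = r + a * xa (-1)" "r \<in> I_0" "a \<in> U_nbar_minus"
    "y = r' + a' * xa (-1)" "r' \<in> I_0" "a' \<in> U_nbar_minus" unfolding I_1_def by blast
  moreover from this have "x + y = (r + r') + (a + a') * xa (-1)" by (simp add: algebra_simps)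
  ultimately show ?thesis unfolding I_1_def using I_0_add U_nbar_minus_add by blast
qed

lemma mode_eq: "level_one_ops e f h \<Longrightarrow> e = (\<lambda>n. g (n + s)) \<Longrightarrow> level_one_ops.mode e 0 = (\<lambda>j. g (s - int j))"
proof
  fix j
  assume "level_one_ops e f h" "e = (\<lambda>n. g (n + s))"
  moreover have "0 - int j + s = s - int j" by simp
  ultimately show "level_one_ops.mode e 0 j = g (s - int j)"
    by (simp only: level_one_ops.mode_def)
qed

context
  fixes rho :: "ghat \<Rightarrow> 'v::complex_vs \<Rightarrow> 'v" and s :: int and f h :: "int \<Rightarrow> 'v \<Rightarrow> 'v" and v :: 'v
  assumes mod: "lie_module rho" and vac: "level_one_vacuum (\<lambda>n. rho (aff sl2_xa (n + s))) f h v"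
begin

text \<open>The parameter \<open>s\<close> records the spectral flow: below it is 0 for weight
  \<Lambda>_0, and -1 for \<Lambda>_1, where the flowed modes see \<open>v\<close> as a vacuum
  vector.\<close>

lemma uea_act_ev_mode: "uea_act rho (ev s p) v = act (level_one_ops.mode (\<lambda>n. rho (aff sl2_xa (n + s))) 0) p v"
proof -
  interpret level_one_vacuum "\<lambda>n. rho (aff sl2_xa (n + s))" f h v by (rule vac)
  have "mode 0 = (\<lambda>j. rho (aff sl2_xa (s - int j)))"
    by (rule mode_eq[OF level_one_ops_axioms, where g = "\<lambda>n. rho (aff sl2_xa n)"]) simp
  then show ?thesis by (simp add: uea_act_ev[OF mod])
qed

lemma ev_Rel_kills: "uea_act rho (ev s (Rel t)) v = 0"
  unfolding uea_act_ev_mode by (rule level_one_vacuum.act_Rel[OF vac])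

lemma ev_annihilator_induct:
  assumes "p \<in> positive" "uea_act rho (ev s p) v = 0"
    "P 0" "\<And>p q. P p \<Longrightarrow> P q \<Longrightarrow> P (p + q)" "\<And>q r n. q \<in> rel_ideal r n \<Longrightarrow> P q"
  shows "P p"
  by (rule vacuum_annihilator_induct[OF vac assms(1) assms(2)[unfolded uea_act_ev_mode] assms(3-)])

end

section \<open>Principal subspaces of the generalized Verma modules\<close>

lemma subalgebra_mono: "S \<subseteq> T \<Longrightarrow> subalgebra S \<subseteq> subalgebra T"
proof
  fix a assume "S \<subseteq> T" "a \<in> subalgebra S"
  from this(2,1) show "a \<in> subalgebra T" by induction (auto intro: subalgebra.intros)
qed

lemma U_nbar_subsets: "U_nbar_minus \<subseteq> U_nbar" "U_nbar_le_m2 \<subseteq> U_nbar" "U_nbar_le_m2 \<subseteq> U_nbar_minus"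
  unfolding U_nbar_def U_nbar_minus_def U_nbar_le_m2_def by (rule subalgebra_mono; force)+

lemma U_nbar_commute:
  assumes "a \<in> U_nbar" "b \<in> U_nbar"
  shows "a * b = b * a"
proof -
  have xa: "xa m * a = a * xa m" for m
    using assms(1) unfolding U_nbar_def
  proof induction
    case (gen s)
    then show ?case by (auto simp: xa_commute)
  next
    case (mult a b)
    have "xa m * (a * b) = (xa m * a) * b" by (simp only: mult.assoc)
    also have "\<dots> = a * b * xa m" unfolding mult.IH(1) mult.assoc mult.IH(2) ..
    finally show ?case .
  qed (simp_all add: distrib_left distrib_right uea_cscale_mult)
  show ?thesis
    using assms(2) unfolding U_nbar_def
  proof induction
    case (gen s)
    then show ?case using xa by auto
  next
    case (mult b c)
    have "a * (b * c) = (a * b) * c" by (simp only: mult.assoc)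
    also have "\<dots> = b * c * a" unfolding mult.IH(1) mult.assoc mult.IH(2) ..
    finally show ?case .
  qed (simp_all add: distrib_left distrib_right uea_cscale_mult)
qed

text \<open>As \<open>U_nbar\<close> is commutative, each factor of a product can be brought next to
  \<open>m\<close> and reduced there in turn.\<close>

lemma U_nbar_reduce:
  assumes m: "\<And>n. n \<ge> 0 \<Longrightarrow> tensor (xa n) m = 0" and "a \<in> U_nbar"
  shows "\<exists>b\<in>U_nbar_minus. tensor a m = tensor b m"
  using assms(2) unfolding U_nbar_def
proof induction
  case (gen x)
  then obtain n where n: "x = xa n" by auto
  show ?case
  proof (cases "n \<ge> 0")
    case True
    then show ?thesis using m[OF True] n U_nbar_minus_zero tensor_zero_left[of m] by metis
  next
    case False
    then have "x \<in> U_nbar_minus" unfolding U_nbar_minus_def n by (auto intro!: subalgebra.gen)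
    then show ?thesis by blast
  qed
next
  case one
  then show ?case unfolding U_nbar_minus_def using subalgebra.one by blast
next
  case (add a b)
  then show ?case using U_nbar_minus_add by (metis tensor_add_left)
next
  case (cscale a c)
  then obtain b where b: "b \<in> U_nbar_minus" "tensor a m = tensor b m" by blast
  have "tensor (c *\<^sub>C x) m = (c *\<^sub>C 1) \<cdot> tensor x m" for x
    by (simp add: umult_tensor uea_cscale_mult)
  then have "tensor (c *\<^sub>C a) m = tensor (c *\<^sub>C b) m" using b by simp
  moreover have "c *\<^sub>C b \<in> U_nbar_minus" using b by (simp add: U_nbar_minus_def subalgebra.cscale)
  ultimately show ?case by blast
next
  case (mult a b)
  then obtain a' b' where *: "a' \<in> U_nbar_minus" "tensor a m = tensor a' m" "b' \<in> U_nbar_minus" "tensor b m = tensor b' m"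
    by blast
  have "a \<in> U_nbar" using mult by (simp add: U_nbar_def)
  have "tensor (a * b) m = a \<cdot> tensor b' m" by (simp add: umult_tensor flip: *(4))
  also have "\<dots> = tensor (b' * a) m"
    using U_nbar_commute[OF \<open>a \<in> U_nbar\<close>, of b'] *(3) U_nbar_subsets(1) by (auto simp: umult_tensor)
  also have "\<dots> = b' \<cdot> tensor a' m" by (simp add: umult_tensor flip: *(2))
  also have "\<dots> = tensor (b' * a') m" by (simp add: umult_tensor)
  finally show ?case using * unfolding U_nbar_minus_def by (blast intro: subalgebra.mult)
qed

lemma xa_nonneg:
  fixes m :: "'m::ghat_nonneg_module"
  assumes "n \<ge> 0"
  shows "tensor (xa n) m = tensor 1 (nn_act (Abs_ghat_nonneg (aff sl2_xa n)) m)"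
    and "incl_nonneg (Abs_ghat_nonneg (aff sl2_xa n)) = aff sl2_xa n"
proof -
  show "incl_nonneg (Abs_ghat_nonneg (aff sl2_xa n)) = aff sl2_xa n"
    using assms by (intro Abs_ghat_nonneg_inverse) (simp add: aff_def lookup_single when_def)
  then show "tensor (xa n) m = tensor 1 (nn_act (Abs_ghat_nonneg (aff sl2_xa n)) m)"
    by (metis tensor_nonneg xa_def)
qed

lemma aff_sel: "cen (aff a n) = 0" "coef (aff a n) 0 = (if n = 0 then a else 0)"
  by (simp_all add: aff_def lookup_single when_def)

lemma xa_vN0: "n \<ge> 0 \<Longrightarrow> tensor (xa n) (Abs_top0 1) = 0"
proof -
  assume n: "n \<ge> 0"
  have "nn_act (Abs_ghat_nonneg (aff sl2_xa n)) (Abs_top0 1) = 0"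
    by (simp add: Rep_top0_inject[symmetric] nn_act_top0.rep_eq zero_top0.rep_eq xa_nonneg(2)[OF n] aff_sel)
  then show ?thesis by (simp add: xa_nonneg(1)[OF n] tensor_zero_right)
qed

lemma xa_vN1: "n \<ge> 0 \<Longrightarrow> tensor (xa n) (Abs_top1 (axis 1 1)) = 0"
proof -
  assume n: "n \<ge> 0"
  have "nn_act (Abs_ghat_nonneg (aff sl2_xa n)) (Abs_top1 (axis 1 1)) = 0"
    by (simp add: Rep_top1_inject[symmetric] nn_act_top1.rep_eq zero_top1.rep_eq xa_nonneg(2)[OF n] aff_sel
        Abs_top1_inverse sl2_xa.rep_eq zero_sl2.rep_eq vec_eq_iff
        matrix_vector_mult_def axis_def sum_2)
  then show ?thesis by (simp add: xa_nonneg(1)[OF n] tensor_zero_right)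
qed

section \<open>The natural maps on the generalized Verma modules\<close>

lemma act_nonneg:
  assumes "lie_module rho" "\<And>u. rho ghat_k u = u"
    and kill: "\<And>a m. m \<ge> 1 \<Longrightarrow> rho (aff a m) u = 0"
  shows "rho (incl_nonneg X) u = rho (aff (coef (incl_nonneg X) 0) 0) u + cen (incl_nonneg X) *\<^sub>C u"
proof -
  interpret lie_module rho by fact
  let ?X = "incl_nonneg X"
  have neg: "coef ?X m = 0" if "m < 0" for m using incl_nonneg[of X] that by blast
  have "rho ?X u = (\<Sum>m\<in>Poly_Mapping.keys (loop ?X). rho (aff (coef ?X m) m) u) + cen ?X *\<^sub>C u"
    by (subst ghat_decompose[of ?X]) (simp add: act_add_left act_sum_left act_cscale_left assms(2))
  also have "(\<Sum>m\<in>Poly_Mapping.keys (loop ?X). rho (aff (coef ?X m) m) u) = (\<Sum>m\<in>{0}. rho (aff (coef ?X m) m) u)"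
  proof (rule sum.mono_neutral_cong)
    fix m assume m: "m \<in> Poly_Mapping.keys (loop ?X) - {0}"
    then have "\<not> m < 0" using neg by (auto simp: in_keys_iff)
    with m show "rho (aff (coef ?X m) m) u = 0" by (intro kill) auto
  next
    fix m assume "m \<in> {0} - Poly_Mapping.keys (loop ?X)"
    then have "coef ?X m = 0" by (auto simp: in_keys_iff)
    then show "rho (aff (coef ?X m) m) u = 0" by (simp only: aff_zero act_zero_left)
  qed simp_all
  finally show ?thesis by simp
qed

lemma aff_act:
  assumes "lie_module rho"
  shows "rho (aff a m) u = mat_of_sl2 a $ 1 $ 1 *\<^sub>C rho (aff sl2_h m) u
    + mat_of_sl2 a $ 1 $ 2 *\<^sub>C rho (aff sl2_xa m) u + mat_of_sl2 a $ 2 $ 1 *\<^sub>C rho (aff sl2_xma m) u"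
proof -
  interpret lie_module rho by fact
  show ?thesis
    by (subst sl2_decompose[of a]) (simp only: aff_add aff_cscale act_add_left act_cscale_left)
qed

text \<open>The hypothesis makes the value independent of the element \<open>a\<close> that
  represents the vector, so the definite description in \<open>Pi_map\<close> has a unique
  solution.\<close>

lemma Pi_map_eq:
  assumes "\<And>a b. a \<cdot> vN = b \<cdot> vN \<Longrightarrow> uea_act rho a v = uea_act rho b v"
  shows "Pi_map vN rho v (a \<cdot> vN) = uea_act rho a v"
  unfolding Pi_map_def
proof (rule the_equality)
  show "\<exists>b. a \<cdot> vN = b \<cdot> vN \<and> uea_act rho a v = uea_act rho b v"
    by (intro exI[of _ a] conjI refl)
next
  fix w assume "\<exists>b. a \<cdot> vN = b \<cdot> vN \<and> w = uea_act rho b v"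
  then obtain b where "a \<cdot> vN = b \<cdot> vN" "w = uea_act rho b v" by (elim exE conjE)
  then show "w = uea_act rho a v" using assms[of a b] by simp
qed

lemma act_vN0: "a \<cdot> vN0 = tensor a (Abs_top0 1)" and act_vN1: "a \<cdot> vN1 = tensor a (Abs_top1 (axis 1 1))"
  by (simp_all add: vN0_def vN1_def umult_tensor)

lemma subalgebra_sum: "(\<And>i. i \<in> A \<Longrightarrow> g i \<in> subalgebra S) \<Longrightarrow> (\<Sum>i\<in>A. g i) \<in> subalgebra S"
proof (induction A rule: infinite_finite_induct)
  case (insert i A)
  then show ?case by (simp add: subalgebra.add)
qed (use subalgebra.cscale[OF subalgebra.one, of 0 S] in simp_all)

lemma R0_in: "R0 t \<in> U_nbar_minus"
  unfolding R0_def U_nbar_minus_def by (rule subalgebra_sum) (force intro!: subalgebra.mult intro: subalgebra.gen)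

lemma R1_in: "R1 t \<in> U_nbar_le_m2"
  unfolding R1_def U_nbar_le_m2_def by (rule subalgebra_sum) (force intro!: subalgebra.mult intro: subalgebra.gen)

lemma I_0_subset: "I_0 \<subseteq> U_nbar_minus"
proof
  fix x assume "x \<in> I_0"
  then show "x \<in> U_nbar_minus"
    unfolding I_0_eq
  proof (induction rule: lincombs_induct)
    case (add x a t)
    then show ?case using R0_in[of t] by (simp add: U_nbar_minus_def subalgebra.add subalgebra.mult)
  qed (rule U_nbar_minus_zero)
qed

lemma I_1'_subset: "I_1' \<subseteq> U_nbar_le_m2"
proof
  fix x assume "x \<in> I_1'"
  then show "x \<in> U_nbar_le_m2"
    unfolding I_1'_eq
  proof (induction rule: lincombs_induct)
    case (add x a t)
    then show ?case using R1_in[of t] by (simp add: U_nbar_le_m2_def subalgebra.add subalgebra.mult)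
  qed (rule U_nbar_le_m2_zero)
qed

lemma I_1_subset: "I_1 \<subseteq> U_nbar_minus"
proof
  fix x assume "x \<in> I_1"
  then obtain r a where "x = r + a * xa (-1)" "r \<in> I_0" "a \<in> U_nbar_minus" unfolding I_1_def by blast
  moreover have "xa (-1) \<in> U_nbar_minus" unfolding U_nbar_minus_def by (auto intro: subalgebra.gen)
  ultimately show "x \<in> U_nbar_minus"
    using I_0_subset by (auto simp: U_nbar_minus_def intro!: subalgebra.add subalgebra.mult)
qed

text \<open>Sending z to z v is a map of modules over the nonnegative part, since all modes of index
  at least 0 kill \<open>v\<close>; for x_{-\<alpha>}(0) this is \<open>f0_v\<close>.\<close>

lemma Pi_map_vN0:
  assumes "is_L 0 rho v"
  shows "Pi_map vN0 rho v (a \<cdot> vN0) = uea_act rho a v"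
proof (rule Pi_map_eq)
  fix a b assume eq: "a \<cdot> vN0 = b \<cdot> vN0"
  note mod = is_L_module(1)[OF assms] and k = is_L_module(2)[OF assms]
  interpret lie_module rho by (rule mod)
  interpret H: level_one_hw "\<lambda>n. rho (aff sl2_xa n)" "\<lambda>n. rho (aff sl2_xma n)" "\<lambda>n. rho (aff sl2_h n)" v 0
    using is_L_module(3)[OF assms] by simp
  have kill: "rho (aff a m) v = 0" if "m \<ge> 0" for a m
    using that H.v_ops(1-3)[of m] H.v_ops(4) H.f0_v by (cases "m = 0") (simp_all add: aff_act[OF mod, of a])
  have "Rep_top0 (Abs_top0 1) *\<^sub>C v = v" by (simp add: Abs_top0_inverse cscale_one)
  moreover have "uea_act rho a (Rep_top0 (Abs_top0 1) *\<^sub>C v) = uea_act rho b (Rep_top0 (Abs_top0 1) *\<^sub>C v)"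
  proof (rule tensor_eq_imp_act_eq[where \<phi> = "\<lambda>z. Rep_top0 z *\<^sub>C v", OF mod])
    show "Rep_top0 (nn_act X z) *\<^sub>C v = rho (incl_nonneg X) (Rep_top0 z *\<^sub>C v)" for X z
      using act_nonneg[OF mod k, of v X] kill
      by (simp add: nn_act_top0.rep_eq act_cscale_right mult.commute)
  qed (use eq in \<open>simp_all add: plus_top0.rep_eq cscale_top0.rep_eq cscale_add_left act_vN0\<close>)
  ultimately show "uea_act rho a v = uea_act rho b v" by simp
qed

text \<open>\<open>v\<close> and \<open>w\<close>, the image of \<open>v\<close> under
  x_{-\<alpha>}(0), receive a map from the natural two-dimensional module: positive modes kill both,
  and \<open>f0_f0_v\<close> says that x_{-\<alpha>}(0) kills \<open>w\<close>.\<close>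

lemma Pi_map_vN1:
  assumes "is_L 1 rho v"
  shows "Pi_map vN1 rho v (a \<cdot> vN1) = uea_act rho a v"
proof (rule Pi_map_eq)
  fix a b assume eq: "a \<cdot> vN1 = b \<cdot> vN1"
  note mod = is_L_module(1)[OF assms] and k = is_L_module(2)[OF assms]
  interpret lie_module rho by (rule mod)
  interpret H: level_one_hw "\<lambda>n. rho (aff sl2_xa n)" "\<lambda>n. rho (aff sl2_xma n)" "\<lambda>n. rho (aff sl2_h n)" v 1
    using is_L_module(3)[OF assms] by simp
  define w where "w = rho (aff sl2_xma 0) v"
  define \<phi> where "\<phi> z = Rep_top1 z $ 1 *\<^sub>C v + Rep_top1 z $ 2 *\<^sub>C w" for z
  have kill: "rho (aff a m) v = 0" "rho (aff a m) w = 0" if "m \<ge> 1" for a m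
    using that H.v_ops(1-3)[of m] H.ff[of m 0 v]
    by (simp_all add: w_def aff_act[OF mod, of a] H.ef H.hf)
  have v0: "rho (aff a 0) v = mat_of_sl2 a $ 1 $ 1 *\<^sub>C v + mat_of_sl2 a $ 2 $ 1 *\<^sub>C w" for a
    using H.v_ops(1)[of 0] H.v_ops(4) by (simp add: aff_act[OF mod, of a] w_def cscale_one)
  have w0: "rho (aff a 0) w = mat_of_sl2 a $ 1 $ 2 *\<^sub>C v - mat_of_sl2 a $ 1 $ 1 *\<^sub>C w" for a
    using H.v_ops(1)[of 0] H.v_ops(4) H.f0_f0_v
    by (simp add: aff_act[OF mod, of a 0 w])
      (simp add: w_def H.ef H.hf cscale_one cscale_two cscale_minus_right cscale_diff_right cscale_add_right)
  have tr: "mat_of_sl2 a $ 2 $ 2 = - mat_of_sl2 a $ 1 $ 1" for a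
    using mat_of_sl2[of a] by (simp add: trace_def sum_2 add_eq_0_iff2)
  have "\<phi> (Abs_top1 (axis 1 1)) = v"
    by (simp add: \<phi>_def Abs_top1_inverse axis_def cscale_one)
  moreover have "uea_act rho a (\<phi> (Abs_top1 (axis 1 1))) = uea_act rho b (\<phi> (Abs_top1 (axis 1 1)))"
  proof (rule tensor_eq_imp_act_eq[where \<phi> = \<phi>, OF mod])
    show "\<phi> (nn_act X z) = rho (incl_nonneg X) (\<phi> z)" for X z
    proof -
      let ?a = "coef (incl_nonneg X) 0" and ?c = "cen (incl_nonneg X)"
      have "rho (incl_nonneg X) v = rho (aff ?a 0) v + ?c *\<^sub>C v"
        "rho (incl_nonneg X) w = rho (aff ?a 0) w + ?c *\<^sub>C w"
        by (rule act_nonneg[OF mod k]; simp add: kill)+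
      then have "rho (incl_nonneg X) (\<phi> z) =
          Rep_top1 z $ 1 *\<^sub>C (mat_of_sl2 ?a $ 1 $ 1 *\<^sub>C v + mat_of_sl2 ?a $ 2 $ 1 *\<^sub>C w + ?c *\<^sub>C v)
        + Rep_top1 z $ 2 *\<^sub>C (mat_of_sl2 ?a $ 1 $ 2 *\<^sub>C v - mat_of_sl2 ?a $ 1 $ 1 *\<^sub>C w + ?c *\<^sub>C w)"
        by (simp add: \<phi>_def act_add_right act_cscale_right v0 w0)
      also have "\<dots> = \<phi> (nn_act X z)"
        by (simp add: \<phi>_def nn_act_top1.rep_eq matrix_vector_mult_def sum_2 tr cscale_add_right
            cscale_diff_right cscale_add_left cvs.scale_left_diff_distrib cscale_minus_left algebra_simps)
      finally show ?thesis by simp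
    qed
  qed (use eq in \<open>simp_all add: \<phi>_def plus_top1.rep_eq cscale_top1.rep_eq cscale_add_left cscale_add_right act_vN1 add_ac\<close>)
  ultimately show "uea_act rho a v = uea_act rho b v" by simp
qed

section \<open>Annihilators of the highest weight vectors\<close>

lemma is_L_0_vacuum:
  assumes "is_L 0 rho v"
  shows "level_one_vacuum (\<lambda>n. rho (aff sl2_xa (n + 0))) (\<lambda>n. rho (aff sl2_xma n)) (\<lambda>n. rho (aff sl2_h n)) v"
  using is_L_module(3)[OF assms] by (simp add: level_one_vacuum_def)

text \<open>Once \<open>em1_v\<close> shows that x(-1) kills \<open>v\<close>, the spectral flow by
  1 lowers the weight of \<open>v\<close> from 1 to 0 and makes it a vacuum vector.\<close>

lemma is_L_1_modes:
  assumes "is_L 1 rho v"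
  shows "rho (aff sl2_xa (-1)) v = 0"
    and "\<exists>f h. level_one_vacuum (\<lambda>n. rho (aff sl2_xa (n + (- 1)))) f h v"
proof -
  interpret H: level_one_hw "\<lambda>n. rho (aff sl2_xa n)" "\<lambda>n. rho (aff sl2_xma n)" "\<lambda>n. rho (aff sl2_h n)" v 1
    using is_L_module(3)[OF assms] by simp
  show *: "rho (aff sl2_xa (-1)) v = 0" by (rule H.em1_v) simp
  have "level_one_hw (\<lambda>n. rho (aff sl2_xa (n - 1))) (\<lambda>n. rho (aff sl2_xma (n + 1)))
    (\<lambda>n u. rho (aff sl2_h n) u - (if n = 0 then of_int 1 else 0) *\<^sub>C u) v 0"
    by (rule H.spectral_flow_hw) (use * H.v_nonzero H.v_ops in auto)
  then have "level_one_vacuum (\<lambda>n. rho (aff sl2_xa (n + (- 1)))) (\<lambda>n. rho (aff sl2_xma (n + 1)))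
    (\<lambda>n u. rho (aff sl2_h n) u - (if n = 0 then of_int 1 else 0) *\<^sub>C u) v"
    by (simp add: level_one_vacuum_def)
  then show "\<exists>f h. level_one_vacuum (\<lambda>n. rho (aff sl2_xa (n + (- 1)))) f h v" by blast
qed

lemma annihilator_0:
  assumes "is_L 0 rho v" "a \<in> U_nbar_minus"
  shows "uea_act rho a v = 0 \<longleftrightarrow> a \<in> I_0"
proof
  note mod = is_L_module(1)[OF assms(1)] and vac = is_L_0_vacuum[OF assms(1)]
  interpret lie_module rho by (rule mod)
  obtain p where p: "p \<in> positive" "a = ev 0 p" using assms(2) by (auto simp: U_nbar_minus_eq)
  assume "uea_act rho a v = 0"
  then have "uea_act rho (ev 0 p) v = 0" by (simp add: p)
  from ev_annihilator_induct[OF mod vac p(1) this, of "\<lambda>p. ev 0 p \<in> I_0"] show "a \<in> I_0"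
    using ev_rel_ideal I_0_add by (auto simp: p(2) ev_add I_0_eq lincombs_zero)
next
  note mod = is_L_module(1)[OF assms(1)] and vac = is_L_0_vacuum[OF assms(1)]
  interpret lie_module rho by (rule mod)
  assume "a \<in> I_0"
  then show "uea_act rho a v = 0"
    unfolding I_0_eq
  proof (induction rule: lincombs_induct)
    case (add x b t)
    then have "R0 t = ev 0 (Rel (nat t))" using R0_eq[of "nat t"] by simp
    then show ?case using add ev_Rel_kills[OF mod vac] by (simp add: uea_act_add uea_act_mult)
  qed simp
qed

text \<open>The same polynomial relations give both conclusions: evaluated by \<open>ev (-1)\<close>
  they land in \<open>I_1'\<close>, and rewritten as \<open>ev 0\<close> of their shifts they land
  in \<open>I_1\<close>.\<close>

lemma annihilator_1':
  assumes "is_L 1 rho v" "a \<in> U_nbar_le_m2"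
  shows "uea_act rho a v = 0 \<longleftrightarrow> a \<in> I_1'" and "uea_act rho a v = 0 \<Longrightarrow> a \<in> I_1"
proof -
  note mod = is_L_module(1)[OF assms(1)]
  obtain f h where vac: "level_one_vacuum (\<lambda>n. rho (aff sl2_xa (n + (- 1)))) f h v"
    using is_L_1_modes(2)[OF assms(1)] by blast
  interpret lie_module rho by (rule mod)
  obtain p where p: "p \<in> positive" "a = ev (-1) p" using assms(2) by (auto simp: U_nbar_le_m2_eq)
  have ev_shift_1: "ev (-1) q = ev 0 (shift 1 q)" for q by (simp add: ev_shift)
  {
    assume "uea_act rho a v = 0"
    then have kill: "uea_act rho (ev (-1) p) v = 0" by (simp add: p)
    from ev_annihilator_induct[OF mod vac p(1) this, of "\<lambda>p. ev (-1) p \<in> I_1'"] have I_1': "a \<in> I_1'"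
      using ev_rel_ideal I_1'_add by (auto simp: p(2) ev_add I_1'_eq lincombs_zero)
    have "0 \<in> I_1"
      unfolding I_1_def using lincombs_zero[of U_nbar_minus R0 "{2..}"] U_nbar_minus_zero
      by (auto simp: I_0_eq intro!: exI[of _ "0 :: ghat uea"])
    moreover have "ev (-1) q \<in> I_1" if "q \<in> rel_ideal r n" for q r n
      unfolding ev_shift_1 by (rule ev_shift_rel_ideal[OF that])
    ultimately have "a \<in> I_1"
      using ev_annihilator_induct[OF mod vac p(1) kill, of "\<lambda>p. ev (-1) p \<in> I_1"] I_1_add
      by (auto simp: p(2) ev_add)
    with I_1' have "a \<in> I_1' \<and> a \<in> I_1" by blast
  }
  note imp = this
  then show "uea_act rho a v = 0 \<Longrightarrow> a \<in> I_1" by blast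
  have "uea_act rho a v = 0" if "a \<in> I_1'"
    using that unfolding I_1'_eq
  proof (induction rule: lincombs_induct)
    case (add x b t)
    then have "R1 t = ev (-1) (Rel (nat (t - 2)))" using R1_eq[of "nat (t - 2)"] by simp
    then show ?case using add ev_Rel_kills[OF mod vac] by (simp add: uea_act_add uea_act_mult)
  qed simp
  with imp show "uea_act rho a v = 0 \<longleftrightarrow> a \<in> I_1'" by blast
qed

text \<open>Because x(-1) kills \<open>v\<close>, an element of \<open>U_nbar_minus\<close> can be
  replaced by one of \<open>U_nbar_le_m2\<close> modulo multiples of x(-1), which \<open>I_1\<close>
  contains.\<close>

lemma annihilator_1:
  assumes "is_L 1 rho v" "a \<in> U_nbar_minus"
  shows "uea_act rho a v = 0 \<longleftrightarrow> a \<in> I_1"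
proof
  note mod = is_L_module(1)[OF assms(1)] and xa_v = is_L_1_modes(1)[OF assms(1)]
  interpret lie_module rho by (rule mod)
  have x: "uea_act rho (b * xa (-1)) v = 0" for b by (simp add: uea_act_mult xa_def xa_v)
  {
    obtain p where p: "p \<in> positive" "a = ev 0 p" using assms(2) by (auto simp: U_nbar_minus_eq)
    obtain b g where b: "b \<in> positive" "g \<in> positive" "p = shift 1 b + g * Var 1"
      using positive_decompose[OF p(1)] by blast
    have a: "a = ev (-1) b + ev 0 g * xa (-1)"
      unfolding p(2) b(3) ev_add ev_mult ev_shift by (simp add: ev_Var)
    have g: "ev 0 g \<in> U_nbar_minus" using b(2) by (simp add: U_nbar_minus_eq)
    assume "uea_act rho a v = 0"
    then have "uea_act rho (ev (-1) b) v = 0" by (simp add: a uea_act_add x)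
    moreover have "ev (-1) b \<in> U_nbar_le_m2" using b(1) by (simp add: U_nbar_le_m2_eq)
    ultimately have "ev (-1) b \<in> I_1" using annihilator_1'(2)[OF assms(1)] by blast
    moreover have "0 + ev 0 g * xa (-1) \<in> I_1"
      unfolding I_1_def I_0_eq using g lincombs_zero by blast
    ultimately show "a \<in> I_1" unfolding a using I_1_add by fastforce
  }
  assume "a \<in> I_1"
  then obtain r b where r: "a = r + b * xa (-1)" "r \<in> I_0" unfolding I_1_def by blast
  have R0: "uea_act rho (R0 t) v = 0" if "t \<ge> 2" for t
  proof -
    obtain f h where vac: "level_one_vacuum (\<lambda>n. rho (aff sl2_xa (n + (- 1)))) f h v"
      using is_L_1_modes(2)[OF assms(1)] by blast
    \<comment> \<open>Up to multiples of \<open>Var 1\<close>, a relation is the shift of the one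
      two steps below. The case \<open>k = 0\<close> is set apart because \<open>shift_Rel\<close>
      starts at 1.\<close>
    have split: "Rel (Suc (Suc k)) = (if k = 0 then Var 1 * Var 1 else shift 1 (Rel k) + 2 * Var (k + 1) * Var 1)" for k
      using Rel_2 shift_Rel[of k] by (simp add: numeral_2_eq_2 algebra_simps)
    obtain k where "t - 2 = int k"
      using \<open>t \<ge> 2\<close> zero_le_imp_eq_int[of "t - 2"] by auto
    then have t: "t = int (Suc (Suc k))" by simp
    have "R0 t = ev 0 (Rel (Suc (Suc k)))" unfolding t by (rule R0_eq)
    also have "\<exists>c. \<dots> = (if k = 0 then 0 else ev (-1) (Rel k)) + c * xa (-1)"
      unfolding split by (auto simp: ev_add ev_mult ev_shift ev_Var)
    finally obtain c where c: "R0 t = (if k = 0 then 0 else ev (-1) (Rel k)) + c * xa (-1)" by blast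
    show ?thesis
      unfolding c uea_act_add x using ev_Rel_kills[OF mod vac, of k] by simp
  qed
  have "uea_act rho r v = 0"
    using r(2) unfolding I_0_eq
    by (induction rule: lincombs_induct) (simp_all add: uea_act_add uea_act_mult R0)
  then show "uea_act rho a v = 0" by (simp add: r(1) uea_act_add x)
qed

text \<open>Knowing the value of the map on every multiple of the generator turns the kernel
  statements into statements about annihilators in \<open>U\<close>.\<close>

lemma Ker_Pi_map:
  assumes Pi: "\<And>a. P (a \<cdot> n) = uea_act rho a v" and U: "U \<subseteq> U_nbar"
    and I: "I \<subseteq> U" "\<And>a. a \<in> U \<Longrightarrow> uea_act rho a v = 0 \<longleftrightarrow> a \<in> I"
  shows "P \<in> U \<cdot>\<cdot> n \<rightarrow> principal_subspace rho v \<and> Ker_on (U \<cdot>\<cdot> n) P = I \<cdot>\<cdot> n \<and>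
    I \<cdot>\<cdot> n \<subseteq> Ker_on UNIV P"
  using assms unfolding Ker_on_def principal_subspace_def by auto

theorem theorem2p2:
  fixes rho0 :: "ghat \<Rightarrow> 'l0::complex_vs \<Rightarrow> 'l0" and v0 :: 'l0
    and rho1 :: "ghat \<Rightarrow> 'l1::complex_vs \<Rightarrow> 'l1" and v1 :: 'l1
  assumes "is_L 0 rho0 v0" and "is_L 1 rho1 v1"
  shows
    "Pi_map vN0 rho0 v0 \<in> WN0 \<rightarrow> principal_subspace rho0 v0 \<and>
     Ker_on WN0 (Pi_map vN0 rho0 v0) = I_0 \<cdot>\<cdot> vN0 \<and>
     I_0 \<cdot>\<cdot> vN0 \<subseteq> Ker_on UNIV (Pi_map vN0 rho0 v0) \<and>
     Pi_map vN1 rho1 v1 \<in> WN1' \<rightarrow> principal_subspace rho1 v1 \<and>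
     Ker_on WN1' (Pi_map vN1 rho1 v1) = I_1' \<cdot>\<cdot> vN1 \<and>
     I_1' \<cdot>\<cdot> vN1 \<subseteq> Ker_on UNIV (Pi_map vN1 rho1 v1) \<and>
     Pi_map vN1 rho1 v1 \<in> WN1 \<rightarrow> principal_subspace rho1 v1 \<and>
     Ker_on WN1 (Pi_map vN1 rho1 v1) = I_1 \<cdot>\<cdot> vN1 \<and>
     I_1 \<cdot>\<cdot> vN1 \<subseteq> Ker_on UNIV (Pi_map vN1 rho1 v1)"
proof -
  \<comment> \<open>The principal subspace is defined with all modes, whereas the annihilator is
    known inside \<open>U_nbar_minus\<close>; \<open>U_nbar_reduce\<close> bridges the two.\<close>
  have "WN0 = U_nbar_minus \<cdot>\<cdot> vN0"
    using U_nbar_reduce[OF xa_vN0] U_nbar_subsets(1) unfolding WN0_def act_vN0 by blast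
  then have L0: "Pi_map vN0 rho0 v0 \<in> WN0 \<rightarrow> principal_subspace rho0 v0 \<and>
     Ker_on WN0 (Pi_map vN0 rho0 v0) = I_0 \<cdot>\<cdot> vN0 \<and> I_0 \<cdot>\<cdot> vN0 \<subseteq> Ker_on UNIV (Pi_map vN0 rho0 v0)"
    using Ker_Pi_map[OF Pi_map_vN0[OF assms(1)] U_nbar_subsets(1) I_0_subset annihilator_0[OF assms(1)]]
    by simp
  have "WN1 = U_nbar_minus \<cdot>\<cdot> vN1"
    using U_nbar_reduce[OF xa_vN1] U_nbar_subsets(1) unfolding WN1_def act_vN1 by blast
  then have L1: "Pi_map vN1 rho1 v1 \<in> WN1 \<rightarrow> principal_subspace rho1 v1 \<and>
     Ker_on WN1 (Pi_map vN1 rho1 v1) = I_1 \<cdot>\<cdot> vN1 \<and> I_1 \<cdot>\<cdot> vN1 \<subseteq> Ker_on UNIV (Pi_map vN1 rho1 v1)"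
    using Ker_Pi_map[OF Pi_map_vN1[OF assms(2)] U_nbar_subsets(1) I_1_subset annihilator_1[OF assms(2)]]
    by simp
  have L1': "Pi_map vN1 rho1 v1 \<in> WN1' \<rightarrow> principal_subspace rho1 v1 \<and>
     Ker_on WN1' (Pi_map vN1 rho1 v1) = I_1' \<cdot>\<cdot> vN1 \<and> I_1' \<cdot>\<cdot> vN1 \<subseteq> Ker_on UNIV (Pi_map vN1 rho1 v1)"
    unfolding WN1'_def
    using Ker_Pi_map[OF Pi_map_vN1[OF assms(2)] U_nbar_subsets(2) I_1'_subset annihilator_1'(1)[OF assms(2)]]
    by simp
  from L0 L1 L1' show ?thesis by (elim conjE) (intro conjI)
qed

end
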